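(* Let $G$ be a totally nonabelian Carnot group, with finest direct product decomposition $G^1\times\dots\times G^m$, where $m>1$. Let $f:G\to G$ be a $C^1$ quasiconformal map. Then $f$ is composed of a group automorphism that permutes the groups $G^j$ and a product bi-Lipschitz map; that is, there are a group automorphism $T$ of $G$ that permutes the groups $G^j$ and maps $f^j:G^j\to G^j$ such that the map $F(p^1,\dots,p^m)=(f^1(p^1),\dots,f^m(p^m))$ is bi-Lipschitz with respect to the Carnot distance and $f=T\circ F$.
   Context: A real finite-dimensional Lie algebra $\mathfrak{g}$ (of dimension at least $3$) is stratified of step $\ell$ if $\mathfrak{g}=\mathfrak{g}_{-1}\oplus\cdots\oplus\mathfrak{g}_{-\ell}$, where $[\mathfrak{g}_{-j},\mathfrak{g}_{-1}]=\mathfrak{g}_{-j-1}$ for $1\le j\le\ell$, $\mathfrak{g}_{-\ell}\ne\{0\}$ and $\mathfrak{g}_{-\ell-1}=\{0\}$. A stratified group $G$ is a connected simply connected Lie group with stratified Lie algebra $\mathfrak{g}$; $\exp:\mathfrak{g}\to G$ is a bijection with inverse $\log$. For $s>0$ the dilation $\delta_s$ acts as $s^j$ on $\mathfrak{g}_{-j}$; also write $\delta_s=\exp\circ\,\delta_s\circ\log$ on $G$. $\mathrm{Aut}^\delta(G)$ is the group of automorphisms of $G$ commuting with dilations. A Carnot group is a stratified group with a fixed scalar product on $\mathfrak{g}_{-1}$, left-translated to the horizontal bundle $H_pG=(L_p)_*(\mathfrak{g}_{-1})$ (where $L_pq=pq$), and equipped with the distance $\varrho(p,q)$ equal to the infimum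 of lengths of smooth curves from $p$ to $q$ tangent to the horizontal bundle. $G$ is totally nonabelian if $\mathfrak{g}_{-1}$ meets the centre of $\mathfrak{g}$ only in $0$. In that case $\mathfrak{g}$ has a finest direct sum decomposition $\mathfrak{g}=\bigoplus_{k=1}^m\mathfrak{g}^k$ into nontrivial, pairwise commuting, totally nonabelian stratified Lie algebras, characterised by: for any direct sum decomposition $\mathfrak{g}=\bigoplus_l\tilde{\mathfrak{g}}^l$ into ideals, $\{1,\dots,m\}$ is partitioned into sets $J_l$ with $\tilde{\mathfrak{g}}^l=\bigoplus_{j\in J_l}\mathfrak{g}^j$. The corresponding decomposition $G=G^1\times\dots\times G^m$ is the finest direct product decomposition of $G$. Quasiconformality: for a map $f:\Omega\to G$ on a nonempty connected open set $\Omega\subseteq G$, $p\in\Omega$, $s>0$, put $$H(f,p,s)=\frac{\sup\{\varrho(f(x),f(p)):x\in\Omega,\ \varrho(x,p)\le s\}}{\inf\{\varrho(f(x),f(p)):x\in\Omega,\ \varrho(x,p)\ge s\}}.$$ $f$ is $\lambda$-quasiconformal in $\Omega$ (where $\lambda\ge1$) if $\limsup_{s\to0+}H(f,p,s)\le\lambda$ for all $p\in\Omega$, and quasiconformal if it is $\lambda$-quasiconformal for some $\lambda$. A group automorphism that permutes the groups $G^j$ is $T\in\mathrm{Aut}^\delta(G)$ for which there is a permutation $\sigma$ of $\{1,\dots,m\}$ with $T(G^j)=G^{\sigma(j)}$ for all $j$. *)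

theory Defs
  imports "HOL-Analysis.Analysis" "HOL-Algebra.Group"
begin

text \<open>
  The Lie algebra \<open>\<gg>\<close> is a type of class \<open>euclidean_space\<close> (its underlying real vector space)
  with a bracket \<open>br\<close>; \<open>V j\<close> stands for the layer of degree \<open>-j\<close>, and \<open>l\<close> for the step.
  The group \<open>G\<close> is an abstract group, and \<open>ex\<close> its exponential map, whose inverse is the
  global chart that gives the manifold structure of \<open>G\<close>.
\<close>

section \<open>Stratified Lie algebras\<close>

definition lie_bracket :: "('a::euclidean_space \<Rightarrow> 'a \<Rightarrow> 'a) \<Rightarrow> bool" where
  "lie_bracket br \<longleftrightarrow>
     bilinear br \<and> (\<forall>x. br x x = 0) \<and>
     (\<forall>x y z. br x (br y z) + br y (br z x) + br z (br x y) = 0)"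

definition direct_sum :: "nat set \<Rightarrow> (nat \<Rightarrow> 'a::euclidean_space set) \<Rightarrow> 'a set \<Rightarrow> bool" where
  "direct_sum I W L \<longleftrightarrow>
     (\<forall>i\<in>I. subspace (W i) \<and> W i \<subseteq> L) \<and>
     (\<forall>x\<in>L. \<exists>!u. u \<in> (\<Pi>\<^sub>E i\<in>I. W i) \<and> x = (\<Sum>i\<in>I. u i))"

definition component :: "nat set \<Rightarrow> (nat \<Rightarrow> 'a::euclidean_space set) \<Rightarrow> 'a \<Rightarrow> nat \<Rightarrow> 'a" where
  "component I W x = (THE u. u \<in> (\<Pi>\<^sub>E i\<in>I. W i) \<and> x = (\<Sum>i\<in>I. u i))"

text \<open>Stated for a subspace \<open>L\<close>, so that it also applies to the summands of a Lie algebra.\<close>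

definition stratified_algebra ::
    "('a::euclidean_space \<Rightarrow> 'a \<Rightarrow> 'a) \<Rightarrow> 'a set \<Rightarrow> (nat \<Rightarrow> 'a set) \<Rightarrow> nat \<Rightarrow> bool" where
  "stratified_algebra br L V l \<longleftrightarrow>
     lie_bracket br \<and> subspace L \<and> (\<forall>x\<in>L. \<forall>y\<in>L. br x y \<in> L) \<and> 3 \<le> dim L \<and>
     direct_sum {1..l} V L \<and>
     (\<forall>j\<in>{1..l}. span {br x y | x y. x \<in> V j \<and> y \<in> V 1} = V (Suc j)) \<and>
     V l \<noteq> {0} \<and> V (Suc l) = {0}"

definition lie_center :: "('a::euclidean_space \<Rightarrow> 'a \<Rightarrow> 'a) \<Rightarrow> 'a set \<Rightarrow> 'a set" where
  "lie_center br L = {z \<in> L. \<forall>x\<in>L. br z x = 0}"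

definition totally_nonabelian ::
    "('a::euclidean_space \<Rightarrow> 'a \<Rightarrow> 'a) \<Rightarrow> 'a set \<Rightarrow> (nat \<Rightarrow> 'a set) \<Rightarrow> bool" where
  "totally_nonabelian br L V \<longleftrightarrow> V 1 \<inter> lie_center br L = {0}"

definition dilation :: "(nat \<Rightarrow> 'a::euclidean_space set) \<Rightarrow> nat \<Rightarrow> real \<Rightarrow> 'a \<Rightarrow> 'a" where
  "dilation V l s x = (\<Sum>j\<in>{1..l}. s ^ j *\<^sub>R component {1..l} V x j)"

section \<open>The finest direct sum decomposition\<close>

definition graded_ideal ::
    "('a::euclidean_space \<Rightarrow> 'a \<Rightarrow> 'a) \<Rightarrow> (nat \<Rightarrow> 'a set) \<Rightarrow> nat \<Rightarrow> 'a set \<Rightarrow> bool" where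
  "graded_ideal br V l h \<longleftrightarrow>
     subspace h \<and> (\<forall>x\<in>h. \<forall>y. br x y \<in> h) \<and>
     (\<forall>x\<in>h. \<forall>j\<in>{1..l}. component {1..l} V x j \<in> h)"

text \<open>
  The decompositions that are compared with the finest one are those of \<open>\<gg>\<close> as a stratified
  algebra, that is, into graded ideals.  With ungraded ideals no decomposition with more than one
  summand would qualify: a nonzero linear map \<open>\<phi>\<close> from the first summand into the centre of the
  second that kills commutators gives the complementary ideal \<open>{x + \<phi> x}\<close>, which is not a sum of
  the given summands.
\<close>

definition finest_decomposition ::
    "('a::euclidean_space \<Rightarrow> 'a \<Rightarrow> 'a) \<Rightarrow> (nat \<Rightarrow> 'a set) \<Rightarrow> nat \<Rightarrow> nat \<Rightarrow> (nat \<Rightarrow> 'a set) \<Rightarrow> bool"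
  where
  "finest_decomposition br V l m g \<longleftrightarrow>
     direct_sum {1..m} g UNIV \<and>
     (\<forall>k\<in>{1..m}. g k \<noteq> {0} \<and>
        (\<exists>lk. stratified_algebra br (g k) (\<lambda>j. g k \<inter> V j) lk) \<and>
        totally_nonabelian br (g k) (\<lambda>j. g k \<inter> V j)) \<and>
     (\<forall>i\<in>{1..m}. \<forall>k\<in>{1..m}. i \<noteq> k \<longrightarrow> (\<forall>x\<in>g i. \<forall>y\<in>g k. br x y = 0)) \<and>
     (\<forall>n h. direct_sum {1..n} h UNIV \<and> (\<forall>i\<in>{1..n}. graded_ideal br V l (h i)) \<longrightarrow>
        (\<exists>J. disjoint_family_on J {1..n} \<and> (\<Union>i\<in>{1..n}. J i) = {1..m} \<and>
             (\<forall>i\<in>{1..n}. h i = span (\<Union>k\<in>J i. g k))))"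

section \<open>Stratified groups\<close>

text \<open>\<open>C\<^sup>k\<close> maps between Euclidean spaces: all directional derivatives are \<open>C\<^sup>k\<^sup>-\<^sup>1\<close>.\<close>

primrec Ck :: "nat \<Rightarrow> ('b::euclidean_space \<Rightarrow> 'c::euclidean_space) \<Rightarrow> bool" where
  "Ck 0 f \<longleftrightarrow> continuous_on UNIV f"
| "Ck (Suc k) f \<longleftrightarrow>
     (\<forall>x. f differentiable (at x)) \<and> (\<forall>v. Ck k (\<lambda>x. frechet_derivative f (at x) v))"

definition smooth :: "('b::euclidean_space \<Rightarrow> 'c::euclidean_space) \<Rightarrow> bool" where
  "smooth f \<longleftrightarrow> (\<forall>k. Ck k f)"

definition glog :: "('a \<Rightarrow> 'g) \<Rightarrow> 'g \<Rightarrow> 'a" where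
  "glog ex = inv_into UNIV ex"

text \<open>
  The value at \<open>p\<close> of the left-invariant vector field of \<open>x\<close>, i.e. \<open>(L\<^sub>p)\<^sub>* x\<close>, in the chart
  \<open>glog ex\<close>.
\<close>

definition left_translate ::
    "'g monoid \<Rightarrow> ('a::euclidean_space \<Rightarrow> 'g) \<Rightarrow> 'g \<Rightarrow> 'a \<Rightarrow> 'a" where
  "left_translate G ex p x = vector_derivative (\<lambda>t. glog ex (p \<otimes>\<^bsub>G\<^esub> ex (t *\<^sub>R x))) (at 0)"

text \<open>
  \<open>G\<close> is a Lie group with Lie algebra \<open>\<gg>\<close> and exponential map \<open>ex\<close>, the latter being a global
  diffeomorphism, as it is for every connected simply connected nilpotent Lie group.  (Conversely,
  the chart makes \<open>G\<close> connected and simply connected.)  The last conjunct says that \<open>br\<close> is the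
  commutator of left-invariant vector fields, evaluated at the identity.
\<close>

definition lie_group_exp ::
    "'g monoid \<Rightarrow> ('a::euclidean_space \<Rightarrow> 'g) \<Rightarrow> ('a \<Rightarrow> 'a \<Rightarrow> 'a) \<Rightarrow> bool" where
  "lie_group_exp G ex br \<longleftrightarrow>
     group G \<and> bij_betw ex UNIV (carrier G) \<and>
     smooth (\<lambda>(x, y). glog ex (ex x \<otimes>\<^bsub>G\<^esub> ex y)) \<and>
     smooth (\<lambda>x. glog ex (m_inv G (ex x))) \<and>
     (\<forall>x s t. ex ((s + t) *\<^sub>R x) = ex (s *\<^sub>R x) \<otimes>\<^bsub>G\<^esub> ex (t *\<^sub>R x)) \<and>
     (\<forall>x y. br x y =
        frechet_derivative (\<lambda>p. left_translate G ex (ex p) y) (at 0) x -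
        frechet_derivative (\<lambda>p. left_translate G ex (ex p) x) (at 0) y)"

text \<open>
  The scalar product of a Carnot group is the restriction to \<open>V 1\<close> of the inner product of the
  type; no relation between that inner product and the other layers is assumed.
\<close>

definition carnot_group ::
    "'g monoid \<Rightarrow> ('a::euclidean_space \<Rightarrow> 'g) \<Rightarrow> ('a \<Rightarrow> 'a \<Rightarrow> 'a) \<Rightarrow> (nat \<Rightarrow> 'a set) \<Rightarrow> nat \<Rightarrow> bool"
  where
  "carnot_group G ex br V l \<longleftrightarrow> stratified_algebra br UNIV V l \<and> lie_group_exp G ex br"

definition group_dilation ::
    "('a::euclidean_space \<Rightarrow> 'g) \<Rightarrow> (nat \<Rightarrow> 'a set) \<Rightarrow> nat \<Rightarrow> real \<Rightarrow> 'g \<Rightarrow> 'g" where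
  "group_dilation ex V l s p = ex (dilation V l s (glog ex p))"

definition aut_dilation ::
    "'g monoid \<Rightarrow> ('a::euclidean_space \<Rightarrow> 'g) \<Rightarrow> (nat \<Rightarrow> 'a set) \<Rightarrow> nat \<Rightarrow> ('g \<Rightarrow> 'g) set" where
  "aut_dilation G ex V l =
     {T. T \<in> iso G G \<and>
         smooth (glog ex \<circ> T \<circ> ex) \<and> smooth (glog ex \<circ> inv_into (carrier G) T \<circ> ex) \<and>
         (\<forall>s>0. \<forall>p\<in>carrier G. T (group_dilation ex V l s p) = group_dilation ex V l s (T p))}"

definition C1_map :: "('a::euclidean_space \<Rightarrow> 'g) \<Rightarrow> ('g \<Rightarrow> 'g) \<Rightarrow> bool" where
  "C1_map ex f \<longleftrightarrow> Ck 1 (glog ex \<circ> f \<circ> ex)"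

section \<open>The Carnot distance\<close>

text \<open>
  \<open>horizontal_curve G ex V \<gamma> X\<close>: on \<open>{0..1}\<close>, \<open>\<gamma>\<close> is tangent to the horizontal bundle, with
  velocity \<open>(L\<^bsub>\<gamma> t\<^esub>)\<^sub>* (X t)\<close> where \<open>X t \<in> V 1\<close>.  The field \<open>X\<close> is determined by \<open>\<gamma>\<close>, and
  \<open>norm (X t)\<close> is the length of the velocity in the left-invariant metric.  A smooth curve on
  \<open>{0..1}\<close> is the restriction of a smooth curve on the real line.
\<close>

definition horizontal_curve ::
    "'g monoid \<Rightarrow> ('a::euclidean_space \<Rightarrow> 'g) \<Rightarrow> (nat \<Rightarrow> 'a set) \<Rightarrow> (real \<Rightarrow> 'g) \<Rightarrow> (real \<Rightarrow> 'a) \<Rightarrow> bool"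
  where
  "horizontal_curve G ex V \<gamma> X \<longleftrightarrow>
     (\<forall>t. \<gamma> t \<in> carrier G) \<and> smooth (glog ex \<circ> \<gamma>) \<and>
     (\<forall>t\<in>{0..1}. X t \<in> V 1 \<and>
        ((glog ex \<circ> \<gamma>) has_vector_derivative left_translate G ex (\<gamma> t) (X t)) (at t))"

definition carnot_dist ::
    "'g monoid \<Rightarrow> ('a::euclidean_space \<Rightarrow> 'g) \<Rightarrow> (nat \<Rightarrow> 'a set) \<Rightarrow> 'g \<Rightarrow> 'g \<Rightarrow> real" where
  "carnot_dist G ex V p q =
     Inf {integral {0..1} (\<lambda>t. norm (X t)) | \<gamma> X.
            horizontal_curve G ex V \<gamma> X \<and> \<gamma> 0 = p \<and> \<gamma> 1 = q}"

definition bi_lipschitz ::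
    "'g monoid \<Rightarrow> ('a::euclidean_space \<Rightarrow> 'g) \<Rightarrow> (nat \<Rightarrow> 'a set) \<Rightarrow> ('g \<Rightarrow> 'g) \<Rightarrow> bool" where
  "bi_lipschitz G ex V F \<longleftrightarrow>
     (\<exists>K\<ge>1. \<forall>p\<in>carrier G. \<forall>q\<in>carrier G.
        carnot_dist G ex V p q / K \<le> carnot_dist G ex V (F p) (F q) \<and>
        carnot_dist G ex V (F p) (F q) \<le> K * carnot_dist G ex V p q)"

section \<open>Quasiconformal maps\<close>

text \<open>
  The quotient is taken to be infinite whenever its denominator vanishes; with the convention
  \<open>0 / 0 = 0\<close> of \<open>ennreal\<close>, constant maps would be quasiconformal.
\<close>

definition distortion ::
    "'g monoid \<Rightarrow> ('a::euclidean_space \<Rightarrow> 'g) \<Rightarrow> (nat \<Rightarrow> 'a set) \<Rightarrow> 'g set \<Rightarrow> ('g \<Rightarrow> 'g) \<Rightarrow> 'g \<Rightarrow> real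
      \<Rightarrow> ennreal" where
  "distortion G ex V \<Omega> f p s =
     (let a = (SUP x\<in>{x \<in> \<Omega>. carnot_dist G ex V x p \<le> s}. ennreal (carnot_dist G ex V (f x) (f p)));
          b = (INF x\<in>{x \<in> \<Omega>. carnot_dist G ex V x p \<ge> s}. ennreal (carnot_dist G ex V (f x) (f p)))
      in if b = 0 then \<infinity> else a / b)"

definition quasiconformal_with ::
    "'g monoid \<Rightarrow> ('a::euclidean_space \<Rightarrow> 'g) \<Rightarrow> (nat \<Rightarrow> 'a set) \<Rightarrow> real \<Rightarrow> 'g set \<Rightarrow> ('g \<Rightarrow> 'g)
      \<Rightarrow> bool" where
  "quasiconformal_with G ex V K \<Omega> f \<longleftrightarrow>
     \<Omega> \<noteq> {} \<and> \<Omega> \<subseteq> carrier G \<and> open (glog ex ` \<Omega>) \<and> connected (glog ex ` \<Omega>) \<and>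
     f \<in> \<Omega> \<rightarrow> carrier G \<and>
     (\<forall>p\<in>\<Omega>. Limsup (at_right 0) (distortion G ex V \<Omega> f p) \<le> ennreal K)"

definition quasiconformal ::
    "'g monoid \<Rightarrow> ('a::euclidean_space \<Rightarrow> 'g) \<Rightarrow> (nat \<Rightarrow> 'a set) \<Rightarrow> 'g set \<Rightarrow> ('g \<Rightarrow> 'g) \<Rightarrow> bool" where
  "quasiconformal G ex V \<Omega> f \<longleftrightarrow> (\<exists>K\<ge>1. quasiconformal_with G ex V K \<Omega> f)"

section \<open>Direct products\<close>

text \<open>
  The element \<open>(p\<^sup>1, \<dots>, p\<^sup>m)\<close> of the internal direct product of \<open>m\<close> commuting subgroups is the
  product of the \<open>p\<^sup>j\<close> in \<open>G\<close>.
\<close>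

definition tuple :: "'g monoid \<Rightarrow> nat \<Rightarrow> (nat \<Rightarrow> 'g) \<Rightarrow> 'g" where
  "tuple G m p = foldr (\<lambda>j q. p j \<otimes>\<^bsub>G\<^esub> q) [1..<Suc m] \<one>\<^bsub>G\<^esub>"

end

(* Working in the chart log, a map f as in the theorem is shown to be contact, directly from the
   distortion inequality: in a direction of the last layer the increment of f at Carnot distance s
   has Carnot size O(s), so the same holds in horizontal directions.  Its Pansu differential at p,
   the limit of the rescaled increments, is therefore a homomorphism that commutes with dilations;
   it is linear by the Trotter formula, hence induces a graded endomorphism of the Lie algebra.
   Where it does not vanish it is an automorphism and, the decomposition being the finest, permutes
   the factors.  Moving p along one factor does not change the differential on the other ones.
   Since there are at least two factors, the differential vanishes nowhere, the permutation is
   constant, f splits, and quasiconformality bounds the stretching in each factor by the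
   stretching in another one, which does not depend on the same variable.  So f is infinitesimally,
   hence (lifting horizontal curves through the open map f) globally bi-Lipschitz. *)
theory Submission
  imports Defs
begin

text \<open>The group law is known only as a smooth map for which rays are one-parameter subgroups;
  no closed formula is at hand. Its link with the bracket comes from two facts: the mixed
  second-order term of the product at \<open>0\<close>, and the linear differential equation of the
  Maurer-Cartan form along rays. Dilations then turn small-o estimates at \<open>0\<close> into
  exact statements about layers. Two features of the hypothesis on \<open>f\<close> shape the
  analysis. The scale below which the distortion inequality holds depends on the point, without
  uniformity, so global bounds are assembled along curves. And \<open>f\<close> is not assumed onto,
  so a horizontal curve joining two values of \<open>f\<close> may a priori leave the range; it
  cannot, because its lift stays in a bounded set. Injectivity comes from the convention that the
  distortion is infinite where its denominator vanishes. As \<open>f\<close> is \<open>C1\<close>,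
  its ordinary differential on \<open>V 1\<close> already is the horizontal part of the Pansu
  differential and is continuous in the point, which makes the permutation locally constant. The
  automorphism split off at the end is the Pansu differential at \<open>0\<close>.\<close>

section \<open>Calculus of \<open>Ck\<close> and smooth maps\<close>

lemma Ck_Suc_has_derivative:
  assumes "Ck (Suc k) f"
  shows "(f has_derivative frechet_derivative f (at x)) (at x)"
  using assms by (auto simp: frechet_derivative_works)

lemma Ck_SucI:
  assumes "\<And>x. (f has_derivative f' x) (at x)" and "\<And>v. Ck k (\<lambda>x. f' x v)"
  shows "Ck (Suc k) f"
proof -
  have "frechet_derivative f (at x) = f' x" for x
    using assms(1) frechet_derivative_at by metis
  then show ?thesis using assms by (auto simp: differentiable_def)
qed

lemma Ck_Suc_imp: "Ck (Suc k) f \<Longrightarrow> Ck k f"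
proof (induction k arbitrary: f)
  case 0
  then show ?case
    using differentiable_imp_continuous_within by (simp add: continuous_on_eq_continuous_within) blast
next
  case (Suc k)
  then show ?case by (metis Ck.simps(2))
qed

lemma Ck_continuous: "Ck k f \<Longrightarrow> continuous_on UNIV f"
  by (induction k arbitrary: f) (simp, use Ck_Suc_imp in blast)

lemma Ck_const: "Ck k (\<lambda>x. c)"
proof (induction k arbitrary: c)
  case (Suc k)
  show ?case by (rule Ck_SucI, rule has_derivative_const, rule Suc)
qed simp

lemma Ck_bounded_linear:
  assumes "bounded_linear A" shows "Ck k f \<Longrightarrow> Ck k (\<lambda>x. A (f x))"
proof (induction k arbitrary: f)
  case 0
  then show ?case using assms by (auto intro: bounded_linear.continuous_on)
next
  case (Suc k)
  note d = Ck_Suc_has_derivative[OF Suc.prems]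
  show ?case
  proof (rule Ck_SucI)
    show "((\<lambda>x. A (f x)) has_derivative (\<lambda>v. A (frechet_derivative f (at x) v))) (at x)" for x
      by (rule bounded_linear.has_derivative[OF assms d])
    show "Ck k (\<lambda>x. A (frechet_derivative f (at x) v))" for v
      using Suc by auto
  qed
qed

lemma Ck_ident: "Ck k (\<lambda>x. x)"
proof (cases k)
  case (Suc j)
  show ?thesis unfolding Suc by (rule Ck_SucI, rule has_derivative_ident, rule Ck_const)
qed simp

lemma Ck_linear: "bounded_linear A \<Longrightarrow> Ck k A"
  using Ck_bounded_linear[OF _ Ck_ident] by auto

lemma Ck_add: "Ck k f \<Longrightarrow> Ck k g \<Longrightarrow> Ck k (\<lambda>x. f x + g x)"
proof (induction k arbitrary: f g)
  case 0
  then show ?case by (simp add: continuous_on_add)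
next
  case (Suc k)
  note d = Ck_Suc_has_derivative[OF Suc.prems(1)] Ck_Suc_has_derivative[OF Suc.prems(2)]
  show ?case
    by (rule Ck_SucI, rule has_derivative_add[OF d]) (use Suc in auto)
qed

lemma Ck_sum: "finite I \<Longrightarrow> (\<And>i. i \<in> I \<Longrightarrow> Ck k (f i)) \<Longrightarrow> Ck k (\<lambda>x. \<Sum>i\<in>I. f i x)"
  by (induction I rule: finite_induct) (auto intro: Ck_const Ck_add)

lemma Ck_bilinear:
  assumes "bounded_bilinear P"
  shows "Ck k f \<Longrightarrow> Ck k g \<Longrightarrow> Ck k (\<lambda>x. P (f x) (g x))"
proof (induction k arbitrary: f g)
  case 0
  then show ?case using assms by (auto intro: bounded_bilinear.continuous_on)
next
  case (Suc k)
  note d = Ck_Suc_has_derivative[OF Suc.prems(1)] Ck_Suc_has_derivative[OF Suc.prems(2)]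
  show ?case
  proof (rule Ck_SucI, rule bounded_bilinear.FDERIV[OF assms d])
    show "Ck k (\<lambda>x. P (f x) (frechet_derivative g (at x) v) + P (frechet_derivative f (at x) v) (g x))"
      for v
      using Suc.prems by (intro Ck_add Suc.IH) (auto intro: Ck_Suc_imp)
  qed
qed

text \<open>\<open>Ck\<close> controls derivatives in fixed directions only. Expanding a direction
  in \<open>Basis\<close> turns a derivative in a moving direction into a finite sum of such
  derivatives with scalar coefficients.\<close>

lemma frechet_derivative_basis:
  fixes f :: "'b::euclidean_space \<Rightarrow> 'c::euclidean_space"
  assumes "f differentiable (at x)"
  shows "frechet_derivative f (at x) v = (\<Sum>b\<in>Basis. (v \<bullet> b) *\<^sub>R frechet_derivative f (at x) b)"
proof -
  have l: "linear (frechet_derivative f (at x))"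
    using assms by (simp add: linear_frechet_derivative)
  have "frechet_derivative f (at x) v = frechet_derivative f (at x) (\<Sum>b\<in>Basis. (v \<bullet> b) *\<^sub>R b)"
    by (simp add: euclidean_representation)
  also have "\<dots> = (\<Sum>b\<in>Basis. (v \<bullet> b) *\<^sub>R frechet_derivative f (at x) b)"
    using l by (simp add: linear_sum linear_cmul)
  finally show ?thesis .
qed

lemma Ck_compose:
  fixes f :: "'b::euclidean_space \<Rightarrow> 'c::euclidean_space" and g :: "'c \<Rightarrow> 'd::euclidean_space"
  shows "Ck k f \<Longrightarrow> Ck k g \<Longrightarrow> Ck k (\<lambda>x. g (f x))"
proof (induction k arbitrary: g)
  case 0
  then show ?case
    by (auto intro: continuous_on_compose2)
next
  case (Suc k)
  note df = Ck_Suc_has_derivative[OF Suc.prems(1)]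
  note dg = Ck_Suc_has_derivative[OF Suc.prems(2)]
  show ?case
  proof (rule Ck_SucI)
    show "((\<lambda>x. g (f x)) has_derivative
        (\<lambda>v. frechet_derivative g (at (f x)) (frechet_derivative f (at x) v))) (at x)" for x
      by (rule has_derivative_compose[OF df dg])
    \<comment> \<open>The direction moves with \<open>x\<close>, so the chain rule is rewritten as a
      sum of products of \<open>Ck k\<close> functions; the induction keeps \<open>g\<close>
      arbitrary in order to reach the directional derivatives of \<open>g\<close>.\<close>
    have "Ck k (\<lambda>x. \<Sum>b\<in>Basis. (frechet_derivative f (at x) v \<bullet> b) *\<^sub>R frechet_derivative g (at (f x)) b)"
      for v
    proof (intro Ck_sum Ck_bilinear[OF bounded_bilinear_scaleR])
      show "Ck k (\<lambda>x. frechet_derivative f (at x) v \<bullet> b)" for b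
        using Suc.prems by (intro Ck_bounded_linear[OF bounded_linear_inner_left]) auto
      show "Ck k (\<lambda>x. frechet_derivative g (at (f x)) b)" for b
        using Suc.prems by (intro Suc.IH[OF Ck_Suc_imp]) auto
    qed auto
    moreover have "(\<lambda>x. frechet_derivative g (at (f x)) (frechet_derivative f (at x) v))
        = (\<lambda>x. \<Sum>b\<in>Basis. (frechet_derivative f (at x) v \<bullet> b) *\<^sub>R frechet_derivative g (at (f x)) b)"
      for v
      using Suc.prems(2) by (intro ext frechet_derivative_basis) auto
    ultimately show "Ck k (\<lambda>x. frechet_derivative g (at (f x)) (frechet_derivative f (at x) v))" for v
      by metis
  qed
qed

text \<open>Joint continuity in the point and the direction. It makes the velocities of smooth
  curves and the differential of \<open>f\<close> continuous.\<close>

lemma C1_derivative_continuous: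
  fixes f :: "'b::euclidean_space \<Rightarrow> 'c::euclidean_space"
  assumes "Ck 1 f" and "continuous_on S g" and "continuous_on S h"
  shows "continuous_on S (\<lambda>z. frechet_derivative f (at (g z)) (h z))"
proof -
  have c: "continuous_on UNIV (\<lambda>x. frechet_derivative f (at x) b)" for b
    using assms(1) by auto
  have "frechet_derivative f (at (g z)) (h z)
      = (\<Sum>b\<in>Basis. (h z \<bullet> b) *\<^sub>R frechet_derivative f (at (g z)) b)" for z
    using assms(1) by (intro frechet_derivative_basis) auto
  moreover have "continuous_on S (\<lambda>z. \<Sum>b\<in>Basis. (h z \<bullet> b) *\<^sub>R frechet_derivative f (at (g z)) b)"
    using assms(2,3) by (intro continuous_intros continuous_on_compose2[OF c]) auto
  ultimately show ?thesis by (rule continuous_on_eq[rotated, OF sym])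
qed

lemma smooth_Ck: "smooth f \<Longrightarrow> Ck k f"
  by (simp add: smooth_def)

lemma smooth_has_derivative: "smooth f \<Longrightarrow> (f has_derivative frechet_derivative f (at x)) (at x)"
  using Ck_Suc_has_derivative smooth_Ck by blast

lemma smooth_const: "smooth (\<lambda>x. c)"
  by (simp add: smooth_def Ck_const)

lemma smooth_linear: "bounded_linear A \<Longrightarrow> smooth A"
  by (simp add: smooth_def Ck_linear)

lemma smooth_add: "smooth f \<Longrightarrow> smooth g \<Longrightarrow> smooth (\<lambda>x. f x + g x)"
  by (simp add: smooth_def Ck_add)

lemma smooth_compose: "smooth f \<Longrightarrow> smooth g \<Longrightarrow> smooth (\<lambda>x. g (f x))"
  by (simp add: smooth_def Ck_compose)

lemma smooth_bounded_linear: "bounded_linear A \<Longrightarrow> smooth f \<Longrightarrow> smooth (\<lambda>x. A (f x))"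
  by (simp add: smooth_def Ck_bounded_linear)

lemma smooth_Pair: "smooth f \<Longrightarrow> smooth g \<Longrightarrow> smooth (\<lambda>x. (f x, g x))"
proof -
  assume "smooth f" "smooth g"
  then have "smooth (\<lambda>x. (f x, 0) + (0, g x))"
    by (intro smooth_add smooth_bounded_linear[of "\<lambda>y. (y, 0)"] smooth_bounded_linear[of "\<lambda>y. (0, y)"])
      (auto intro!: bounded_linear_intros)
  then show ?thesis by simp
qed

lemma smooth_affine: "smooth (\<lambda>t::real. a + t *\<^sub>R b)"
  by (intro smooth_add smooth_const smooth_linear bounded_linear_intros)

lemma smooth_vector_derivative:
  fixes c :: "real \<Rightarrow> 'b::euclidean_space"
  assumes "smooth c"
  shows "(c has_vector_derivative frechet_derivative c (at t) 1) (at t)"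
proof -
  note d = smooth_has_derivative[OF assms, of t]
  have "frechet_derivative c (at t) r = r *\<^sub>R frechet_derivative c (at t) 1" for r
    using linear_cmul[OF has_derivative_linear[OF d], of r 1] by simp
  then show ?thesis
    unfolding has_vector_derivative_def by (intro has_derivative_eq_rhs[OF d] ext)
qed

section \<open>A smooth step function\<close>

text \<open>\<open>p (1 / x) exp (-1 / x)\<close>, extended by \<open>0\<close>: a family that is closed under derivatives.\<close>

definition flat_exp :: "real poly \<Rightarrow> real \<Rightarrow> real" where
  "flat_exp p x = (if x > 0 then poly p (1 / x) * exp (- (1 / x)) else 0)"

lemma poly_exp_tendsto_0: "((\<lambda>y. poly p y * exp (- y)) \<longlongrightarrow> 0) (at_top :: real filter)"
proof -
  have "((\<lambda>y. \<Sum>i\<le>degree p. coeff p i * (y ^ i / exp y)) \<longlongrightarrow> (\<Sum>i\<le>degree p. coeff p i * 0)) at_top"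
    by (intro tendsto_intros tendsto_power_div_exp_0)
  then show ?thesis
    by (simp add: poly_altdef exp_minus divide_inverse sum_distrib_right mult.assoc)
qed

text \<open>With \<open>y = 1 / x\<close> one has \<open>y' = - y^2\<close>, so
  \<open>p y * exp (- y)\<close> has derivative \<open>(p - p') y * y^2 * exp (- y)\<close>; the
  factor \<open>[:0, 0, 1:]\<close> is \<open>y^2\<close>. At \<open>0\<close> the right-hand
  difference quotient belongs to the same family and tends to \<open>0\<close>, because the
  exponential beats every polynomial.\<close>

lemma flat_exp_has_derivative:
  "(flat_exp p has_real_derivative flat_exp ((p - pderiv p) * [:0, 0, 1:]) x) (at x)"
proof -
  consider "x > 0" | "x < 0" | "x = 0" by linarith
  then show ?thesis
  proof cases
    case 1
    have inv: "((\<lambda>x. 1 / x) has_real_derivative - (1 / x)\<^sup>2) (at x)"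
      using 1 by (auto intro!: derivative_eq_intros simp: power2_eq_square)
    have "((\<lambda>x. poly p (1 / x) * exp (- (1 / x))) has_real_derivative
        poly (pderiv p) (1 / x) * - (1 / x)\<^sup>2 * exp (- (1 / x))
        + exp (- (1 / x)) * - (- (1 / x)\<^sup>2) * poly p (1 / x)) (at x)"
      by (intro DERIV_mult DERIV_chain2[OF poly_DERIV inv] DERIV_chain2[OF DERIV_exp] DERIV_minus inv)
    moreover have "poly (pderiv p) (1 / x) * - (1 / x)\<^sup>2 * exp (- (1 / x))
        + exp (- (1 / x)) * - (- (1 / x)\<^sup>2) * poly p (1 / x)
        = flat_exp ((p - pderiv p) * [:0, 0, 1:]) x"
      using 1 by (simp add: flat_exp_def power2_eq_square algebra_simps)
    ultimately have "((\<lambda>x. poly p (1 / x) * exp (- (1 / x))) has_real_derivative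
        flat_exp ((p - pderiv p) * [:0, 0, 1:]) x) (at x)"
      by simp
    then show ?thesis
      by (rule has_field_derivative_transform_within_open[of _ _ _ "{0<..}"])
        (use 1 in \<open>auto simp: flat_exp_def\<close>)
  next
    case 2
    have "((\<lambda>x. 0) has_real_derivative 0) (at x)" by simp
    then show ?thesis
      by (rule has_field_derivative_transform_within_open[of _ _ _ "{..<0}", THEN DERIV_cong])
        (use 2 in \<open>auto simp: flat_exp_def\<close>)
  next
    case 3
    have "((\<lambda>x. poly (p * [:0, 1:]) (1 / x) * exp (- (1 / x))) \<longlongrightarrow> 0) (at_right 0)"
      using filterlim_compose[OF poly_exp_tendsto_0 filterlim_inverse_at_top_right, of "p * [:0, 1:]"]
      by (simp only: inverse_eq_divide)
    then have r: "((\<lambda>x. flat_exp p x / x) \<longlongrightarrow> 0) (at_right 0)"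
      by (rule Lim_transform_eventually)
        (auto simp: eventually_at_filter flat_exp_def field_simps)
    have l: "((\<lambda>x. flat_exp p x / x) \<longlongrightarrow> 0) (at_left 0)"
      by (rule Lim_transform_eventually[OF tendsto_const])
        (auto simp: eventually_at_filter flat_exp_def)
    have "((\<lambda>x. flat_exp p x / x) \<longlongrightarrow> 0) (at 0)"
      using l r by (rule filterlim_split_at)
    then show ?thesis
      using 3 by (simp add: has_field_derivative_iff flat_exp_def)
  qed
qed

lemma Ck_flat_exp: "Ck k (flat_exp p)"
proof (induction k arbitrary: p)
  case 0
  show ?case
    using DERIV_isCont[OF flat_exp_has_derivative] by (simp add: continuous_at_imp_continuous_on)
next
  case (Suc k)
  show ?case
    by (rule Ck_SucI, rule flat_exp_has_derivative[unfolded has_field_derivative_def],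
        rule Ck_bounded_linear[OF bounded_linear_mult_left], rule Suc)
qed

text \<open>The normalized primitive of the bump \<open>flat_exp 1 x * flat_exp 1 (1 - x)\<close>.
  It serves to reparametrize curves so that they come to rest before being joined.\<close>

lemma smooth_step_exists:
  obtains \<psi> \<psi>' :: "real \<Rightarrow> real" where "smooth \<psi>"
    and "\<And>t. (\<psi> has_real_derivative \<psi>' t) (at t)"
    and "\<And>t. 0 \<le> \<psi>' t" and "\<And>t. t \<le> 0 \<Longrightarrow> \<psi>' t = 0" and "\<And>t. t \<ge> 1 \<Longrightarrow> \<psi>' t = 0"
    and "\<And>t. t \<le> 0 \<Longrightarrow> \<psi> t = 0" and "\<And>t. t \<ge> 1 \<Longrightarrow> \<psi> t = 1"
    and "\<And>t. 0 \<le> \<psi> t" and "\<And>t. \<psi> t \<le> 1"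
proof -
  define \<beta> where "\<beta> x = flat_exp 1 x * flat_exp 1 (1 - x)" for x
  have Ck\<beta>: "Ck k \<beta>" for k
  proof -
    have "Ck k (\<lambda>x::real. 1 - x)"
      using smooth_Ck[OF smooth_affine[of "1::real" "-1"]] by simp
    then show ?thesis unfolding \<beta>_def
      by (intro Ck_bilinear[OF bounded_bilinear_mult] Ck_flat_exp Ck_compose[OF _ Ck_flat_exp, where f="\<lambda>x. 1 - x"])
  qed
  have cont: "continuous_on S \<beta>" for S
    using Ck_continuous[OF Ck\<beta>] continuous_on_subset by blast
  have nn: "\<beta> x \<ge> 0" for x by (auto simp: \<beta>_def flat_exp_def)
  have z: "\<beta> x = 0" if "x \<le> 0 \<or> x \<ge> 1" for x using that by (auto simp: \<beta>_def flat_exp_def)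
  \<comment> \<open>The lower limit \<open>-1\<close> puts \<open>0\<close> inside the interval of
    integration, so the fundamental theorem gives a two-sided derivative there.\<close>
  define \<Psi> where "\<Psi> x = integral {-1..x} \<beta>" for x
  have \<Psi>0: "\<Psi> x = 0" if "x \<le> 0" for x
  proof -
    have "\<Psi> x = integral {-1..x} (\<lambda>_. 0::real)"
      unfolding \<Psi>_def using that z by (intro integral_cong) auto
    then show ?thesis by simp
  qed
  have d: "(\<Psi> has_real_derivative \<beta> x) (at x)" for x
  proof (cases "x < 0")
    case True
    have "((\<lambda>x. 0) has_real_derivative \<beta> x) (at x)" using z True by simp
    then show ?thesis
      by (rule has_field_derivative_transform_within_open[of _ _ _ "{..<0}"])
        (use True \<Psi>0 in auto)
  next
    case False
    have "(\<Psi> has_real_derivative \<beta> x) (at x within {-1..x+1})"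
      unfolding \<Psi>_def by (rule integral_has_real_derivative[OF cont]) (use False in auto)
    then show ?thesis
      using False by (simp add: at_within_Icc_at)
  qed
  have mono: "\<Psi> x \<le> \<Psi> y" if "x \<le> y" for x y
    using d nn that by (meson DERIV_nonneg_imp_nondecreasing)
  have cst: "\<Psi> x = \<Psi> 1" if "x \<ge> 1" for x
  proof (cases "x = 1")
    case False
    then have "1 < x" using that by simp
    then show ?thesis
    proof (rule DERIV_isconst_end)
      show "continuous_on {1..x} \<Psi>"
        using d DERIV_isCont by (metis continuous_at_imp_continuous_on)
      show "(\<Psi> has_real_derivative 0) (at y)" if "1 < y" "y < x" for y
        using d[of y] z[of y] that by simp
    qed
  qed simp
  have "\<Psi> 1 \<noteq> 0"
  proof
    assume 0: "\<Psi> 1 = 0"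
    have "(\<beta> has_integral 0) (cbox 0 1)"
    proof -
      have "\<Psi> 1 = integral {-1..0} \<beta> + integral {0..1} \<beta>"
        unfolding \<Psi>_def using integrable_continuous_interval[OF cont]
        by (intro Henstock_Kurzweil_Integration.integral_combine[symmetric]) auto
      then have "integral {0..1} \<beta> = 0"
        using 0 \<Psi>0[of 0] by (simp add: \<Psi>_def)
      then show ?thesis
        using integrable_integral[OF integrable_continuous_interval[OF cont], of 0 1] by simp
    qed
    from has_integral_0_cbox_imp_0[OF cont nn this, of "1/2"]
    show False by (simp add: \<beta>_def flat_exp_def box_real)
  qed
  then have pos: "\<Psi> 1 > 0" using mono[of 0 1] \<Psi>0[of 0] by simp
  define \<psi> where "\<psi> t = \<Psi> t * (1 / \<Psi> 1)" for t
  show thesis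
  proof
    show "smooth \<psi>"
      unfolding smooth_def
    proof
      fix k
      have "Ck (Suc k) \<Psi>"
        by (rule Ck_SucI, rule d[unfolded has_field_derivative_def])
          (rule Ck_bounded_linear[OF bounded_linear_mult_left], rule Ck\<beta>)
      then have "Ck k \<Psi>" by (rule Ck_Suc_imp)
      then show "Ck k \<psi>"
        unfolding \<psi>_def by (rule Ck_bounded_linear[OF bounded_linear_mult_left])
    qed
    show "(\<psi> has_real_derivative \<beta> t * (1 / \<Psi> 1)) (at t)" for t
      unfolding \<psi>_def using d by (rule DERIV_cmult_right)
    show "0 \<le> \<beta> t * (1 / \<Psi> 1)" for t using nn pos by simp
    show "\<psi> t = 0" if "t \<le> 0" for t using \<Psi>0 that by (simp add: \<psi>_def)
    show "\<psi> t = 1" if "t \<ge> 1" for t using cst[OF that] pos by (simp add: \<psi>_def)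
    show "0 \<le> \<psi> t" for t
      using mono[of 0 t] mono[of t 0] \<Psi>0[of 0] \<Psi>0[of t] pos
      by (cases "t \<le> 0") (auto simp: \<psi>_def)
    show "\<psi> t \<le> 1" for t
      using mono[of t 1] cst[of t] pos by (cases "t \<le> 1") (auto simp: \<psi>_def)
  qed (use z in auto)
qed

section \<open>Groups in exponential coordinates\<close>

lemma mean_value_01:
  fixes g :: "real \<Rightarrow> 'b::real_normed_vector"
  assumes "\<And>t. 0 \<le> t \<Longrightarrow> t \<le> 1 \<Longrightarrow> (g has_vector_derivative g' t) (at t)"
    and "\<And>t. 0 \<le> t \<Longrightarrow> t \<le> 1 \<Longrightarrow> norm (g' t) \<le> C"
  shows "norm (g 1 - g 0) \<le> C"
proof -
  have "norm (g 1 - g 0) \<le> C * 1 - C * 0"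
  proof (rule differentiable_bound_general)
    show "continuous_on {0..1} g"
      using assms(1) by (intro continuous_at_imp_continuous_on ballI has_vector_derivative_continuous) auto
    show "((\<lambda>t. C * t) has_vector_derivative C) (at x)" for x
      by (auto intro!: derivative_eq_intros)
    show "(g has_vector_derivative g' x) (at x)" if "0 < x" "x < 1" for x using assms(1) that by simp
    show "norm (g' x) \<le> C" if "0 < x" "x < 1" for x using assms(2) that by simp
  qed (auto intro: continuous_intros)
  then show ?thesis by simp
qed

lemma has_vector_derivative_const_if_zero:
  fixes c :: "real \<Rightarrow> 'b::real_normed_vector"
  assumes "\<And>t. 0 \<le> t \<Longrightarrow> t \<le> 1 \<Longrightarrow> (c has_vector_derivative 0) (at t)"
  shows "c 1 = c 0"
  using mean_value_01[OF assms, of 0] by simp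

text \<open>A Lie group seen through its logarithm. Neutral element and inverses are not postulated:
  since each ray is a one-parameter subgroup, \<open>0\<close> is neutral and \<open>- x\<close>
  inverts \<open>x\<close>.\<close>

locale exp_chart =
  fixes mul :: "'a::euclidean_space \<Rightarrow> 'a \<Rightarrow> 'a"  (infixl \<open>\<odot>\<close> 70)
  assumes mul_assoc: "x \<odot> y \<odot> z = x \<odot> (y \<odot> z)"
    and ray_add: "(s + t) *\<^sub>R x = (s *\<^sub>R x) \<odot> (t *\<^sub>R x)"
    and smooth_mul: "smooth (\<lambda>(x, y). x \<odot> y)"
begin

lemma mul_0_right [simp]: "x \<odot> 0 = x"
  using ray_add[of 1 0 x] by simp

lemma mul_0_left [simp]: "0 \<odot> x = x"
  using ray_add[of 0 1 x] by simp

lemma mul_minus_right [simp]: "x \<odot> (- x) = 0"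
  using ray_add[of 1 "-1" x] by simp

lemma mul_minus_left [simp]: "(- x) \<odot> x = 0"
  using ray_add[of "-1" 1 x] by simp

lemma mul_cancel1 [simp]: "(- x) \<odot> (x \<odot> y) = y" "x \<odot> ((- x) \<odot> y) = y"
  by (simp_all flip: mul_assoc)

lemma mul_cancel2 [simp]: "y \<odot> (- x) \<odot> x = y" "y \<odot> x \<odot> (- x) = y"
  by (simp_all add: mul_assoc)

lemma minus_mul: "- (x \<odot> y) = (- y) \<odot> (- x)"
proof -
  have "- (x \<odot> y) = - (x \<odot> y) \<odot> (x \<odot> y) \<odot> ((- y) \<odot> (- x))"
    by (simp only: mul_assoc mul_cancel1 mul_minus_right mul_0_right)
  then show ?thesis by simp
qed

definition Dmul :: "'a \<times> 'a \<Rightarrow> 'a \<times> 'a \<Rightarrow> 'a" where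
  "Dmul z = frechet_derivative (\<lambda>(x, y). x \<odot> y) (at z)"

lemma has_derivative_mul: "((\<lambda>z. fst z \<odot> snd z) has_derivative Dmul z) (at z)"
  unfolding Dmul_def using smooth_has_derivative[OF smooth_mul] by (simp add: case_prod_unfold)

lemma linear_Dmul: "linear (Dmul z)"
  using has_derivative_linear[OF has_derivative_mul] .

lemma continuous_on_mul [continuous_intros]:
  assumes "continuous_on S f" "continuous_on S g"
  shows "continuous_on S (\<lambda>x. f x \<odot> g x)"
proof -
  have "continuous_on UNIV (\<lambda>z. fst z \<odot> snd z)"
    using Ck_continuous[OF smooth_Ck[OF smooth_mul]] by (simp add: case_prod_unfold)
  from continuous_on_compose2[OF this continuous_on_Pair[OF assms]] show ?thesis by simp
qed

lemma tendsto_mul [tendsto_intros]: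
  assumes "(f \<longlongrightarrow> x) F" "(g \<longlongrightarrow> y) F"
  shows "((\<lambda>i. f i \<odot> g i) \<longlongrightarrow> x \<odot> y) F"
proof -
  have "isCont (\<lambda>z. fst z \<odot> snd z) (x, y)"
    using has_derivative_continuous[OF has_derivative_mul] .
  from isCont_tendsto_compose[OF this tendsto_Pair[OF assms]] show ?thesis by simp
qed

lemma continuous_on_Dmul [continuous_intros]:
  assumes "continuous_on S f" "continuous_on S g"
  shows "continuous_on S (\<lambda>x. Dmul (f x) (g x))"
  unfolding Dmul_def by (rule C1_derivative_continuous[OF smooth_Ck[OF smooth_mul] assms])

lemma has_vector_derivative_mul:
  assumes "(c has_vector_derivative c') (at t within S)" "(k has_vector_derivative k') (at t within S)"
  shows "((\<lambda>s. c s \<odot> k s) has_vector_derivative Dmul (c t, k t) (c', k')) (at t within S)"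
proof -
  have "((\<lambda>s. (c s, k s)) has_vector_derivative (c', k')) (at t within S)"
    using assms by (rule has_vector_derivative_Pair)
  then have "((\<lambda>s. fst (c s, k s) \<odot> snd (c s, k s)) has_derivative (\<lambda>h. Dmul (c t, k t) (h *\<^sub>R (c', k'))))
      (at t within S)"
    unfolding has_vector_derivative_def
    by (rule has_derivative_compose) (rule has_derivative_mul)
  then show ?thesis
    by (simp add: has_vector_derivative_def linear_cmul[OF linear_Dmul] del: scaleR_Pair)
qed

lemma has_vector_derivative_mul_left:
  assumes "(c has_vector_derivative c') (at t within S)"
  shows "((\<lambda>s. p \<odot> c s) has_vector_derivative Dmul (p, c t) (0, c')) (at t within S)"
  using has_vector_derivative_mul[OF has_vector_derivative_const assms] .

lemma has_vector_derivative_mul_right: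
  assumes "(c has_vector_derivative c') (at t within S)"
  shows "((\<lambda>s. c s \<odot> p) has_vector_derivative Dmul (c t, p) (c', 0)) (at t within S)"
  using has_vector_derivative_mul[OF assms has_vector_derivative_const] .

lemma ray_vector_derivative: "((\<lambda>t. t *\<^sub>R v) has_vector_derivative v) (at t within S)"
  by (auto intro!: derivative_eq_intros)

lemma affine_vector_derivative: "((\<lambda>t. a + t *\<^sub>R v) has_vector_derivative v) (at t within S)"
  by (auto intro!: derivative_eq_intros)

lemma Dmul_0_left: "Dmul (0, x) (0, v) = v"
proof -
  have "((\<lambda>s. 0 \<odot> (x + s *\<^sub>R v)) has_vector_derivative Dmul (0, x + 0 *\<^sub>R v) (0, v)) (at 0)"
    by (rule has_vector_derivative_mul_left[OF affine_vector_derivative])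
  then show ?thesis
    using vector_derivative_unique_at[OF _ affine_vector_derivative] by simp
qed

lemma Dmul_0_right: "Dmul (x, 0) (v, 0) = v"
proof -
  have "((\<lambda>s. (x + s *\<^sub>R v) \<odot> 0) has_vector_derivative Dmul (x + 0 *\<^sub>R v, 0) (v, 0)) (at 0)"
    by (rule has_vector_derivative_mul_right[OF affine_vector_derivative])
  then show ?thesis
    using vector_derivative_unique_at[OF _ affine_vector_derivative] by simp
qed

lemma Dmul_0_0: "Dmul (0, 0) (u, v) = u + v"
  using linear_add[OF linear_Dmul, of "(0,0)" "(u, 0)" "(0, v)"] Dmul_0_left Dmul_0_right by simp

text \<open>The differential at \<open>0\<close> of left translation by \<open>p\<close>, so
  \<open>lin p v\<close> is the value at \<open>p\<close> of the left-invariant field of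
  \<open>v\<close>.\<close>

definition lin :: "'a \<Rightarrow> 'a \<Rightarrow> 'a" where "lin p v = Dmul (p, 0) (0, v)"

text \<open>The left Maurer--Cartan form.\<close>

definition mc :: "'a \<Rightarrow> 'a \<Rightarrow> 'a" where "mc p v = Dmul (- p, p) (0, v)"

lemma linear_lin: "linear (lin p)"
proof -
  have "linear (\<lambda>v::'a. (0::'a, v))" by (auto intro!: linearI)
  from linear_compose[OF this linear_Dmul] show ?thesis by (simp add: lin_def[abs_def] comp_def)
qed

lemma linear_mc: "linear (mc p)"
proof -
  have "linear (\<lambda>v::'a. (0::'a, v))" by (auto intro!: linearI)
  from linear_compose[OF this linear_Dmul] show ?thesis by (simp add: mc_def[abs_def] comp_def)
qed

lemma lin_0 [simp]: "lin 0 v = v" by (simp add: lin_def Dmul_0_left)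
lemma mc_0 [simp]: "mc 0 v = v" by (simp add: mc_def Dmul_0_left)

lemma lin_mc [simp]: "lin p (mc p v) = v"
proof -
  have "((\<lambda>s. p \<odot> ((- p) \<odot> (p + s *\<^sub>R v))) has_vector_derivative
      Dmul (p, (- p) \<odot> (p + 0 *\<^sub>R v)) (0, Dmul (- p, p + 0 *\<^sub>R v) (0, v))) (at 0)"
    by (intro has_vector_derivative_mul_left affine_vector_derivative)
  then show ?thesis
    using vector_derivative_unique_at[OF _ affine_vector_derivative] by (simp add: lin_def mc_def)
qed

lemma mc_lin [simp]: "mc p (lin p v) = v"
proof -
  have "((\<lambda>s. (- p) \<odot> (p \<odot> (s *\<^sub>R v))) has_vector_derivative
      Dmul (- p, p \<odot> (0 *\<^sub>R v)) (0, Dmul (p, 0 *\<^sub>R v) (0, v))) (at 0)"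
    by (intro has_vector_derivative_mul_left ray_vector_derivative)
  then show ?thesis
    using vector_derivative_unique_at[OF _ ray_vector_derivative] by (simp add: lin_def mc_def)
qed

lemma continuous_on_lin [continuous_intros]:
  "continuous_on S f \<Longrightarrow> continuous_on S g \<Longrightarrow> continuous_on S (\<lambda>x. lin (f x) (g x))"
  unfolding lin_def by (intro continuous_intros)

lemma continuous_on_mc [continuous_intros]:
  "continuous_on S f \<Longrightarrow> continuous_on S g \<Longrightarrow> continuous_on S (\<lambda>x. mc (f x) (g x))"
  unfolding mc_def by (intro continuous_intros)

text \<open>The velocity of a curve carried back to the identity by left translation, that is, its
  logarithmic derivative.\<close>

definition has_lvel :: "(real \<Rightarrow> 'a) \<Rightarrow> 'a \<Rightarrow> real \<Rightarrow> bool" where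
  "has_lvel c w t \<longleftrightarrow> (c has_vector_derivative lin (c t) w) (at t)"

text \<open>Translating the curve so that it passes through \<open>0\<close> at time
  \<open>t\<close> removes \<open>lin\<close> from the statement. Invariance and product rules then
  come down to algebra in the group.\<close>

lemma has_lvel_iff:
  "has_lvel c w t \<longleftrightarrow> ((\<lambda>s. (- c t) \<odot> c s) has_vector_derivative w) (at t)"
proof
  assume "has_lvel c w t"
  then have "((\<lambda>s. (- c t) \<odot> c s) has_vector_derivative mc (c t) (lin (c t) w)) (at t)"
    unfolding has_lvel_def mc_def by (rule has_vector_derivative_mul_left)
  then show "((\<lambda>s. (- c t) \<odot> c s) has_vector_derivative w) (at t)" by simp
next
  assume "((\<lambda>s. (- c t) \<odot> c s) has_vector_derivative w) (at t)"
  from has_vector_derivative_mul_left[OF this, of "c t"]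
  show "has_lvel c w t" by (simp add: has_lvel_def lin_def)
qed

lemma has_lvelI: "(c has_vector_derivative v) (at t) \<Longrightarrow> has_lvel c (mc (c t) v) t"
  by (simp add: has_lvel_def)

lemma has_lvel_unique: "has_lvel c v t \<Longrightarrow> has_lvel c w t \<Longrightarrow> v = w"
  unfolding has_lvel_iff by (rule vector_derivative_unique_at)

lemma has_lvel_ray: "has_lvel (\<lambda>t. t *\<^sub>R x) x t"
proof -
  have eq: "(- (t *\<^sub>R x)) \<odot> (s *\<^sub>R x) = (- t) *\<^sub>R x + s *\<^sub>R x" for s
    using ray_add[of "- t" s x] by (simp add: algebra_simps)
  show ?thesis
    unfolding has_lvel_iff eq by (rule affine_vector_derivative)
qed

lemma has_lvel_mul_left: "has_lvel c w t \<Longrightarrow> has_lvel (\<lambda>s. p \<odot> c s) w t"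
  unfolding has_lvel_iff by (simp add: minus_mul mul_assoc)

text \<open>The adjoint action: the differential at \<open>0\<close> of conjugation by
  \<open>k\<close>, written with partial derivatives of the product. That it coincides with
  conjugation itself is shown in \<open>Ad_conj\<close>.\<close>

definition Ad :: "'a \<Rightarrow> 'a \<Rightarrow> 'a" where "Ad k v = Dmul (k, - k) (Dmul (k, 0) (0, v), 0)"

lemma conj_vector_derivative:
  assumes "(e has_vector_derivative w) (at t)" "e t = 0"
  shows "((\<lambda>s. k \<odot> e s \<odot> (- k)) has_vector_derivative Ad k w) (at t)"
  using has_vector_derivative_mul_right[OF has_vector_derivative_mul_left[OF assms(1)], of k "- k"] assms(2)
  by (simp add: Ad_def)

lemma linear_Ad: "linear (Ad k)"
proof -
  have "linear (\<lambda>v::'a. (v, 0::'a))" by (auto intro!: linearI)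
  from linear_compose[OF linear_compose[OF linear_lin this] linear_Dmul]
  show ?thesis by (simp add: Ad_def[abs_def] lin_def[abs_def] comp_def)
qed

text \<open>The product translated back to \<open>0\<close> is the conjugate by \<open>- k t\<close>
  of the translated \<open>c\<close>, times the translated \<open>k\<close>; and at
  \<open>(0, 0)\<close> the differential of the product is addition.\<close>

lemma has_lvel_mul:
  assumes "has_lvel c a t" "has_lvel k b t"
  shows "has_lvel (\<lambda>s. c s \<odot> k s) (Ad (- k t) a + b) t"
proof -
  have 1: "((\<lambda>s. (- k t) \<odot> ((- c t) \<odot> c s) \<odot> (- (- k t))) has_vector_derivative Ad (- k t) a) (at t)"
    by (rule conj_vector_derivative[OF assms(1)[unfolded has_lvel_iff]]) simp
  from has_vector_derivative_mul[OF this assms(2)[unfolded has_lvel_iff]]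
  show ?thesis
    unfolding has_lvel_iff by (simp add: mul_assoc minus_mul Dmul_0_0)
qed

lemma Ad_self: "Ad (t *\<^sub>R w) w = w"
proof -
  have "((\<lambda>s. (t *\<^sub>R w) \<odot> (s *\<^sub>R w) \<odot> (- (t *\<^sub>R w))) has_vector_derivative Ad (t *\<^sub>R w) w) (at 0)"
    by (rule conj_vector_derivative[OF ray_vector_derivative]) simp
  moreover have "(t *\<^sub>R w) \<odot> (s *\<^sub>R w) \<odot> (- (t *\<^sub>R w)) = s *\<^sub>R w" for s
    by (simp add: add.commute[of t s] flip: ray_add) (simp add: ray_add)
  ultimately show ?thesis
    using vector_derivative_unique_at[OF _ ray_vector_derivative] by simp
qed

lemma has_lvel_0_const:
  assumes "\<And>t. 0 \<le> t \<Longrightarrow> t \<le> 1 \<Longrightarrow> has_lvel c 0 t"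
  shows "c 1 = c 0"
  using assms by (intro has_vector_derivative_const_if_zero)
    (simp add: has_lvel_def linear_0[OF linear_lin])

text \<open>Uniqueness of integral curves by hand: multiplying by the ray of \<open>- w\<close>
  cancels the velocity, thanks to \<open>Ad_self\<close>, and a curve of zero velocity is
  constant.\<close>

lemma has_lvel_const_imp:
  assumes "\<And>t. 0 \<le> t \<Longrightarrow> t \<le> 1 \<Longrightarrow> has_lvel c w t"
  shows "c 1 = c 0 \<odot> w"
proof -
  have "has_lvel (\<lambda>t. c t \<odot> (t *\<^sub>R (- w))) 0 t" if "0 \<le> t" "t \<le> 1" for t
    using has_lvel_mul[OF assms[OF that] has_lvel_ray[of "- w"]] by (simp add: Ad_self)
  from has_lvel_0_const[OF this] have "c 1 \<odot> (- w) = c 0" by simp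
  then show ?thesis by (metis mul_cancel2(1))
qed

text \<open>Both sides are the value at time \<open>1\<close> of the one-parameter group with velocity \<open>Ad x y\<close>.\<close>

lemma Ad_conj: "Ad x y = x \<odot> y \<odot> (- x)"
proof -
  have "has_lvel (\<lambda>t. x \<odot> (t *\<^sub>R y) \<odot> (- x)) (Ad x y) t" for t
    using has_vector_derivative_const[of "- x" "at t"]
      has_lvel_mul[OF has_lvel_mul_left[OF has_lvel_ray], of "\<lambda>_. - x" 0]
    by (simp add: has_lvel_def linear_0[OF linear_lin])
  from has_lvel_const_imp[OF this] show ?thesis by simp
qed

lemma Ad_mul: "Ad (x \<odot> y) v = Ad x (Ad y v)"
  by (simp add: Ad_conj minus_mul mul_assoc)

end

lemma has_vector_derivative_quotient:
  "(f has_vector_derivative v) (at t) \<longleftrightarrow> ((\<lambda>h. (f (t + h) - f t) /\<^sub>R h) \<longlongrightarrow> v) (at 0)"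
proof -
  have "norm (f (t + h) - f t - h *\<^sub>R v) / norm h = norm ((f (t + h) - f t) /\<^sub>R h - v)" if "h \<noteq> 0" for h
  proof -
    have "(f (t + h) - f t) /\<^sub>R h - v = (f (t + h) - f t - h *\<^sub>R v) /\<^sub>R h"
      using that by (simp add: scaleR_right_diff_distrib)
    then show ?thesis by (simp add: divide_inverse_commute)
  qed
  then have "((\<lambda>h. norm (f (t + h) - f t - h *\<^sub>R v) / norm h) \<longlongrightarrow> 0) (at 0)
      \<longleftrightarrow> ((\<lambda>h. norm ((f (t + h) - f t) /\<^sub>R h - v)) \<longlongrightarrow> 0) (at 0)"
    by (intro filterlim_cong refl) (auto simp: eventually_at_filter)
  then show ?thesis
    by (simp only: has_vector_derivative_def has_derivative_at bounded_linear_scaleR_left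
        tendsto_norm_zero_iff simp_thms flip: Lim_null)
qed

section \<open>The bracket as the second-order term of the product\<close>

context exp_chart begin

text \<open>The mixed second derivative of the product: first in the right factor along
  \<open>w\<close>, then in the left factor along \<open>u\<close>.\<close>

definition D2mul :: "'a \<times> 'a \<Rightarrow> 'a \<Rightarrow> 'a \<Rightarrow> 'a" where
  "D2mul z u w = frechet_derivative (\<lambda>z. Dmul z (0, w)) (at z) (u, 0)"

text \<open>The antisymmetrized mixed term. Since \<open>lin p y = Dmul (p, 0) (0, y)\<close>, it is
  the commutator of left-invariant fields at \<open>0\<close>; \<open>lbr_eq\<close> makes this
  precise.\<close>

definition lbr :: "'a \<Rightarrow> 'a \<Rightarrow> 'a" where
  "lbr x y = D2mul (0, 0) x y - D2mul (0, 0) y x"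

lemma C1_Dmul: "Ck 1 (\<lambda>z. Dmul z w)"
proof -
  have "Ck (Suc 1) (\<lambda>(x, y). x \<odot> y)" by (rule smooth_Ck[OF smooth_mul])
  then show ?thesis unfolding Dmul_def Ck.simps(2) by blast
qed

lemma Dmul_has_derivative:
  "((\<lambda>z. Dmul z w) has_derivative frechet_derivative (\<lambda>z. Dmul z w) (at z)) (at z)"
  by (rule Ck_Suc_has_derivative[of 0]) (use C1_Dmul in simp)

lemma linear_D2mul_left: "linear (\<lambda>u. D2mul z u w)"
proof -
  have "linear (\<lambda>v::'a. (v, 0::'a))" by (auto intro!: linearI)
  from linear_compose[OF this has_derivative_linear[OF Dmul_has_derivative]]
  show ?thesis by (simp add: D2mul_def comp_def)
qed

lemma linear_D2mul_right: "linear (D2mul z u)"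
proof (rule linearI)
  fix v w :: 'a and r :: real
  have "Dmul z (0, v + w) = Dmul z (0, v) + Dmul z (0, w)" for z
    using linear_add[OF linear_Dmul, of z "(0, v)" "(0, w)"] by simp
  then have "((\<lambda>z. Dmul z (0, v + w)) has_derivative (\<lambda>h. frechet_derivative (\<lambda>z. Dmul z (0, v)) (at z) h
      + frechet_derivative (\<lambda>z. Dmul z (0, w)) (at z) h)) (at z)"
    using has_derivative_add[OF Dmul_has_derivative Dmul_has_derivative] by simp
  from frechet_derivative_at[OF this, symmetric]
  show "D2mul z u (v + w) = D2mul z u v + D2mul z u w"
    by (simp add: D2mul_def)
  have "Dmul z (0, r *\<^sub>R v) = r *\<^sub>R Dmul z (0, v)" for z
    using linear_cmul[OF linear_Dmul, of z r "(0, v)"] by simp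
  then have "((\<lambda>z. Dmul z (0, r *\<^sub>R v)) has_derivative
      (\<lambda>h. r *\<^sub>R frechet_derivative (\<lambda>z. Dmul z (0, v)) (at z) h)) (at z)"
    using has_derivative_scaleR_right[OF Dmul_has_derivative] by simp
  from frechet_derivative_at[OF this, symmetric]
  show "D2mul z u (r *\<^sub>R v) = r *\<^sub>R D2mul z u v"
    by (simp add: D2mul_def)
qed

lemma bilinear_D2mul: "bilinear (D2mul z)"
  unfolding bilinear_def using linear_D2mul_left linear_D2mul_right by blast

text \<open>Bilinearity reduces closeness of \<open>D2mul z\<close> to \<open>D2mul 0\<close> to the
  finitely many pairs of basis vectors, which makes the bound uniform in \<open>x\<close> and
  \<open>y\<close>.\<close>

lemma D2mul_diff_bound:
  "norm (D2mul z x y - D2mul 0 x y)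
    \<le> (\<Sum>b\<in>Basis. \<Sum>v\<in>Basis. norm (D2mul z b v - D2mul 0 b v)) * norm x * norm y"
proof -
  have ex: "D2mul z x y = (\<Sum>b\<in>Basis. \<Sum>v\<in>Basis. ((x \<bullet> b) * (y \<bullet> v)) *\<^sub>R D2mul z b v)" for z
  proof -
    have "D2mul z x y = D2mul z (\<Sum>b\<in>Basis. (x \<bullet> b) *\<^sub>R b) (\<Sum>v\<in>Basis. (y \<bullet> v) *\<^sub>R v)"
      by (simp add: euclidean_representation)
    also have "\<dots> = (\<Sum>b\<in>Basis. \<Sum>v\<in>Basis. ((x \<bullet> b) * (y \<bullet> v)) *\<^sub>R D2mul z b v)"
      by (simp add: linear_sum[OF linear_D2mul_left] linear_cmul[OF linear_D2mul_left]
          linear_sum[OF linear_D2mul_right] linear_cmul[OF linear_D2mul_right] scaleR_sum_right mult_ac)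
        (rule sum.swap)
    finally show ?thesis .
  qed
  have eq: "D2mul z x y - D2mul 0 x y
      = (\<Sum>b\<in>Basis. \<Sum>v\<in>Basis. ((x \<bullet> b) * (y \<bullet> v)) *\<^sub>R (D2mul z b v - D2mul 0 b v))"
    by (subst (1 2) ex) (simp add: sum_subtractf scaleR_right_diff_distrib)
  have "norm (D2mul z x y - D2mul 0 x y)
      \<le> (\<Sum>b\<in>Basis. \<Sum>v\<in>Basis. norm x * norm y * norm (D2mul z b v - D2mul 0 b v))"
    unfolding eq by (intro sum_norm_le) (simp add: abs_mult mult_mono Basis_le_norm mult_right_mono)
  then show ?thesis by (simp add: sum_distrib_left mult_ac)
qed

lemma D2mul_cont:
  assumes "\<epsilon> > 0"
  obtains d where "d > 0" and "\<And>z x y. norm z < d \<Longrightarrow> norm (D2mul z x y - D2mul 0 x y) \<le> \<epsilon> * norm x * norm y"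
proof -
  have c: "isCont (\<lambda>z. D2mul z b v) 0" for b v
  proof -
    have "continuous_on UNIV (\<lambda>z. frechet_derivative (\<lambda>z. Dmul z (0, v)) (at z) (b, 0))"
      using C1_Dmul[of "(0, v)"] by simp
    then show ?thesis
      unfolding D2mul_def using continuous_on_eq_continuous_at[OF open_UNIV] by blast
  qed
  have "((\<lambda>z. \<Sum>b\<in>Basis. \<Sum>v\<in>Basis. norm (D2mul z b v - D2mul 0 b v)) \<longlongrightarrow>
      (\<Sum>b\<in>Basis. \<Sum>v\<in>Basis. norm (D2mul 0 b v - D2mul 0 b v))) (at (0::'a \<times> 'a))"
    by (intro tendsto_intros isContD c)
  then have "\<exists>d>0. \<forall>z. z \<noteq> 0 \<and> dist z 0 < d \<longrightarrow>
      dist (\<Sum>b\<in>Basis. \<Sum>v\<in>Basis. norm (D2mul z b v - D2mul 0 b v)) 0 < \<epsilon>"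
    using assms by (simp add: LIM_def)
  then obtain d where d: "d > 0" "\<And>z. z \<noteq> 0 \<Longrightarrow> norm z < d \<Longrightarrow>
      \<bar>\<Sum>b\<in>Basis. \<Sum>v\<in>Basis. norm (D2mul z b v - D2mul 0 b v)\<bar> < \<epsilon>"
    by (auto simp: dist_norm)
  show ?thesis
  proof
    show "norm (D2mul z x y - D2mul 0 x y) \<le> \<epsilon> * norm x * norm y" if "norm z < d" for z x y
    proof (cases "z = 0")
      case False
      then have "(\<Sum>b\<in>Basis. \<Sum>v\<in>Basis. norm (D2mul z b v - D2mul 0 b v)) \<le> \<epsilon>"
        using d(2)[OF False that] by linarith
      then show ?thesis
        using D2mul_diff_bound[of z x y] by (meson mult_right_mono norm_ge_zero order_trans)
    qed (use assms in simp)
  qed (use d in simp)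
qed

text \<open>The remainder vanishes when either variable is \<open>0\<close>, so it can be integrated
  once in each variable. This is why the bound is by the product of the norms and not merely by the
  square of their sum.\<close>

lemma mul_expansion:
  assumes "\<epsilon> > 0"
  obtains d where "d > 0" and "\<And>x y. norm x < d \<Longrightarrow> norm y < d \<Longrightarrow>
      norm (x \<odot> y - x - y - D2mul 0 x y) \<le> \<epsilon> * norm x * norm y"
proof -
  obtain d where d: "d > 0"
    and D: "\<And>z x y. norm z < d \<Longrightarrow> norm (D2mul z x y - D2mul 0 x y) \<le> \<epsilon> * norm x * norm y"
    using D2mul_cont[OF assms] by blast
  show ?thesis
  proof
    show "d / 2 > 0" using d by simp
    fix x y :: 'a assume xy: "norm x < d / 2" "norm y < d / 2"
    have small: "norm (s *\<^sub>R x, t *\<^sub>R y) < d" if "0 \<le> s" "s \<le> 1" "0 \<le> t" "t \<le> 1" for s t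
    proof -
      have "norm (s *\<^sub>R x) \<le> norm x" "norm (t *\<^sub>R y) \<le> norm y"
        using that by (simp_all add: mult_left_le_one_le)
      then show ?thesis using norm_Pair_le[of "s *\<^sub>R x" "t *\<^sub>R y"] xy by linarith
    qed
    \<comment> \<open>Error in the derivative along \<open>y\<close>, as a function of the left
      factor \<open>s x\<close>. It vanishes at \<open>s = 0\<close> by \<open>Dmul_0_left\<close>,
      and its value at \<open>s = 1\<close> is the derivative of the total remainder
      \<open>\<Psi>\<close> below.\<close>
    define E where "E t s = Dmul (s *\<^sub>R x, t *\<^sub>R y) (0, y) - y - s *\<^sub>R D2mul 0 x y" for t s
    have E1: "norm (E t 1 - E t 0) \<le> \<epsilon> * norm x * norm y" if t: "0 \<le> t" "t \<le> 1" for t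
    proof (rule mean_value_01)
      fix s :: real assume s: "0 \<le> s" "s \<le> 1"
      have "((\<lambda>s. (s *\<^sub>R x, t *\<^sub>R y)) has_derivative (\<lambda>h. (h *\<^sub>R x, 0))) (at s)"
        by (auto intro!: derivative_eq_intros)
      from has_derivative_compose[OF this Dmul_has_derivative[of "(0, y)"]]
      have "((\<lambda>s. Dmul (s *\<^sub>R x, t *\<^sub>R y) (0, y)) has_vector_derivative D2mul (s *\<^sub>R x, t *\<^sub>R y) x y) (at s)"
        using linear_cmul[OF linear_D2mul_left, of "(s *\<^sub>R x, t *\<^sub>R y)" _ x y]
        by (simp add: has_vector_derivative_def D2mul_def)
      then show "(E t has_vector_derivative (D2mul (s *\<^sub>R x, t *\<^sub>R y) x y - 0 - D2mul 0 x y)) (at s)"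
        unfolding E_def
        by (intro has_vector_derivative_diff has_vector_derivative_const ray_vector_derivative)
      show "norm (D2mul (s *\<^sub>R x, t *\<^sub>R y) x y - 0 - D2mul 0 x y) \<le> \<epsilon> * norm x * norm y"
        using D[OF small[OF s t]] by simp
    qed
    have E0: "E t 0 = 0" for t by (simp add: E_def Dmul_0_left)
    define \<Psi> where "\<Psi> t = x \<odot> (t *\<^sub>R y) - x - t *\<^sub>R y - t *\<^sub>R D2mul 0 x y" for t
    have "norm (\<Psi> 1 - \<Psi> 0) \<le> \<epsilon> * norm x * norm y"
    proof (rule mean_value_01)
      fix t :: real assume t: "0 \<le> t" "t \<le> 1"
      have "(\<Psi> has_vector_derivative Dmul (x, t *\<^sub>R y) (0, y) - 0 - y - D2mul 0 x y) (at t)"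
        unfolding \<Psi>_def
        by (intro has_vector_derivative_diff has_vector_derivative_const ray_vector_derivative
            has_vector_derivative_mul_left)
      then show "(\<Psi> has_vector_derivative E t 1) (at t)" by (simp add: E_def)
      show "norm (E t 1) \<le> \<epsilon> * norm x * norm y" using E1[OF t] E0 by simp
    qed
    then show "norm (x \<odot> y - x - y - D2mul 0 x y) \<le> \<epsilon> * norm x * norm y"
      by (simp add: \<Psi>_def)
  qed
qed

lemma bilinear_lbr: "bilinear lbr"
  unfolding bilinear_def lbr_def
  by (intro conjI allI linear_compose_sub linear_D2mul_left linear_D2mul_right)

lemma lbr_self [simp]: "lbr x x = 0"
  by (simp add: lbr_def)

lemma lbr_skew: "lbr y x = - lbr x y"
  by (simp add: lbr_def)

definition gcomm :: "'a \<Rightarrow> 'a \<Rightarrow> 'a" where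
  "gcomm x y = x \<odot> y \<odot> (- (y \<odot> x))"

text \<open>With \<open>k\<close> the commutator,
  \<open>k \<odot> (y \<odot> x) = x \<odot> y\<close>, and the expansions of the three products are
  combined. A crude bound for \<open>k\<close> comes first, by absorbing half of its norm; it then
  makes the contribution of \<open>k \<odot> (y \<odot> x)\<close> negligible.\<close>

lemma gcomm_expansion:
  assumes "\<epsilon> > 0"
  obtains d where "d > 0" and "\<And>x y. norm x < d \<Longrightarrow> norm y < d \<Longrightarrow>
      norm (gcomm x y - lbr x y) \<le> \<epsilon> * norm x * norm y"
proof -
  define B where "B = D2mul 0"
  have bB: "bounded_bilinear B"
    using bilinear_D2mul bilinear_conv_bounded_bilinear B_def by blast
  obtain C where C: "C > 0" "\<And>x y. norm (B x y) \<le> norm x * norm y * C"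
    using bounded_bilinear.pos_bounded[OF bB] by blast
  define \<alpha> where "\<alpha> = min 1 (\<epsilon> / 4)"
  have \<alpha>: "\<alpha> > 0" "\<alpha> \<le> 1" "\<alpha> \<le> \<epsilon> / 4" using assms by (auto simp: \<alpha>_def)
  obtain d where d: "d > 0" and T: "\<And>x y. norm x < d \<Longrightarrow> norm y < d \<Longrightarrow>
      norm (x \<odot> y - x - y - B x y) \<le> \<alpha> * norm x * norm y"
    using mul_expansion[OF \<alpha>(1)] unfolding B_def by blast
  \<comment> \<open>The second entry lets half of \<open>norm k\<close> be absorbed; the third makes
    the last error at most \<open>\<epsilon> / 2\<close> times \<open>norm x * norm y\<close> once
    \<open>norm k\<close> is known to be of that order. With
    \<open>\<alpha> \<le> \<epsilon> / 4\<close> this adds up to \<open>\<epsilon>\<close>.\<close>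
  define \<eta> where "\<eta> = Min {d, 1 / (2 * (C + 1)), \<epsilon> / (8 * (C + 1) * (C + 1))}"
  have \<eta>: "\<eta> > 0" "\<eta> \<le> d" "\<eta> \<le> 1 / (2 * (C + 1))" "\<eta> \<le> \<epsilon> / (8 * (C + 1) * (C + 1))"
    using d C assms unfolding \<eta>_def by auto
  let ?o = "0 :: 'a \<times> 'a"
  have f: "(fst \<longlongrightarrow> fst ?o) (nhds ?o)" "(snd \<longlongrightarrow> snd ?o) (nhds ?o)"
    by (rule tendsto_fst[OF filterlim_ident] tendsto_snd[OF filterlim_ident])+
  have "((\<lambda>z. gcomm (fst z) (snd z)) \<longlongrightarrow> gcomm (fst ?o) (snd ?o)) (nhds ?o)"
      "((\<lambda>z. snd z \<odot> fst z) \<longlongrightarrow> snd ?o \<odot> fst ?o) (nhds ?o)"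
    unfolding gcomm_def by (intro tendsto_mul tendsto_minus f)+
  then have "eventually (\<lambda>z. dist (gcomm (fst z) (snd z)) 0 < \<eta> \<and> dist (snd z \<odot> fst z) 0 < \<eta>) (nhds 0)"
    using \<eta>(1) by (intro eventually_conj tendstoD) (simp_all add: gcomm_def)
  then obtain e where e: "e > 0" "\<And>z. dist z 0 < e \<Longrightarrow>
      dist (gcomm (fst z) (snd z)) 0 < \<eta> \<and> dist (snd z \<odot> fst z) 0 < \<eta>"
    unfolding eventually_nhds_metric by blast
  show ?thesis
  proof
    show "min d (e / 2) > 0" using d e by simp
    fix x y :: 'a assume "norm x < min d (e / 2)" "norm y < min d (e / 2)"
    then have xy: "norm x < d" "norm y < d" "norm (x, y) < e"
      using norm_Pair_le[of x y] by auto
    define k where "k = gcomm x y"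
    define w where "w = y \<odot> x"
    have kw: "norm k < \<eta>" "norm w < \<eta>" using e(2)[of "(x, y)"] xy(3) by (auto simp: k_def w_def)
    have kd: "k \<odot> w = x \<odot> y" by (simp add: k_def w_def gcomm_def)
    have 1: "norm (x \<odot> y - k - w - B k w) \<le> norm k * norm w"
      using T[of k w] kw \<eta>(2) \<alpha>(2) unfolding kd
      by (smt (verit) mult_left_le_one_le mult_nonneg_nonneg norm_ge_zero mult.assoc \<alpha>(1))
    have 2: "norm (x \<odot> y - x - y - B x y) \<le> \<alpha> * (norm x * norm y)"
        "norm (w - y - x - B y x) \<le> \<alpha> * (norm x * norm y)"
      using T[OF xy(1,2)] T[OF xy(2,1)] by (simp_all add: w_def mult_ac)
    have l: "lbr x y = B x y - B y x" by (simp add: lbr_def B_def zero_prod_def)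
    have eq: "k - lbr x y = (x \<odot> y - x - y - B x y) - (w - y - x - B y x) - (x \<odot> y - k - w - B k w) - B k w"
      unfolding l by simp
    have "norm (k - lbr x y) \<le> norm (x \<odot> y - x - y - B x y) + norm (w - y - x - B y x)
        + norm (x \<odot> y - k - w - B k w) + norm (B k w)"
      unfolding eq by (smt (verit) norm_triangle_ineq4)
    then have 3: "norm (k - lbr x y) \<le> 2 * \<alpha> * (norm x * norm y) + (C + 1) * (norm k * norm w)"
      using 1 2 C(2)[of k w] by (simp add: algebra_simps)
    have lb: "norm (lbr x y) \<le> 2 * C * (norm x * norm y)"
      unfolding l using norm_triangle_ineq4[of "B x y" "B y x"] C(2)[of x y] C(2)[of y x]
      by (simp add: algebra_simps)
    have "(C + 1) * norm w \<le> (C + 1) * (1 / (2 * (C + 1)))"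
      using kw \<eta>(3) C by (intro mult_left_mono) auto
    moreover have "(C + 1) * (1 / (2 * (C + 1))) = 1 / 2" using C(1) by (simp add: field_simps)
    ultimately have "(C + 1) * norm w \<le> 1 / 2" by linarith
    then have "(C + 1) * (norm k * norm w) \<le> norm k / 2"
      using mult_right_mono[of "(C + 1) * norm w" "1/2" "norm k"] by (simp add: mult_ac)
    then have "norm k \<le> 2 * \<alpha> * (norm x * norm y) + norm k / 2 + 2 * C * (norm x * norm y)"
      using 3 lb norm_triangle_sub[of k "lbr x y"] by linarith
    moreover have "2 * \<alpha> * (norm x * norm y) \<le> 2 * (norm x * norm y)"
      using \<alpha>(2) by (intro mult_right_mono) auto
    ultimately have kb: "norm k \<le> 4 * (C + 1) * (norm x * norm y)"
      by (simp add: algebra_simps)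
    have "(C + 1) * (norm k * norm w) \<le> (C + 1) * (4 * (C + 1) * (norm x * norm y) * (\<epsilon> / (8 * (C + 1) * (C + 1))))"
      using kb kw \<eta>(4) C by (intro mult_left_mono mult_mono) auto
    also have "\<dots> = \<epsilon> / 2 * (norm x * norm y)" using C by (simp add: divide_simps)
    finally have "norm (k - lbr x y) \<le> 2 * \<alpha> * (norm x * norm y) + \<epsilon> / 2 * (norm x * norm y)"
      using 3 by linarith
    also have "\<dots> \<le> \<epsilon> * (norm x * norm y)"
      using mult_right_mono[OF \<alpha>(3), of "norm x * norm y"] by (simp add: algebra_simps)
    finally show "norm (gcomm x y - lbr x y) \<le> \<epsilon> * norm x * norm y"
      by (simp add: k_def mult.assoc)
  qed
qed

text \<open>\<open>Ad x\<close> is linear, so the commutator estimate can be applied to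
  \<open>s y\<close> and divided by \<open>s\<close>; in the limit no smallness of \<open>y\<close>
  remains.\<close>

lemma Ad_bound:
  assumes "\<epsilon> > 0"
  obtains d where "d > 0" and "\<And>x y. norm x < d \<Longrightarrow> norm (Ad x y - y - lbr x y) \<le> \<epsilon> * norm x * norm y"
proof -
  obtain d where d: "d > 0" "\<And>x y. norm x < d \<Longrightarrow> norm y < d \<Longrightarrow>
      norm (gcomm x y - lbr x y) \<le> \<epsilon> * norm x * norm y"
    using gcomm_expansion[OF assms] by blast
  show ?thesis
  proof
    fix x y :: 'a assume x: "norm x < d"
    have g: "gcomm x (s *\<^sub>R y) = (s *\<^sub>R Ad x y) \<odot> (s *\<^sub>R (- y))" for s
      using Ad_conj[of x "s *\<^sub>R y"] linear_cmul[OF linear_Ad, of x s y]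
      by (simp add: gcomm_def minus_mul mul_assoc)
    have "((\<lambda>s. gcomm x (s *\<^sub>R y)) has_vector_derivative Ad x y - y) (at 0)"
      using has_vector_derivative_mul[OF ray_vector_derivative[of "Ad x y"] ray_vector_derivative[of "- y"], of 0 UNIV]
      unfolding g by (simp add: Dmul_0_0)
    then have "((\<lambda>s. gcomm x (s *\<^sub>R y) /\<^sub>R s) \<longlongrightarrow> Ad x y - y) (at 0)"
      by (simp add: has_vector_derivative_quotient gcomm_def)
    then have "((\<lambda>s. gcomm x (s *\<^sub>R y) /\<^sub>R s) \<longlongrightarrow> Ad x y - y) (at_right 0)"
      using filterlim_at_split by blast
    then have "((\<lambda>s. norm (gcomm x (s *\<^sub>R y) /\<^sub>R s - lbr x y)) \<longlongrightarrow> norm (Ad x y - y - lbr x y)) (at_right 0)"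
      by (intro tendsto_norm tendsto_diff tendsto_const)
    moreover have "\<forall>\<^sub>F s in at_right 0. norm (gcomm x (s *\<^sub>R y) /\<^sub>R s - lbr x y) \<le> \<epsilon> * norm x * norm y"
    proof -
      have "((\<lambda>s. norm (s *\<^sub>R y)) \<longlongrightarrow> norm (0 *\<^sub>R y)) (at_right 0)" by (intro tendsto_intros)
      then have "\<forall>\<^sub>F s in at_right 0. norm (s *\<^sub>R y) < d"
        using d(1) by (simp add: order_tendstoD(2))
      then show ?thesis
        using eventually_at_right_less[of "0::real"]
      proof eventually_elim
        case (elim s)
        have "gcomm x (s *\<^sub>R y) /\<^sub>R s - lbr x y = (gcomm x (s *\<^sub>R y) - lbr x (s *\<^sub>R y)) /\<^sub>R s"
          using elim(2) by (simp add: bilinear_rmul[OF bilinear_lbr] scaleR_right_diff_distrib)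
        also have "norm \<dots> \<le> (\<epsilon> * norm x * norm (s *\<^sub>R y)) / s"
          using d(2)[OF x elim(1)] elim(2) by (simp add: divide_inverse_commute mult_left_mono)
        also have "\<dots> = \<epsilon> * norm x * norm y" using elim(2) by simp
        finally show ?case .
      qed
    qed
    ultimately show "norm (Ad x y - y - lbr x y) \<le> \<epsilon> * norm x * norm y"
      by (rule tendsto_upperbound) simp
  qed (use d in simp)
qed

section \<open>Linear differential equations for the adjoint action and the Maurer-Cartan
  form\<close>

lemma bounded_linear_Ad: "bounded_linear (Ad k)"
  using linear_Ad linear_conv_bounded_linear by blast

lemma Ad_0 [simp]: "Ad 0 y = y"
  by (simp add: Ad_conj)

lemma Ad_ray_derivative_0: "((\<lambda>t. Ad (t *\<^sub>R x) y) has_vector_derivative lbr x y) (at 0)"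
  unfolding has_vector_derivative_quotient
proof (rule LIM_I)
  fix r :: real assume r: "r > 0"
  define \<epsilon> where "\<epsilon> = r / (2 * (norm x * norm y + 1))"
  have pos: "norm x * norm y + 1 > 0" by (simp add: add_nonneg_pos)
  then have \<epsilon>: "\<epsilon> > 0" using r by (simp add: \<epsilon>_def)
  obtain d where d: "d > 0" "\<And>x y. norm x < d \<Longrightarrow> norm (Ad x y - y - lbr x y) \<le> \<epsilon> * norm x * norm y"
    using Ad_bound[OF \<epsilon>] by blast
  show "\<exists>s>0. \<forall>h. h \<noteq> 0 \<and> norm (h - 0) < s \<longrightarrow>
      norm ((Ad ((0 + h) *\<^sub>R x) y - Ad (0 *\<^sub>R x) y) /\<^sub>R h - lbr x y) < r"
  proof (intro exI[of _ "d / (norm x + 1)"] conjI allI impI)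
    show "d / (norm x + 1) > 0" using d(1) by (simp add: add_nonneg_pos)
    fix h :: real assume h: "h \<noteq> 0 \<and> norm (h - 0) < d / (norm x + 1)"
    have "\<bar>h\<bar> * norm x \<le> \<bar>h\<bar> * (norm x + 1)" by (simp add: algebra_simps)
    also have "\<dots> < d" using h by (simp add: pos_less_divide_eq add_nonneg_pos)
    finally have "norm (h *\<^sub>R x) < d" by simp
    from d(2)[OF this, of y]
    have "norm (Ad (h *\<^sub>R x) y - y - h *\<^sub>R lbr x y) \<le> \<epsilon> * \<bar>h\<bar> * norm x * norm y"
      by (simp add: bilinear_lmul[OF bilinear_lbr])
    moreover have "(Ad ((0 + h) *\<^sub>R x) y - Ad (0 *\<^sub>R x) y) /\<^sub>R h - lbr x y
        = (Ad (h *\<^sub>R x) y - y - h *\<^sub>R lbr x y) /\<^sub>R h"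
      using h by (simp add: scaleR_right_diff_distrib)
    ultimately have "norm ((Ad ((0 + h) *\<^sub>R x) y - Ad (0 *\<^sub>R x) y) /\<^sub>R h - lbr x y) \<le> \<epsilon> * (norm x * norm y)"
      using h by (simp add: divide_inverse_commute[symmetric] pos_divide_le_eq mult_ac)
    also have "\<dots> \<le> \<epsilon> * (norm x * norm y + 1)" using \<epsilon> by simp
    also have "\<dots> = r / 2" using pos by (simp add: \<epsilon>_def divide_simps)
    also have "\<dots> < r" using r by simp
    finally show "norm ((Ad ((0 + h) *\<^sub>R x) y - Ad (0 *\<^sub>R x) y) /\<^sub>R h - lbr x y) < r" .
  qed
qed

lemma Ad_ray_add: "Ad ((t + h) *\<^sub>R x) y = Ad (t *\<^sub>R x) (Ad (h *\<^sub>R x) y)"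
  by (simp add: ray_add Ad_mul)

lemma Ad_ray_derivative: "((\<lambda>t. Ad (t *\<^sub>R x) y) has_vector_derivative Ad (t *\<^sub>R x) (lbr x y)) (at t)"
proof -
  have "((\<lambda>h. (Ad (h *\<^sub>R x) y - y) /\<^sub>R h) \<longlongrightarrow> lbr x y) (at 0)"
    using Ad_ray_derivative_0 by (simp add: has_vector_derivative_quotient)
  from bounded_linear.tendsto[OF bounded_linear_Ad[of "t *\<^sub>R x"] this]
  show ?thesis
    by (simp add: has_vector_derivative_quotient Ad_ray_add linear_cmul[OF linear_Ad] linear_diff[OF linear_Ad])
qed

text \<open>Product rule for a moving vector; expanding it in \<open>Basis\<close> leaves only
  scalar coefficients to differentiate next to the known curves \<open>Ad (t x) b\<close>.\<close>

lemma Ad_ray_product_derivative: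
  assumes "(E has_vector_derivative E') (at t)"
  shows "((\<lambda>t. Ad (t *\<^sub>R x) (E t)) has_vector_derivative Ad (t *\<^sub>R x) (lbr x (E t) + E')) (at t)"
proof -
  have ex: "Ad k w = (\<Sum>b\<in>Basis. (w \<bullet> b) *\<^sub>R Ad k b)" for k w
  proof -
    have "Ad k w = Ad k (\<Sum>b\<in>Basis. (w \<bullet> b) *\<^sub>R b)" by (simp add: euclidean_representation)
    then show ?thesis by (simp add: linear_sum[OF linear_Ad] linear_cmul[OF linear_Ad])
  qed
  have ex2: "lbr x w = (\<Sum>b\<in>Basis. (w \<bullet> b) *\<^sub>R lbr x b)" for w
  proof -
    have "lbr x w = lbr x (\<Sum>b\<in>Basis. (w \<bullet> b) *\<^sub>R b)" by (simp add: euclidean_representation)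
    then show ?thesis
      by (simp add: linear_sum linear_cmul bilinear_lbr[unfolded bilinear_def])
  qed
  have i: "((\<lambda>t. E t \<bullet> b) has_real_derivative E' \<bullet> b) (at t)" for b
    using bounded_linear.has_vector_derivative[OF bounded_linear_inner_left assms, of b]
    by (simp add: has_real_derivative_iff_has_vector_derivative)
  have "((\<lambda>t. \<Sum>b\<in>Basis. (E t \<bullet> b) *\<^sub>R Ad (t *\<^sub>R x) b) has_vector_derivative
      (\<Sum>b\<in>Basis. (E t \<bullet> b) *\<^sub>R Ad (t *\<^sub>R x) (lbr x b) + (E' \<bullet> b) *\<^sub>R Ad (t *\<^sub>R x) b)) (at t)"
    by (intro has_vector_derivative_sum has_vector_derivative_scaleR i Ad_ray_derivative)
  moreover have "(\<Sum>b\<in>Basis. (E t \<bullet> b) *\<^sub>R Ad (t *\<^sub>R x) (lbr x b) + (E' \<bullet> b) *\<^sub>R Ad (t *\<^sub>R x) b)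
      = Ad (t *\<^sub>R x) (lbr x (E t) + E')"
    unfolding sum.distrib linear_add[OF linear_Ad]
    by (simp add: ex[of _ E', symmetric] ex2[of "E t"] linear_sum[OF linear_Ad] linear_cmul[OF linear_Ad])
  moreover have "(\<lambda>t. Ad (t *\<^sub>R x) (E t)) = (\<lambda>t. \<Sum>b\<in>Basis. (E t \<bullet> b) *\<^sub>R Ad (t *\<^sub>R x) b)"
    by (intro ext ex)
  ultimately show ?thesis by metis
qed

text \<open>\<open>Ad (t x)\<close> is an integrating factor: applied to a solution it gives a
  constant, and it is invertible.\<close>

lemma adjoint_ode_unique:
  assumes "\<And>t. 0 \<le> t \<Longrightarrow> t \<le> 1 \<Longrightarrow> (E has_vector_derivative - lbr x (E t)) (at t)" and "E 0 = 0"
  shows "E 1 = 0"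
proof -
  have "((\<lambda>t. Ad (t *\<^sub>R x) (E t)) has_vector_derivative 0) (at t)" if "0 \<le> t" "t \<le> 1" for t
    using Ad_ray_product_derivative[OF assms(1)[OF that], of x] by (simp add: linear_0[OF linear_Ad])
  from has_vector_derivative_const_if_zero[OF this]
  have "Ad x (E 1) = 0" using assms(2) by (simp add: linear_0[OF linear_Ad])
  moreover have "Ad (- x) (Ad x (E 1)) = E 1" by (simp flip: Ad_mul)
  ultimately show ?thesis by (simp add: linear_0[OF linear_Ad])
qed

text \<open>Perturb the direction of the ray: the point \<open>(t + h) (x + r v)\<close> is the
  product of \<open>t (x + r v)\<close> and \<open>h (x + r v)\<close>. Comparing left velocities at
  \<open>r = 0\<close> by the product rule gives the identity.\<close>

lemma mc_ray_add:
  "(t + h) *\<^sub>R mc ((t + h) *\<^sub>R x) v = Ad (h *\<^sub>R (- x)) (t *\<^sub>R mc (t *\<^sub>R x) v) + h *\<^sub>R mc (h *\<^sub>R x) v"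
proof -
  have l: "has_lvel (\<lambda>r. t *\<^sub>R (x + r *\<^sub>R v)) (t *\<^sub>R mc (t *\<^sub>R x) v) 0" for t
  proof -
    have "((\<lambda>r. t *\<^sub>R (x + r *\<^sub>R v)) has_vector_derivative t *\<^sub>R v) (at 0)"
      by (auto intro!: derivative_eq_intros)
    from has_lvelI[OF this] show ?thesis by (simp add: linear_cmul[OF linear_mc])
  qed
  from has_lvel_mul[OF l[of t] l[of h]] l[of "t + h"]
  show ?thesis
    by (intro has_lvel_unique) (simp_all flip: ray_add)
qed

text \<open>The derivative of the exponential map, as an equation \<open>A' = v - [x, A]\<close> in
  place of the usual series \<open>(1 - exp (- ad x)) / ad x\<close>. The equation involves only the
  bracket.\<close>

lemma mc_ray_derivative:
  "((\<lambda>t. t *\<^sub>R mc (t *\<^sub>R x) v) has_vector_derivative v - lbr x (t *\<^sub>R mc (t *\<^sub>R x) v)) (at t)"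
proof -
  define A where "A t = t *\<^sub>R mc (t *\<^sub>R x) v" for t
  have "((\<lambda>h. (Ad (h *\<^sub>R (- x)) (A t) - A t) /\<^sub>R h) \<longlongrightarrow> lbr (- x) (A t)) (at 0)"
    using Ad_ray_derivative_0[of "- x" "A t"] unfolding has_vector_derivative_quotient by simp
  moreover have "((\<lambda>h. mc (h *\<^sub>R x) v) \<longlongrightarrow> v) (at 0)"
  proof -
    have "continuous_on UNIV (\<lambda>h. mc (h *\<^sub>R x) v)" by (intro continuous_intros)
    then have "isCont (\<lambda>h. mc (h *\<^sub>R x) v) 0"
      by (simp add: continuous_on_eq_continuous_at)
    then show ?thesis by (simp add: isCont_def)
  qed
  ultimately have "((\<lambda>h. (Ad (h *\<^sub>R (- x)) (A t) - A t) /\<^sub>R h + mc (h *\<^sub>R x) v) \<longlongrightarrow> lbr (- x) (A t) + v) (at 0)"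
    by (rule tendsto_add)
  then have "((\<lambda>h. (A (t + h) - A t) /\<^sub>R h) \<longlongrightarrow> v - lbr x (A t)) (at 0)"
  proof (rule Lim_transform_eventually[THEN tendsto_eq_rhs])
    show "\<forall>\<^sub>F h in at 0. (Ad (h *\<^sub>R (- x)) (A t) - A t) /\<^sub>R h + mc (h *\<^sub>R x) v = (A (t + h) - A t) /\<^sub>R h"
      unfolding eventually_at_filter A_def mc_ray_add
      by (auto simp: scaleR_right_diff_distrib scaleR_right_distrib)
    show "lbr (- x) (A t) + v = v - lbr x (A t)"
      by (simp add: bilinear_lneg[OF bilinear_lbr])
  qed
  then show ?thesis
    by (simp add: has_vector_derivative_quotient A_def)
qed

lemma mc_eqI:
  assumes "\<And>t. 0 \<le> t \<Longrightarrow> t \<le> 1 \<Longrightarrow> (A has_vector_derivative v - lbr x (A t)) (at t)" and "A 0 = 0"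
  shows "A 1 = mc x v"
proof -
  have "((\<lambda>t. A t - t *\<^sub>R mc (t *\<^sub>R x) v) has_vector_derivative
      - lbr x (A t - t *\<^sub>R mc (t *\<^sub>R x) v)) (at t)" if "0 \<le> t" "t \<le> 1" for t
    using has_vector_derivative_diff[OF assms(1)[OF that] mc_ray_derivative[of x v t]]
    by (simp add: bilinear_rsub[OF bilinear_lbr])
  from adjoint_ode_unique[OF this] assms(2) show ?thesis by simp
qed

text \<open>The bracket determines \<open>mc\<close> through \<open>mc_eqI\<close>, and
  \<open>mc\<close> determines the product through uniqueness of integral curves. A linear map that
  respects the bracket respects each stage; this stands in for the Baker-Campbell-Hausdorff
  formula.\<close>

lemma hom_if_lbr_hom:
  assumes lin: "linear \<phi>" and br: "\<And>x y. \<phi> (lbr x y) = lbr (\<phi> x) (\<phi> y)"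
  shows "\<phi> (x \<odot> y) = \<phi> x \<odot> \<phi> y"
proof -
  have b: "bounded_linear \<phi>" using lin linear_conv_bounded_linear by blast
  have mc: "\<phi> (mc p v) = mc (\<phi> p) (\<phi> v)" for p v
  proof -
    have "((\<lambda>t. \<phi> (t *\<^sub>R mc (t *\<^sub>R p) v)) has_vector_derivative
        \<phi> v - lbr (\<phi> p) (\<phi> (t *\<^sub>R mc (t *\<^sub>R p) v))) (at t)" for t
      using bounded_linear.has_vector_derivative[OF b mc_ray_derivative[of p v t]]
      by (simp add: linear_diff[OF lin] br)
    from mc_eqI[OF this] show ?thesis by (simp add: linear_0[OF lin])
  qed
  have "has_lvel (\<lambda>t. \<phi> (x \<odot> (t *\<^sub>R y))) (\<phi> y) t" for t
  proof -
    have "((\<lambda>t. \<phi> (x \<odot> (t *\<^sub>R y))) has_vector_derivative \<phi> (lin (x \<odot> (t *\<^sub>R y)) y)) (at t)"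
      by (rule bounded_linear.has_vector_derivative[OF b has_lvel_mul_left[OF has_lvel_ray, unfolded has_lvel_def]])
    from has_lvelI[OF this] show ?thesis by (simp flip: mc)
  qed
  from has_lvel_const_imp[OF this] show ?thesis by simp
qed

text \<open>Conjugation by points of a ray is \<open>Ad\<close>, and its derivative at
  \<open>0\<close> is the bracket.\<close>

lemma lbr_hom_if_hom:
  assumes lin: "linear \<phi>" and hom: "\<And>x y. \<phi> (x \<odot> y) = \<phi> x \<odot> \<phi> y"
  shows "\<phi> (lbr x y) = lbr (\<phi> x) (\<phi> y)"
proof -
  have b: "bounded_linear \<phi>" using lin linear_conv_bounded_linear by blast
  have "\<phi> (Ad (t *\<^sub>R x) y) = Ad (t *\<^sub>R \<phi> x) (\<phi> y)" for t
    by (simp add: Ad_conj hom linear_neg[OF lin] linear_cmul[OF lin])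
  then have "((\<lambda>t. Ad (t *\<^sub>R \<phi> x) (\<phi> y)) has_vector_derivative \<phi> (lbr x y)) (at 0)"
    using bounded_linear.has_vector_derivative[OF b Ad_ray_derivative_0[of x y]] by simp
  from vector_derivative_unique_at[OF this Ad_ray_derivative_0] show ?thesis .
qed

text \<open>The line \<open>x + t y\<close> has constant left velocity \<open>y\<close>: the bracket
  of \<open>x + t y\<close> with \<open>y\<close> vanishes, so \<open>mc\<close> at that point fixes
  \<open>y\<close>.\<close>

lemma mul_eq_add_if_commute:
  assumes "lbr x y = 0" shows "x \<odot> y = x + y"
proof -
  have "has_lvel (\<lambda>t. x + t *\<^sub>R y) y t" for t
  proof -
    have "lbr (x + t *\<^sub>R y) y = 0"
      by (simp add: bilinear_ladd[OF bilinear_lbr] bilinear_lmul[OF bilinear_lbr] assms)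
    then have "((\<lambda>s. s *\<^sub>R y) has_vector_derivative y - lbr (x + t *\<^sub>R y) (s *\<^sub>R y)) (at s)" for s
      using ray_vector_derivative[of y s UNIV] by (simp add: bilinear_rmul[OF bilinear_lbr])
    from mc_eqI[OF this] have "mc (x + t *\<^sub>R y) y = y" by simp
    then show ?thesis using has_lvelI[OF affine_vector_derivative[of x y]] by metis
  qed
  from has_lvel_const_imp[OF this] show ?thesis by simp
qed

text \<open>The curve \<open>(s x) \<odot> (s y)\<close> has derivative \<open>x + y\<close> at
  \<open>s = 0\<close>; the times \<open>s = 1 / n\<close> are inserted in its difference
  quotient.\<close>

lemma Trotter:
  "((\<lambda>n. real n *\<^sub>R ((x /\<^sub>R real n) \<odot> (y /\<^sub>R real n))) \<longlongrightarrow> x + y) sequentially"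
proof -
  have "((\<lambda>s. (s *\<^sub>R x) \<odot> (s *\<^sub>R y)) has_vector_derivative x + y) (at 0)"
    using has_vector_derivative_mul[OF ray_vector_derivative[of x 0 UNIV] ray_vector_derivative[of y 0 UNIV]] by (simp add: Dmul_0_0)
  then have "((\<lambda>s. ((s *\<^sub>R x) \<odot> (s *\<^sub>R y)) /\<^sub>R s) \<longlongrightarrow> x + y) (at 0)"
    by (simp add: has_vector_derivative_quotient)
  moreover have "filterlim (\<lambda>n. inverse (real n)) (at 0) sequentially"
    using LIMSEQ_inverse_real_of_nat eventually_gt_at_top[of 0]
    by (auto simp: filterlim_at lim_inverse_n elim!: eventually_mono)
  ultimately have "((\<lambda>n. ((inverse (real n) *\<^sub>R x) \<odot> (inverse (real n) *\<^sub>R y)) /\<^sub>R inverse (real n)) \<longlongrightarrow> x + y) sequentially"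
    by (rule filterlim_compose)
  then show ?thesis by simp
qed

end

section \<open>Gradings and dilations\<close>

lemma direct_sum_component:
  assumes "direct_sum I W L" "x \<in> L"
  shows "component I W x \<in> (\<Pi>\<^sub>E i\<in>I. W i)" "x = (\<Sum>i\<in>I. component I W x i)"
proof -
  have "\<exists>!u. u \<in> (\<Pi>\<^sub>E i\<in>I. W i) \<and> x = (\<Sum>i\<in>I. u i)"
    using assms by (simp add: direct_sum_def)
  from theI'[OF this] show "component I W x \<in> (\<Pi>\<^sub>E i\<in>I. W i)" "x = (\<Sum>i\<in>I. component I W x i)"
    unfolding component_def by blast+
qed

lemma direct_sum_component_in:
  assumes "direct_sum I W L" "x \<in> L" "i \<in> I"
  shows "component I W x i \<in> W i"
  using direct_sum_component(1)[OF assms(1,2)] assms(3) by auto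

lemma direct_sum_component_eqI:
  assumes "direct_sum I W L" "x \<in> L" "\<And>i. i \<in> I \<Longrightarrow> u i \<in> W i" "x = (\<Sum>i\<in>I. u i)" "i \<in> I"
  shows "component I W x i = u i"
proof -
  have ex: "\<exists>!u. u \<in> (\<Pi>\<^sub>E i\<in>I. W i) \<and> x = (\<Sum>i\<in>I. u i)"
    using assms by (simp add: direct_sum_def)
  have "restrict u I \<in> (\<Pi>\<^sub>E i\<in>I. W i) \<and> x = (\<Sum>i\<in>I. restrict u I i)"
    using assms(3,4) by auto
  moreover have "component I W x \<in> (\<Pi>\<^sub>E i\<in>I. W i) \<and> x = (\<Sum>i\<in>I. component I W x i)"
    using direct_sum_component[OF assms(1,2)] by blast
  ultimately have "component I W x = restrict u I" using ex by blast
  then show ?thesis using assms(5) by simp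
qed

lemma direct_sum_subspace: "direct_sum I W L \<Longrightarrow> i \<in> I \<Longrightarrow> subspace (W i)"
  by (simp add: direct_sum_def)

text \<open>Outside \<open>I\<close>, \<open>component\<close> carries no useful value; the default
  \<open>0\<close> makes each summand a linear map for every index.\<close>

definition summand :: "nat set \<Rightarrow> (nat \<Rightarrow> 'a::euclidean_space set) \<Rightarrow> nat \<Rightarrow> 'a \<Rightarrow> 'a" where
  "summand I W i x = (if i \<in> I then component I W x i else 0)"

context
  fixes I :: "nat set" and W :: "nat \<Rightarrow> 'a::euclidean_space set"
  assumes ds: "direct_sum I W UNIV"
begin

lemma summand_in: "i \<in> I \<Longrightarrow> summand I W i x \<in> W i"
  by (simp add: summand_def direct_sum_component_in[OF ds])

lemma sum_summand: "(\<Sum>i\<in>I. summand I W i x) = x"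
  using direct_sum_component(2)[OF ds, of x] by (simp add: summand_def)

lemma summand_eqI:
  "(\<And>i. i \<in> I \<Longrightarrow> u i \<in> W i) \<Longrightarrow> x = (\<Sum>i\<in>I. u i) \<Longrightarrow> i \<in> I \<Longrightarrow> summand I W i x = u i"
  by (simp add: summand_def direct_sum_component_eqI[OF ds, of _ u])

lemma linear_summand: "linear (summand I W i)"
proof (cases "i \<in> I")
  case True
  note s = direct_sum_subspace[OF ds]
  show ?thesis
  proof (rule linearI)
    fix x y :: 'a and r :: real
    show "summand I W i (x + y) = summand I W i x + summand I W i y"
      by (rule summand_eqI[OF _ _ True])
        (use s summand_in in \<open>auto simp: subspace_add sum.distrib sum_summand\<close>)
    show "summand I W i (r *\<^sub>R x) = r *\<^sub>R summand I W i x"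
      by (rule summand_eqI[OF _ _ True])
        (use s summand_in in \<open>auto simp: subspace_scale sum_summand simp flip: scaleR_sum_right\<close>)
  qed
qed (auto simp: summand_def intro!: linearI)

lemma summand_self:
  assumes "finite I" "i \<in> I" "x \<in> W i"
  shows "summand I W j x = (if j = i then x else 0)"
proof (cases "j \<in> I")
  case True
  have "summand I W j x = (\<lambda>k. if k = i then x else 0) j"
  proof (rule summand_eqI[OF _ _ True])
    show "(if k = i then x else 0) \<in> W k" if "k \<in> I" for k
      using assms direct_sum_subspace[OF ds that] by (auto simp: subspace_0)
    show "x = (\<Sum>k\<in>I. if k = i then x else 0)" using assms by simp
  qed
  then show ?thesis by simp
qed (use assms in \<open>auto simp: summand_def\<close>)

end

locale stratified_chart = exp_chart mul
  for mul :: "'a::euclidean_space \<Rightarrow> 'a \<Rightarrow> 'a"  (infixl \<open>\<odot>\<close> 70) +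
  fixes V :: "nat \<Rightarrow> 'a set" and l :: nat
  assumes strat: "stratified_algebra lbr UNIV V l"
begin

lemma layers: "direct_sum {1..l} V UNIV"
  using strat by (simp add: stratified_algebra_def)

lemma Jacobi: "lbr x (lbr y z) = lbr (lbr x y) z + lbr y (lbr x z)"
proof -
  have "lbr x (lbr y z) + lbr y (lbr z x) + lbr z (lbr x y) = 0"
    using strat by (simp add: stratified_algebra_def lie_bracket_def)
  moreover have "lbr y (lbr z x) = - lbr y (lbr x z)" "lbr z (lbr x y) = - lbr (lbr x y) z"
    using lbr_skew[of z x] lbr_skew[of z "lbr x y"] bilinear_rneg[OF bilinear_lbr] by simp_all
  ultimately show ?thesis by (simp add: add_eq_0_iff algebra_simps)
qed

lemma l_pos: "l \<ge> 1"
proof (rule ccontr)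
  assume "\<not> l \<ge> 1"
  then have "x = 0" for x :: 'a using sum_summand[OF layers, of x] by simp
  then have "(UNIV :: 'a set) = {0}" by auto
  then have "dim (UNIV :: 'a set) = dim {0 :: 'a}" by simp
  then have "dim (UNIV :: 'a set) = 0" by simp
  then show False using strat by (simp add: stratified_algebra_def)
qed

definition lay :: "nat \<Rightarrow> 'a \<Rightarrow> 'a" where "lay = summand {1..l} V"

lemma linear_lay: "linear (lay j)"
  unfolding lay_def by (rule linear_summand[OF layers])

lemma lay_outside: "\<not> (1 \<le> j \<and> j \<le> l) \<Longrightarrow> lay j x = 0"
  by (auto simp: lay_def summand_def)

lemma bounded_linear_lay: "bounded_linear (lay j)"
  using linear_lay linear_conv_bounded_linear by blast

lemma lay_in: "1 \<le> j \<Longrightarrow> j \<le> l \<Longrightarrow> lay j x \<in> V j"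
  using summand_in[OF layers] by (simp add: lay_def)

lemma sum_lay: "(\<Sum>j\<in>{1..l}. lay j x) = x"
  unfolding lay_def by (rule sum_summand[OF layers])

lemma lay_self: "1 \<le> i \<Longrightarrow> i \<le> l \<Longrightarrow> x \<in> V i \<Longrightarrow> lay j x = (if j = i then x else 0)"
  using summand_self[OF layers, of i x] by (simp add: lay_def)

lemma subspace_V: "1 \<le> j \<Longrightarrow> j \<le> l \<Longrightarrow> subspace (V j)"
  using direct_sum_subspace[OF layers] by simp

lemma subspace_V1: "subspace (V 1)"
  using subspace_V l_pos by simp

text \<open>At \<open>0\<close> and beyond \<open>Suc l\<close> the family \<open>V\<close> is
  unconstrained. The value \<open>{0}\<close> there allows degrees to be added without range
  conditions.\<close>

definition layer :: "nat \<Rightarrow> 'a set" where "layer j = (if 1 \<le> j \<and> j \<le> l then V j else {0})"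

lemma subspace_layer: "subspace (layer j)"
  by (simp add: layer_def subspace_V)

lemma lay_layer: "lay j x \<in> layer j"
  using lay_in lay_outside by (auto simp: layer_def)

lemma lay_of_layer: "x \<in> layer i \<Longrightarrow> lay j x = (if j = i then x else 0)"
  using lay_self linear_0[OF linear_lay] by (auto simp: layer_def split: if_splits)

lemma span_brackets: "1 \<le> j \<Longrightarrow> j \<le> l \<Longrightarrow> span {lbr x y | x y. x \<in> V j \<and> y \<in> V 1} = layer (Suc j)"
  using strat by (cases "j = l") (auto simp: stratified_algebra_def layer_def)

lemma lbr_layer_1: "x \<in> layer i \<Longrightarrow> y \<in> layer 1 \<Longrightarrow> lbr x y \<in> layer (Suc i)"
proof (cases "1 \<le> i \<and> i \<le> l")
  case True
  assume "x \<in> layer i" "y \<in> layer 1"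
  then have "lbr x y \<in> span {lbr x y | x y. x \<in> V i \<and> y \<in> V 1}"
    using True l_pos by (intro span_base) (auto simp: layer_def)
  then show ?thesis using span_brackets True by simp
next
  case False
  assume "x \<in> layer i"
  then have "x = 0" using False by (auto simp: layer_def)
  then show ?thesis using subspace_0[OF subspace_layer] by (simp add: bilinear_lzero[OF bilinear_lbr])
qed

text \<open>The stratification speaks only of brackets with degree one. An element of degree
  \<open>j + 1\<close> is a sum of brackets of \<open>a\<close> and \<open>b\<close>, and Jacobi
  moves \<open>x\<close> inside: \<open>[x, [a, b]] = [[x, a], b] - [[x, b], a]\<close>.\<close>

lemma lbr_layer: "1 \<le> j \<Longrightarrow> x \<in> layer i \<Longrightarrow> y \<in> layer j \<Longrightarrow> lbr x y \<in> layer (i + j)"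
proof (induction j arbitrary: x y i rule: nat_induct_at_least)
  case base
  then show ?case using lbr_layer_1 by simp
next
  case (Suc j)
  have lin: "linear (lbr x)" using bilinear_lbr by (simp add: bilinear_def)
  show ?case
  proof (cases "j \<le> l")
    case True
    then have "y \<in> span {lbr x y | x y. x \<in> V j \<and> y \<in> V 1}"
      using Suc.prems(2) span_brackets[of j] Suc.hyps by simp
    moreover have "span {lbr x y | x y. x \<in> V j \<and> y \<in> V 1} \<subseteq> {y. lbr x y \<in> layer (i + Suc j)}"
    proof (rule span_minimal[OF subsetI])
      show "subspace {y. lbr x y \<in> layer (i + Suc j)}"
        using linear_subspace_vimage[OF lin subspace_layer[of "i + Suc j"]] by (simp add: vimage_def)
      fix y assume mem: "y \<in> {lbr x y | x y. x \<in> V j \<and> y \<in> V 1}"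
      show "y \<in> {y. lbr x y \<in> layer (i + Suc j)}"
      proof -
        obtain a b where ab: "y = lbr a b" "a \<in> layer j" "b \<in> layer 1"
          using mem True Suc.hyps l_pos by (auto simp: layer_def)
        have 1: "lbr (lbr x a) b \<in> layer (Suc (i + j))"
          using ab Suc.prems(1) by (intro lbr_layer_1 Suc.IH)
        have "lbr (lbr x b) a \<in> layer (Suc i + j)"
          using ab Suc.prems(1) by (intro Suc.IH lbr_layer_1)
        then show ?thesis
          using subspace_diff[OF subspace_layer 1] by (simp add: ab(1) Jacobi[of x] lbr_skew[of a "lbr x b"])
      qed
    qed
    ultimately show ?thesis by blast
  next
    case False
    then have "y = 0" using Suc.prems by (simp add: layer_def)
    then show ?thesis using linear_0[OF lin] subspace_0[OF subspace_layer] by simp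
  qed
qed

definition dil :: "real \<Rightarrow> 'a \<Rightarrow> 'a" where "dil s x = (\<Sum>j\<in>{1..l}. s ^ j *\<^sub>R lay j x)"

lemma dilation_eq_dil: "dilation V l s x = dil s x"
  by (simp add: dilation_def dil_def lay_def summand_def)

lemma lay_dil: "lay j (dil s x) = s ^ j *\<^sub>R lay j x"
proof -
  have "lay j (s ^ i *\<^sub>R lay i x) = (if i = j then s ^ i *\<^sub>R lay i x else 0)" for i
    using lay_of_layer[OF lay_layer] by (simp add: linear_cmul[OF linear_lay])
  then show ?thesis
    using lay_outside by (auto simp: dil_def linear_sum[OF linear_lay])
qed

lemma eq_if_lay_eq: "(\<And>j. 1 \<le> j \<Longrightarrow> j \<le> l \<Longrightarrow> lay j x = lay j y) \<Longrightarrow> x = y"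
  by (subst sum_lay[of x, symmetric], subst sum_lay[of y, symmetric]) (rule sum.cong, auto)

lemma linear_dil: "linear (dil s)"
  unfolding dil_def
  by (intro linear_compose_sum ballI linear_compose_scale_right linear_lay) 

lemma dil_dil [simp]: "dil s (dil t x) = dil (s * t) x"
  by (rule eq_if_lay_eq) (simp add: lay_dil power_mult_distrib)

lemma dil_1 [simp]: "dil 1 x = x"
  by (rule eq_if_lay_eq) (simp add: lay_dil)

lemma dil_0 [simp]: "dil s 0 = 0"
  by (rule linear_0[OF linear_dil])

lemma dil_layer: "x \<in> layer j \<Longrightarrow> dil s x = s ^ j *\<^sub>R x"
  by (rule eq_if_lay_eq) (simp add: lay_dil linear_cmul[OF linear_lay] lay_of_layer)

lemma dil_V1: "x \<in> V 1 \<Longrightarrow> dil s x = s *\<^sub>R x"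
  using dil_layer[of x 1 s] l_pos by (simp add: layer_def)

lemma dil_lbr: "dil s (lbr x y) = lbr (dil s x) (dil s y)"
proof -
  have d: "dil s (lbr (lay i x) (lay j y)) = lbr (dil s (lay i x)) (dil s (lay j y))"
    if "1 \<le> j" for i j
    using dil_layer[OF lbr_layer[OF that lay_layer lay_layer], of s i x y]
      dil_layer[OF lay_layer, of s i x] dil_layer[OF lay_layer, of s j y]
    by (simp add: bilinear_lmul[OF bilinear_lbr] bilinear_rmul[OF bilinear_lbr] power_add)
  have "dil s (lbr x y) = dil s (lbr (\<Sum>i\<in>{1..l}. lay i x) (\<Sum>j\<in>{1..l}. lay j y))"
    by (simp only: sum_lay)
  also have "\<dots> = (\<Sum>(i, j)\<in>{1..l} \<times> {1..l}. lbr (dil s (lay i x)) (dil s (lay j y)))"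
    using d by (auto simp: bilinear_sum[OF bilinear_lbr] linear_sum[OF linear_dil] intro!: sum.cong)
  also have "\<dots> = lbr (\<Sum>i\<in>{1..l}. dil s (lay i x)) (\<Sum>j\<in>{1..l}. dil s (lay j y))"
    by (simp add: bilinear_sum[OF bilinear_lbr])
  also have "\<dots> = lbr (dil s x) (dil s y)"
    by (simp only: linear_sum[OF linear_dil, symmetric] sum_lay)
  finally show ?thesis .
qed

lemma dil_mul: "dil s (x \<odot> y) = dil s x \<odot> dil s y"
  by (rule hom_if_lbr_hom[OF linear_dil dil_lbr])

lemma dil_minus: "dil s (- x) = - dil s x"
  by (rule linear_neg[OF linear_dil])

lemma lay_bound:
  obtains C where "C \<ge> 1" "\<And>j x. norm (lay j x) \<le> C * norm x"
proof -
  have "\<forall>j. \<exists>K. \<forall>x. norm (lay j x) \<le> norm x * K"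
    using bounded_linear.bounded[OF bounded_linear_lay] by blast
  then obtain K where K: "\<And>j x. norm (lay j x) \<le> norm x * K j" by metis
  show thesis
  proof
    show "1 \<le> 1 + (\<Sum>j\<in>{1..l}. \<bar>K j\<bar>)" by (simp add: sum_nonneg)
    show "norm (lay j x) \<le> (1 + (\<Sum>j\<in>{1..l}. \<bar>K j\<bar>)) * norm x" for j x
    proof (cases "j \<in> {1..l}")
      case True
      then have "K j \<le> 1 + (\<Sum>j\<in>{1..l}. \<bar>K j\<bar>)"
        using member_le_sum[OF True, of "\<lambda>j. \<bar>K j\<bar>"] by auto
      then show ?thesis
        using K[of j x] mult_right_mono[of "K j" "1 + (\<Sum>j\<in>{1..l}. \<bar>K j\<bar>)" "norm x"] by (simp add: mult_ac)
    qed (use lay_outside in \<open>auto simp: sum_nonneg\<close>)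
  qed
qed

lemma dil_inverse_bound:
  obtains C where "C \<ge> 1" "\<And>s x. 0 < s \<Longrightarrow> s \<le> 1 \<Longrightarrow> norm (dil (1 / s) x) \<le> C * (1 / s) ^ l * norm x"
proof -
  obtain C where C: "C \<ge> 1" "\<And>j x. norm (lay j x) \<le> C * norm x" using lay_bound by blast
  show thesis
  proof
    show "real l * C \<ge> 1" using C(1) l_pos mult_mono[of 1 "real l" 1 C] by simp
    fix s :: real and x assume s: "0 < s" "s \<le> 1"
    have "norm (dil (1 / s) x) \<le> (\<Sum>j\<in>{1..l}. (1 / s) ^ l * (C * norm x))"
      unfolding dil_def
    proof (rule sum_norm_le)
      fix j assume "j \<in> {1..l}"
      then have "(1 / s) ^ j \<le> (1 / s) ^ l" using s by (intro power_increasing) auto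
      then show "norm ((1 / s) ^ j *\<^sub>R lay j x) \<le> (1 / s) ^ l * (C * norm x)"
        using C(2)[of j x] s by (auto intro!: mult_mono)
    qed
    then show "norm (dil (1 / s) x) \<le> real l * C * (1 / s) ^ l * norm x" by (simp add: mult_ac)
  qed
qed

lemma dil_bound:
  obtains C where "C \<ge> 1" "\<And>s x. 0 \<le> s \<Longrightarrow> s \<le> 1 \<Longrightarrow> norm (dil s x) \<le> C * s * norm x"
proof -
  obtain C where C: "C \<ge> 1" "\<And>j x. norm (lay j x) \<le> C * norm x" using lay_bound by blast
  show thesis
  proof
    show "real l * C \<ge> 1" using C(1) l_pos mult_mono[of 1 "real l" 1 C] by simp
    fix s :: real and x assume s: "0 \<le> s" "s \<le> 1"
    have "norm (dil s x) \<le> (\<Sum>j\<in>{1..l}. s * (C * norm x))"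
      unfolding dil_def
    proof (rule sum_norm_le)
      fix j assume "j \<in> {1..l}"
      then have "s ^ j \<le> s ^ 1" using s by (intro power_decreasing) auto
      then show "norm (s ^ j *\<^sub>R lay j x) \<le> s * (C * norm x)"
        using C(2)[of j x] s by (auto intro!: mult_mono)
    qed
    then show "norm (dil s x) \<le> real l * C * s * norm x" by (simp add: mult_ac)
  qed
qed

lemma continuous_on_dil [continuous_intros]:
  "continuous_on S f \<Longrightarrow> continuous_on S g \<Longrightarrow> continuous_on S (\<lambda>x. dil (f x) (g x))"
  unfolding dil_def
  by (intro continuous_intros bounded_linear.continuous_on[OF bounded_linear_lay])

lemma tendsto_dil [tendsto_intros]:
  "(f \<longlongrightarrow> s) F \<Longrightarrow> (g \<longlongrightarrow> x) F \<Longrightarrow> ((\<lambda>i. dil (f i) (g i)) \<longlongrightarrow> dil s x) F"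
  unfolding dil_def by (intro tendsto_intros bounded_linear.tendsto[OF bounded_linear_lay])

lemma dil_zero_left: "dil 0 x = 0"
  unfolding dil_def by (simp add: power_0_left)

end

section \<open>Horizontal curves and the Carnot distance\<close>

text \<open>The velocity bound is available only while the curve stays in the unit ball. Up to the
  first time at which the norm reaches \<open>1\<close> it gives
  \<open>norm (c t) \<le> \<Lambda> t\<close>, and \<open>\<Lambda> 1 < 1\<close> excludes such a
  time.\<close>

lemma first_exit:
  fixes c :: "real \<Rightarrow> 'a::real_normed_vector"
  assumes c: "\<And>t. 0 \<le> t \<Longrightarrow> t \<le> 1 \<Longrightarrow> (c has_vector_derivative c' t) (at t)" and "c 0 = 0"
    and bnd: "\<And>t. 0 \<le> t \<Longrightarrow> t \<le> 1 \<Longrightarrow> norm (c t) \<le> 1 \<Longrightarrow> norm (c' t) \<le> k t"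
    and cont: "continuous_on {0..1} \<Lambda>"
    and \<Lambda>: "\<And>t. 0 < t \<Longrightarrow> t < 1 \<Longrightarrow> (\<Lambda> has_vector_derivative k t) (at t)"
    and "\<Lambda> 0 = 0" and mono: "\<And>t. 0 \<le> t \<Longrightarrow> t \<le> 1 \<Longrightarrow> \<Lambda> t \<le> \<Lambda> 1" and "\<Lambda> 1 < 1"
  shows "norm (c 1) \<le> \<Lambda> 1"
proof -
  have cc: "continuous_on {0..1} c"
    using c by (intro continuous_at_imp_continuous_on ballI has_vector_derivative_continuous) auto
  have bd: "norm (c b) \<le> \<Lambda> b" if b: "0 < b" "b \<le> 1" and lt: "\<And>t. 0 < t \<Longrightarrow> t < b \<Longrightarrow> norm (c t) \<le> 1" for b
  proof -
    have "norm (c b - c 0) \<le> \<Lambda> b - \<Lambda> 0"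
    proof (rule differentiable_bound_general[OF b(1)])
      show "continuous_on {0..b} c" "continuous_on {0..b} \<Lambda>"
        using cc cont b by (auto elim: continuous_on_subset)
      fix t assume t: "0 < t" "t < b"
      show "(c has_vector_derivative c' t) (at t)" using c t b by simp
      show "(\<Lambda> has_vector_derivative k t) (at t)" using \<Lambda> t b by simp
      show "norm (c' t) \<le> k t" using bnd t b lt[OF t] by simp
    qed
    then show ?thesis using assms by simp
  qed
  have "norm (c t) < 1" if t: "0 \<le> t" "t \<le> 1" for t
  proof (rule ccontr)
    assume "\<not> norm (c t) < 1"
    define S where "S = {0..1} \<inter> (\<lambda>t. norm (c t)) -` {1..}"
    have cl: "closed S"
      unfolding S_def by (intro continuous_closed_preimage continuous_on_norm cc) auto
    have ne: "S \<noteq> {}" "bdd_below S" using t \<open>\<not> norm (c t) < 1\<close> by (auto simp: S_def)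
    define t0 where "t0 = Inf S"
    have t0: "t0 \<in> S" unfolding t0_def by (rule closed_contains_Inf[OF ne cl])
    have "t0 \<noteq> 0" using t0 \<open>c 0 = 0\<close> by (auto simp: S_def)
    then have "norm (c t0) \<le> \<Lambda> t0"
    proof (intro bd)
      show "norm (c t) \<le> 1" if "0 < t" "t < t0" for t
      proof (rule ccontr)
        assume "\<not> norm (c t) \<le> 1"
        then have "t \<in> S" using that t0 by (auto simp: S_def)
        then have "t0 \<le> t" unfolding t0_def using ne(2) by (rule cInf_lower)
        then show False using that by simp
      qed
    qed (use t0 in \<open>auto simp: S_def\<close>)
    moreover have "\<Lambda> t0 < 1" "norm (c t0) \<ge> 1"
      using mono[of t0] t0 \<open>\<Lambda> 1 < 1\<close> by (auto simp: S_def)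
    ultimately show False by linarith
  qed
  then show ?thesis by (intro bd) (auto intro: less_imp_le)
qed

context exp_chart begin

lemma has_lvel_hom:
  assumes "linear \<phi>" "\<And>x y. \<phi> (x \<odot> y) = \<phi> x \<odot> \<phi> y" "has_lvel c w t"
  shows "has_lvel (\<lambda>s. \<phi> (c s)) (\<phi> w) t"
proof -
  have "bounded_linear \<phi>" using assms(1) linear_conv_bounded_linear by blast
  from bounded_linear.has_vector_derivative[OF this assms(3)[unfolded has_lvel_iff]]
  show ?thesis by (simp add: has_lvel_iff assms(2) linear_neg[OF assms(1)])
qed

lemma has_lvel_compose:
  assumes "has_lvel c w (\<theta> t)" "(\<theta> has_real_derivative r) (at t)"
  shows "has_lvel (\<lambda>s. c (\<theta> s)) (r *\<^sub>R w) t"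
  using vector_diff_chain_at[OF assms(2)[unfolded has_real_derivative_iff_has_vector_derivative]
      assms(1)[unfolded has_lvel_def]]
  by (simp add: has_lvel_def comp_def linear_cmul[OF linear_lin])

lemma smooth_mul_left: "smooth c \<Longrightarrow> smooth (\<lambda>t. p \<odot> c t)"
  using smooth_compose[OF smooth_Pair[OF smooth_const[of p]] smooth_mul] by simp

lemma lin_bound:
  obtains C where "C > 0" "\<And>p v. norm p \<le> 1 \<Longrightarrow> norm (lin p v) \<le> C * norm v"
proof -
  have "compact ((\<lambda>(p, v). lin p v) ` (cball 0 1 \<times> cball 0 1))"
    by (intro compact_continuous_image compact_Times compact_cball)
      (auto simp: case_prod_unfold intro!: continuous_intros)
  then obtain C where "\<forall>p\<in>cball 0 1. \<forall>v\<in>cball 0 1. norm (lin p v) \<le> C"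
    by (auto dest!: compact_imp_bounded simp: bounded_iff)
  then have C: "norm (lin p v) \<le> C" if "norm p \<le> 1" "norm v \<le> 1" for p v
    using that by simp
  show thesis
  proof
    show "\<bar>C\<bar> + 1 > 0" by simp
    show "norm (lin p v) \<le> (\<bar>C\<bar> + 1) * norm v" if p: "norm p \<le> 1" for p v
    proof (cases "v = 0")
      case False
      have "norm (lin p (v /\<^sub>R norm v)) \<le> C" using False by (intro C[OF p]) simp
      then have "norm (lin p v) \<le> C * norm v"
        using False by (simp add: linear_cmul[OF linear_lin] divide_inverse_commute[symmetric] pos_divide_le_eq)
      also have "\<dots> \<le> (\<bar>C\<bar> + 1) * norm v" by (intro mult_right_mono) auto
      finally show ?thesis .
    qed (simp add: linear_0[OF linear_lin])
  qed
qed

end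

context stratified_chart begin

definition hcurve :: "(real \<Rightarrow> 'a) \<Rightarrow> (real \<Rightarrow> 'a) \<Rightarrow> bool" where
  "hcurve c X \<longleftrightarrow> smooth c \<and> (\<forall>t\<in>{0..1}. X t \<in> V 1 \<and> has_lvel c (X t) t)"

definition arclen :: "(real \<Rightarrow> 'a) \<Rightarrow> real \<Rightarrow> real" where
  "arclen X t = integral {0..t} (\<lambda>t. norm (X t))"

definition reach :: "'a \<Rightarrow> 'a \<Rightarrow> real \<Rightarrow> bool" where
  "reach p q L \<longleftrightarrow> (\<exists>c X. hcurve c X \<and> c 0 = p \<and> c 1 = q \<and> L = arclen X 1)"

text \<open>On \<open>{0..1}\<close> the field is recovered from the curve as \<open>mc\<close>
  applied to its ordinary derivative.\<close>

lemma hcurve_continuous: "hcurve c X \<Longrightarrow> continuous_on {0..1} X"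
proof -
  assume h: "hcurve c X"
  then have s: "smooth c" by (simp add: hcurve_def)
  note [continuous_intros] = C1_derivative_continuous[OF smooth_Ck[OF s]]
  have "X t = mc (c t) (frechet_derivative c (at t) 1)" if "t \<in> {0..1}" for t
  proof -
    have "lin (c t) (X t) = frechet_derivative c (at t) 1"
      using h that vector_derivative_unique_at[OF _ smooth_vector_derivative[OF s]]
      by (auto simp: hcurve_def has_lvel_def)
    then show ?thesis by (metis mc_lin)
  qed
  moreover have "continuous_on {0..1} (\<lambda>t. mc (c t) (frechet_derivative c (at t) 1))"
    using continuous_on_subset[OF Ck_continuous[OF smooth_Ck[OF s]]]
    by (intro continuous_intros) auto
  ultimately show ?thesis by (metis (no_types, lifting) continuous_on_cong)
qed

lemma hcurve_mul_left: "hcurve c X \<Longrightarrow> hcurve (\<lambda>t. p \<odot> c t) X"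
  by (auto simp: hcurve_def smooth_mul_left has_lvel_mul_left)

lemma reach_mul_left: "reach p q L \<Longrightarrow> reach (a \<odot> p) (a \<odot> q) L"
proof -
  assume "reach p q L"
  then obtain c X where "hcurve c X" "c 0 = p" "c 1 = q" "L = arclen X 1" by (auto simp: reach_def)
  then show ?thesis
    unfolding reach_def using hcurve_mul_left[of c X a]
    by (intro exI[of _ "\<lambda>t. a \<odot> c t"] exI[of _ X]) simp
qed

lemma arclen_derivative:
  assumes "continuous_on {0..1} X" "t \<in> {0..1}"
  shows "(arclen X has_real_derivative norm (X t)) (at t within {0..1})"
  unfolding arclen_def
  using integral_has_real_derivative[OF continuous_on_norm[OF assms(1)] assms(2)] .

lemma arclen_0 [simp]: "arclen X 0 = 0"
  by (simp add: arclen_def)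

lemma arclen_nonneg: "arclen X t \<ge> 0"
  unfolding arclen_def
  by (cases "(\<lambda>t. norm (X t)) integrable_on {0..t}") (auto intro: integral_nonneg simp: not_integrable_integral)

text \<open>A signed length: \<open>\<theta>'\<close> may be negative, which is used for reversed
  curves.\<close>

lemma reparam_length:
  assumes X: "continuous_on {0..1} X" and \<theta>: "\<And>t. (\<theta> has_real_derivative \<theta>' t) (at t)"
    and im: "\<And>t. t \<in> {0..1} \<Longrightarrow> \<theta> t \<in> {0..1}"
  shows "((\<lambda>t. norm (X (\<theta> t)) * \<theta>' t) has_integral arclen X (\<theta> 1) - arclen X (\<theta> 0)) {0..1}"
proof (rule fundamental_theorem_of_calculus)
  fix t :: real assume t: "t \<in> {0..1}"
  have "(\<theta> has_real_derivative \<theta>' t) (at t within {0..1})"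
    by (rule has_field_derivative_at_within[OF \<theta>])
  from DERIV_image_chain[OF DERIV_subset[OF arclen_derivative[OF X im[OF t]]] this]
  have "(arclen X \<circ> \<theta> has_real_derivative norm (X (\<theta> t)) * \<theta>' t) (at t within {0..1})"
    using im by blast
  then show "((\<lambda>t. arclen X (\<theta> t)) has_vector_derivative norm (X (\<theta> t)) * \<theta>' t) (at t within {0..1})"
    by (simp add: has_real_derivative_iff_has_vector_derivative comp_def)
qed simp

lemma hcurve_reparam:
  assumes h: "hcurve c X" and s: "smooth \<theta>" and \<theta>: "\<And>t. (\<theta> has_real_derivative \<theta>' t) (at t)"
    and im: "\<And>t. t \<in> {0..1} \<Longrightarrow> \<theta> t \<in> {0..1}"
  shows "hcurve (\<lambda>t. c (\<theta> t)) (\<lambda>t. \<theta>' t *\<^sub>R X (\<theta> t))"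
  unfolding hcurve_def
proof (intro conjI ballI)
  show "smooth (\<lambda>t. c (\<theta> t))" using h s by (simp add: hcurve_def smooth_compose)
  fix t :: real assume "t \<in> {0..1}"
  from im[OF this] h have x: "X (\<theta> t) \<in> V 1" "has_lvel c (X (\<theta> t)) (\<theta> t)" by (auto simp: hcurve_def)
  show "\<theta>' t *\<^sub>R X (\<theta> t) \<in> V 1" using x(1) subspace_scale[OF subspace_V1] by blast
  show "has_lvel (\<lambda>t. c (\<theta> t)) (\<theta>' t *\<^sub>R X (\<theta> t)) t" by (rule has_lvel_compose[OF x(2) \<theta>])
qed

lemma reach_reparam:
  assumes h: "hcurve c X" and s: "smooth \<theta>" and \<theta>: "\<And>t. (\<theta> has_real_derivative \<theta>' t) (at t)"
    and im: "\<And>t. t \<in> {0..1} \<Longrightarrow> \<theta> t \<in> {0..1}" and nn: "\<And>t. \<theta>' t \<ge> 0"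
  shows "reach (c (\<theta> 0)) (c (\<theta> 1)) (arclen X (\<theta> 1) - arclen X (\<theta> 0))"
proof -
  have "arclen X (\<theta> 1) - arclen X (\<theta> 0) = arclen (\<lambda>t. \<theta>' t *\<^sub>R X (\<theta> t)) 1"
    using integral_unique[OF reparam_length[OF hcurve_continuous[OF h] \<theta> im]] nn
    by (simp add: arclen_def mult.commute)
  then show ?thesis
    unfolding reach_def using hcurve_reparam[OF h s \<theta> im] by blast
qed

lemma affine_real_derivative: "((\<lambda>t. a + t * b) has_real_derivative b) (at t)"
  by (auto intro!: derivative_eq_intros)

lemma smooth_affine_real: "smooth (\<lambda>t::real. a + t * b :: real)"
  using smooth_affine[of a b] by simp

lemma reach_subcurve:
  assumes h: "hcurve c X" and ab: "0 \<le> a" "a \<le> b" "b \<le> 1"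
  shows "reach (c a) (c b) (arclen X b - arclen X a)"
proof -
  have "a + t * (b - a) \<in> {0..1}" if "t \<in> {0..1}" for t
    using that ab mult_left_le_one_le[of "b - a" t] by auto
  from reach_reparam[OF h smooth_affine_real[of a "b - a"] affine_real_derivative this] ab show ?thesis by simp
qed

lemma reach_sym: "reach p q L \<Longrightarrow> reach q p L"
proof -
  assume "reach p q L"
  then obtain c X where h: "hcurve c X" and c: "c 0 = p" "c 1 = q" "L = arclen X 1"
    by (auto simp: reach_def)
  have d: "((\<lambda>t. 1 + t * (-1)) has_real_derivative -1) (at t)" for t :: real
    by (rule affine_real_derivative)
  have im: "1 + t * (-1) \<in> {0..1}" if "t \<in> {0..1}" for t :: real using that by simp
  have "((\<lambda>t. norm (X (1 + t * (-1))) * (-1)) has_integral - L) {0..1}"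
    using reparam_length[OF hcurve_continuous[OF h] d im] by (simp add: c)
  from has_integral_neg[OF this]
  have "L = arclen (\<lambda>t. (-1) *\<^sub>R X (1 + t * (-1))) 1"
    by (simp add: arclen_def integral_unique)
  moreover have "hcurve (\<lambda>t. c (1 + t * (-1))) (\<lambda>t. (-1) *\<^sub>R X (1 + t * (-1)))"
    using hcurve_reparam[OF h smooth_affine_real[of 1 "-1"] d im] .
  ultimately show ?thesis unfolding reach_def using c
    by (intro exI[of _ "\<lambda>t. c (1 + t * (-1))"] exI[of _ "\<lambda>t. (-1) *\<^sub>R X (1 + t * (-1))"]) simp
qed

lemma reach_ray: "u \<in> V 1 \<Longrightarrow> reach 0 u (norm u)"
  unfolding reach_def hcurve_def
  by (intro exI[of _ "\<lambda>t. t *\<^sub>R u"] exI[of _ "\<lambda>t. u"])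
    (auto simp: arclen_def has_lvel_ray intro: smooth_linear bounded_linear_scaleR_left)

lemma reach_dil: "s > 0 \<Longrightarrow> reach p q L \<Longrightarrow> reach (dil s p) (dil s q) (s * L)"
proof -
  assume s: "s > 0" and "reach p q L"
  then obtain c X where h: "hcurve c X" and c: "c 0 = p" "c 1 = q" "L = arclen X 1"
    by (auto simp: reach_def)
  have "hcurve (\<lambda>t. dil s (c t)) (\<lambda>t. s *\<^sub>R X t)"
    unfolding hcurve_def
  proof (intro conjI ballI)
    have "bounded_linear (dil s)" using linear_dil linear_conv_bounded_linear by blast
    then show "smooth (\<lambda>t. dil s (c t))" using h by (simp add: hcurve_def smooth_bounded_linear)
    fix t :: real assume "t \<in> {0..1}"
    with h have x: "X t \<in> V 1" "has_lvel c (X t) t" by (auto simp: hcurve_def)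
    show "s *\<^sub>R X t \<in> V 1" using x(1) subspace_scale[OF subspace_V1] by blast
    show "has_lvel (\<lambda>t. dil s (c t)) (s *\<^sub>R X t) t"
      using has_lvel_hom[OF linear_dil dil_mul x(2)] by (simp add: dil_V1[OF x(1)])
  qed
  moreover have "s * L = arclen (\<lambda>t. s *\<^sub>R X t) 1" using s by (simp add: c arclen_def)
  ultimately show ?thesis unfolding reach_def using c by blast
qed

text \<open>Reparametrizing by a step function makes the two pieces stationary, to infinite order, where
  they are joined.  The sum below then needs no gluing: one of its summands is always constant.\<close>

lemma reach_trans: "reach p q L \<Longrightarrow> reach q r M \<Longrightarrow> reach p r (L + M)"
proof -
  assume "reach p q L" "reach q r M"
  then obtain c1 X1 c2 X2 where h1: "hcurve c1 X1" and h2: "hcurve c2 X2"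
    and c: "c1 0 = p" "c1 1 = q" "L = arclen X1 1" "c2 0 = q" "c2 1 = r" "M = arclen X2 1"
    unfolding reach_def by blast
  obtain \<psi> \<psi>' :: "real \<Rightarrow> real" where \<psi>: "smooth \<psi>" "\<And>t. (\<psi> has_real_derivative \<psi>' t) (at t)"
    "\<And>t. 0 \<le> \<psi>' t" "\<And>t. t \<le> 0 \<Longrightarrow> \<psi>' t = 0" "\<And>t. t \<ge> 1 \<Longrightarrow> \<psi>' t = 0"
    "\<And>t. t \<le> 0 \<Longrightarrow> \<psi> t = 0" "\<And>t. t \<ge> 1 \<Longrightarrow> \<psi> t = 1" "\<And>t. 0 \<le> \<psi> t" "\<And>t. \<psi> t \<le> 1"
    using smooth_step_exists by blast
  \<comment> \<open>With \<open>a = 0\<close> the step is completed on the first half of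
    \<open>{0..1}\<close>; with \<open>a = -1\<close> it starts at \<open>1 / 2\<close>.\<close>
  define \<theta> where "\<theta> a t = \<psi> (a + t * 2)" for a t
  define \<theta>' where "\<theta>' a t = \<psi>' (a + t * 2) * 2" for a t
  have s: "smooth (\<theta> a)" for a unfolding \<theta>_def[abs_def] by (rule smooth_compose[OF smooth_affine_real \<psi>(1)])
  have d: "(\<theta> a has_real_derivative \<theta>' a t) (at t)" for a t
    unfolding \<theta>_def[abs_def] \<theta>'_def by (rule DERIV_chain2[OF \<psi>(2) affine_real_derivative])
  have im: "\<theta> a t \<in> {0..1}" for a t using \<psi>(8,9) by (simp add: \<theta>_def)
  note k1 = hcurve_reparam[OF h1 s d im, of 0] and k2 = hcurve_reparam[OF h2 s d im, of "-1"]
  note i1 = reparam_length[OF hcurve_continuous[OF h1] d im, of 0]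
  note i2 = reparam_length[OF hcurve_continuous[OF h2] d im, of "-1"]
  have v: "\<theta> 0 0 = 0" "\<theta> 0 1 = 1" "\<theta> (-1) 0 = 0" "\<theta> (-1) 1 = 1" using \<psi>(6,7) by (simp_all add: \<theta>_def)
  \<comment> \<open>At every time one of the two curves sits at \<open>q\<close>, so subtracting
    \<open>q\<close> leaves the other one.\<close>
  define k where "k t = c1 (\<theta> 0 t) + (c2 (\<theta> (-1) t) + (- q))" for t
  define X where "X t = (if t \<le> 1 / 2 then \<theta>' 0 t *\<^sub>R X1 (\<theta> 0 t) else \<theta>' (-1) t *\<^sub>R X2 (\<theta> (-1) t))" for t
  have "hcurve k X"
    unfolding hcurve_def
  proof (intro conjI ballI)
    show "smooth k" unfolding k_def[abs_def]
      using k1 k2 by (intro smooth_add smooth_const) (auto simp: hcurve_def)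
    fix t :: real assume t: "t \<in> {0..1}"
    show "X t \<in> V 1" using k1 k2 t by (auto simp: hcurve_def X_def)
    have D: "(k has_vector_derivative lin (c1 (\<theta> 0 t)) (\<theta>' 0 t *\<^sub>R X1 (\<theta> 0 t))
        + (lin (c2 (\<theta> (-1) t)) (\<theta>' (-1) t *\<^sub>R X2 (\<theta> (-1) t)) + 0)) (at t)"
      unfolding k_def[abs_def] using k1 k2 t
      by (intro has_vector_derivative_add has_vector_derivative_const) (auto simp: hcurve_def has_lvel_def)
    show "has_lvel k (X t) t"
    proof (cases "t \<le> 1 / 2")
      case True
      then have "\<theta>' (-1) t = 0" "\<theta> (-1) t = 0" using \<psi>(4,6) by (simp_all add: \<theta>_def \<theta>'_def)
      then show ?thesis using D True by (simp add: has_lvel_def X_def k_def c linear_0[OF linear_lin])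
    next
      case False
      then have "\<theta>' 0 t = 0" "\<theta> 0 t = 1" using \<psi>(5,7) by (simp_all add: \<theta>_def \<theta>'_def)
      then show ?thesis using D False by (simp add: has_lvel_def X_def k_def c linear_0[OF linear_lin])
    qed
  qed
  moreover have "arclen X 1 = L + M"
  proof -
    have "norm (X t) = norm (X1 (\<theta> 0 t)) * \<theta>' 0 t + norm (X2 (\<theta> (-1) t)) * \<theta>' (-1) t" for t
    proof (cases "t \<le> 1 / 2")
      case True
      then have "\<theta>' (-1) t = 0" using \<psi>(4) by (simp add: \<theta>'_def)
      then show ?thesis using True \<psi>(3) by (simp add: X_def \<theta>'_def)
    next
      case False
      then have "\<theta>' 0 t = 0" using \<psi>(5) by (simp add: \<theta>'_def)
      then show ?thesis using False \<psi>(3) by (simp add: X_def \<theta>'_def)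
    qed
    then show ?thesis
      using integral_unique[OF has_integral_add[OF i1 i2]] by (simp add: arclen_def v c)
  qed
  moreover have "k 0 = p" "k 1 = r" using v c by (simp_all add: k_def)
  ultimately show ?thesis
    unfolding reach_def by (intro exI[of _ k] exI[of _ X]) simp
qed

lemma reach_nonneg: "reach p q L \<Longrightarrow> L \<ge> 0"
  by (auto simp: reach_def arclen_nonneg)

text \<open>In the unit ball the Euclidean speed is at most \<open>C\<close> times the horizontal
  speed, so a curve from \<open>0\<close> shorter than \<open>1 / C\<close> cannot leave that
  ball.\<close>

lemma reach_short_bounded:
  obtains \<epsilon> where "\<epsilon> > 0" "\<And>x L. reach 0 x L \<Longrightarrow> L < \<epsilon> \<Longrightarrow> norm x \<le> 1"
proof -
  obtain C where C: "C > 0" "\<And>p v. norm p \<le> 1 \<Longrightarrow> norm (lin p v) \<le> C * norm v"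
    using lin_bound by blast
  show thesis
  proof
    show "1 / C > 0" using C(1) by simp
    fix x L assume "reach 0 x L" and L: "L < 1 / C"
    then obtain c X where h: "hcurve c X" and c: "c 0 = 0" "c 1 = x" "L = arclen X 1"
      by (auto simp: reach_def)
    note d = arclen_derivative[OF hcurve_continuous[OF h]]
    have mono: "arclen X t \<le> arclen X 1" if "0 \<le> t" "t \<le> 1" for t
      using reach_nonneg[OF reach_subcurve[OF h that(1) that(2)]] by simp
    have "norm (c 1) \<le> C * arclen X 1"
    proof (rule first_exit)
      show "(c has_vector_derivative lin (c t) (X t)) (at t)" if "0 \<le> t" "t \<le> 1" for t
        using h that by (simp add: hcurve_def has_lvel_def)
      show "norm (lin (c t) (X t)) \<le> C * norm (X t)" if "norm (c t) \<le> 1" for t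
        by (rule C(2)[OF that])
      have "continuous_on {0..1} (arclen X)" by (rule DERIV_continuous_on[OF d])
      then show "continuous_on {0..1} (\<lambda>t. C * arclen X t)" by (intro continuous_intros)
      show "((\<lambda>t. C * arclen X t) has_vector_derivative C * norm (X t)) (at t)" if t: "0 < t" "t < 1" for t
      proof -
        have "(arclen X has_real_derivative norm (X t)) (at t)"
          using d[of t] t by (simp add: at_within_Icc_at)
        then show ?thesis
          unfolding has_real_derivative_iff_has_vector_derivative[symmetric] by (rule DERIV_cmult)
      qed
      show "C * arclen X t \<le> C * arclen X 1" if "0 \<le> t" "t \<le> 1" for t
        using mono[OF that] C(1) by simp
      show "C * arclen X 1 < 1" using L C(1) by (simp add: c(3)[symmetric] pos_less_divide_eq mult.commute)
    qed (use c in auto)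
    also have "\<dots> \<le> 1" using L C(1) by (simp add: c(3)[symmetric] pos_less_divide_eq mult.commute less_imp_le)
    finally show "norm x \<le> 1" by (simp add: c)
  qed
qed

section \<open>Generation by the first layer\<close>

definition prodl :: "'a list \<Rightarrow> 'a" where "prodl us = foldr (\<odot>) us 0"

lemma prodl_Nil [simp]: "prodl [] = 0" by (simp add: prodl_def)
lemma prodl_Cons [simp]: "prodl (u # us) = u \<odot> prodl us" by (simp add: prodl_def)

lemma prodl_append: "prodl (us @ vs) = prodl us \<odot> prodl vs"
  by (induction us) (auto simp: mul_assoc)

lemma prodl_rev_minus: "prodl (rev (map uminus us)) = - prodl us"
  by (induction us) (auto simp: prodl_append minus_mul)

lemma dil_prodl: "dil s (prodl us) = prodl (map (dil s) us)"
  by (induction us) (auto simp: dil_mul)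

text \<open>Counts the factors and bounds their size, so that membership yields both a bounded set
  and a curve of controlled length.\<close>

definition gen :: "nat \<Rightarrow> real \<Rightarrow> 'a \<Rightarrow> bool" where
  "gen n C x \<longleftrightarrow> (\<exists>us. length us \<le> n \<and> (\<forall>u\<in>set us. u \<in> V 1 \<and> norm u \<le> C) \<and> x = prodl us)"

lemma gen_0: "gen n C 0"
  unfolding gen_def by (intro exI[of _ "[]"]) simp

lemma gen_V1: "u \<in> V 1 \<Longrightarrow> norm u \<le> C \<Longrightarrow> gen 1 C u"
  unfolding gen_def by (intro exI[of _ "[u]"]) simp

lemma gen_mul:
  assumes "gen n C x" "gen m D y" shows "gen (n + m) (max C D) (x \<odot> y)"
proof -
  obtain us vs where "length us \<le> n" "\<forall>u\<in>set us. u \<in> V 1 \<and> norm u \<le> C" "x = prodl us"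
    "length vs \<le> m" "\<forall>u\<in>set vs. u \<in> V 1 \<and> norm u \<le> D" "y = prodl vs"
    using assms by (auto simp: gen_def)
  then show ?thesis
    unfolding gen_def by (intro exI[of _ "us @ vs"]) (auto simp: prodl_append)
qed

lemma gen_minus:
  assumes "gen n C x" shows "gen n C (- x)"
proof -
  obtain us where "length us \<le> n" "\<forall>u\<in>set us. u \<in> V 1 \<and> norm u \<le> C" "x = prodl us"
    using assms by (auto simp: gen_def)
  then show ?thesis
    unfolding gen_def using subspace_neg[OF subspace_V1]
    by (intro exI[of _ "rev (map uminus us)"]) (auto simp: prodl_rev_minus simp del: rev_map)
qed

lemma gen_dil:
  assumes "gen n C x" "s \<ge> 0" shows "gen n (s * C) (dil s x)"
proof -
  obtain us where "length us \<le> n" "\<forall>u\<in>set us. u \<in> V 1 \<and> norm u \<le> C" "x = prodl us"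
    using assms by (auto simp: gen_def)
  then show ?thesis
    unfolding gen_def using subspace_scale[OF subspace_V1] \<open>s \<ge> 0\<close>
    by (intro exI[of _ "map (dil s) us"]) (auto simp: dil_prodl dil_V1 mult_left_mono)
qed

lemma mul_bounded:
  obtains M where "\<And>x y. norm x \<le> R \<Longrightarrow> norm y \<le> S \<Longrightarrow> norm (x \<odot> y) \<le> M"
proof -
  have "compact ((\<lambda>z. fst z \<odot> snd z) ` (cball 0 R \<times> cball 0 S))"
    by (intro compact_continuous_image compact_Times compact_cball continuous_intros)
  then obtain M where "\<forall>z\<in>(\<lambda>z. fst z \<odot> snd z) ` (cball 0 R \<times> cball 0 S). norm z \<le> M"
    using compact_imp_bounded bounded_iff by metis
  then show thesis by (intro that[of M]) (force simp: image_iff)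
qed

lemma gen_bounded: "\<exists>R. \<forall>x. gen n C x \<longrightarrow> norm x \<le> R"
proof (induction n)
  case 0
  then show ?case by (auto simp: gen_def)
next
  case (Suc n)
  then obtain R where R: "\<And>x. gen n C x \<Longrightarrow> norm x \<le> R" by auto
  obtain M where M: "\<And>x y. norm x \<le> C \<Longrightarrow> norm y \<le> R \<Longrightarrow> norm (x \<odot> y) \<le> M"
    using mul_bounded by blast
  have "norm x \<le> max M 0" if "gen (Suc n) C x" for x
  proof -
    obtain us where us: "length us \<le> Suc n" "\<forall>u\<in>set us. u \<in> V 1 \<and> norm u \<le> C" "x = prodl us"
      using \<open>gen (Suc n) C x\<close> by (auto simp: gen_def)
    show ?thesis
    proof (cases us)
      case (Cons u vs)
      then have "gen n C (prodl vs)" using us by (auto simp: gen_def)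
      then show ?thesis using M[OF _ R] us Cons by fastforce
    qed (use us in simp)
  qed
  then show ?case by blast
qed

section \<open>Filtration by degree and leading terms\<close>

definition tail :: "nat \<Rightarrow> 'a set" where "tail k = {x. \<forall>j<k. lay j x = 0}"

lemma subspace_tail: "subspace (tail k)"
  unfolding tail_def
  by (auto simp: subspace_def linear_0[OF linear_lay] linear_add[OF linear_lay] linear_cmul[OF linear_lay])

lemma tail_1: "tail 1 = UNIV"
  using lay_outside by (auto simp: tail_def)

lemma tail_end: "tail (Suc l) = {0}"
proof -
  have "x = 0" if "x \<in> tail (Suc l)" for x
    by (rule eq_if_lay_eq) (use that in \<open>simp add: tail_def linear_0[OF linear_lay]\<close>)
  then show ?thesis using subspace_0[OF subspace_tail] by auto
qed

lemma dil_tail: "x \<in> tail k \<Longrightarrow> dil s x \<in> tail k"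
  by (simp add: tail_def lay_dil)

lemma dil_tail_bound:
  obtains C where "C \<ge> 1" "\<And>s k x. 0 \<le> s \<Longrightarrow> s \<le> 1 \<Longrightarrow> x \<in> tail k \<Longrightarrow> norm (dil s x) \<le> C * s ^ k * norm x"
proof -
  obtain C where C: "C \<ge> 1" "\<And>j x. norm (lay j x) \<le> C * norm x" using lay_bound by blast
  show thesis
  proof
    show "real l * C \<ge> 1" using C(1) l_pos mult_mono[of 1 "real l" 1 C] by simp
    fix s :: real and k x assume s: "0 \<le> s" "s \<le> 1" and x: "x \<in> tail k"
    have "norm (dil s x) \<le> (\<Sum>j\<in>{1..l}. s ^ k * (C * norm x))"
      unfolding dil_def
    proof (rule sum_norm_le)
      fix j assume "j \<in> {1..l}"
      show "norm (s ^ j *\<^sub>R lay j x) \<le> s ^ k * (C * norm x)"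
      proof (cases "j < k")
        case True
        then show ?thesis using x s C(1) by (simp add: tail_def)
      next
        case False
        then have "s ^ j \<le> s ^ k" using s by (intro power_decreasing) auto
        then show ?thesis using C(2)[of j x] s by (auto intro!: mult_mono)
      qed
    qed
    then show "norm (dil s x) \<le> real l * C * s ^ k * norm x" by (simp add: mult_ac)
  qed
qed

text \<open>Homogeneity turns estimates near the identity into identities for layers of low degree.\<close>

lemma homogeneous_vanish:
  assumes \<Phi>: "\<And>s. lay n (\<Phi> (dil s x) (dil s y)) = s ^ n *\<^sub>R lay n (\<Phi> x y)"
    and bnd: "\<And>\<epsilon>. \<epsilon> > 0 \<Longrightarrow> \<exists>d>0. \<forall>a b. norm a < d \<longrightarrow> norm b < d \<longrightarrow> norm (\<Phi> a b) \<le> \<epsilon> * norm a * norm b"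
    and x: "x \<in> tail i" and y: "y \<in> tail j" and n: "n \<le> i + j"
  shows "lay n (\<Phi> x y) = 0"
proof (rule ccontr)
  assume nz: "lay n (\<Phi> x y) \<noteq> 0"
  obtain C where C: "C \<ge> 1" "\<And>s k x. 0 \<le> s \<Longrightarrow> s \<le> 1 \<Longrightarrow> x \<in> tail k \<Longrightarrow> norm (dil s x) \<le> C * s ^ k * norm x"
    using dil_tail_bound by blast
  obtain D where D: "D \<ge> 1" "\<And>j x. norm (lay j x) \<le> D * norm x" using lay_bound by blast
  \<comment> \<open>The summand \<open>1\<close> makes \<open>K\<close> positive and one inequality
    in the chain below strict.\<close>
  define K where "K = D * (C * norm x) * (C * norm y) + 1"
  have K: "K > 0" unfolding K_def using C(1) D(1) by (simp add: add_nonneg_pos)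
  define \<epsilon> where "\<epsilon> = norm (lay n (\<Phi> x y)) / K"
  have \<epsilon>: "\<epsilon> > 0" using nz K by (simp add: \<epsilon>_def)
  obtain d where d: "d > 0" "\<And>a b. norm a < d \<Longrightarrow> norm b < d \<Longrightarrow> norm (\<Phi> a b) \<le> \<epsilon> * norm a * norm b"
    using bnd[OF \<epsilon>] by blast
  have "((\<lambda>s. norm (dil s x)) \<longlongrightarrow> norm (dil 0 x)) (at_right 0)"
    "((\<lambda>s. norm (dil s y)) \<longlongrightarrow> norm (dil 0 y)) (at_right 0)"
    by (intro tendsto_intros)+
  then have "\<forall>\<^sub>F s in at_right 0. norm (dil s x) < d \<and> norm (dil s y) < d \<and> 0 < s \<and> s < 1"
    using d(1) by (intro eventually_conj order_tendstoD(2)[of _ _ _ d] eventually_at_right_less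
        eventually_at_right_real[THEN eventually_mono]) (auto simp: dil_zero_left)
  then obtain s where s: "norm (dil s x) < d" "norm (dil s y) < d" "0 < s" "s < 1"
    using eventually_happens trivial_limit_at_right_real by blast
  have "s ^ n * norm (lay n (\<Phi> x y)) = norm (lay n (\<Phi> (dil s x) (dil s y)))"
    using s by (simp add: \<Phi>)
  also have "\<dots> \<le> D * (\<epsilon> * norm (dil s x) * norm (dil s y))"
    using D(2)[of n "\<Phi> (dil s x) (dil s y)"] d(2)[OF s(1,2)] D(1)
    by (meson mult_left_mono order_trans zero_le_one)
  also have "\<dots> \<le> D * (\<epsilon> * (C * s ^ i * norm x) * (C * s ^ j * norm y))"
    using C(2)[of s x i] C(2)[of s y j] s x y \<epsilon> D(1) C(1)
    by (intro mult_left_mono mult_mono) auto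
  also have "\<dots> = s ^ (i + j) * (\<epsilon> * (K - 1))" by (simp add: K_def power_add mult_ac)
  also have "\<dots> \<le> s ^ n * (\<epsilon> * (K - 1))"
    using s n \<epsilon> C(1) D(1) by (intro mult_right_mono power_decreasing) (auto simp: K_def)
  also have "\<dots> < s ^ n * (\<epsilon> * K)" using s \<epsilon> by simp
  also have "\<dots> = s ^ n * norm (lay n (\<Phi> x y))" using K by (simp add: \<epsilon>_def)
  finally show False by simp
qed

text \<open>The difference of commutator and bracket is homogeneous and small compared with
  \<open>norm x * norm y\<close>, so its parts of degree at most \<open>i + j\<close>
  vanish.\<close>

lemma lay_gcomm:
  assumes "x \<in> tail i" "y \<in> tail j" "n \<le> i + j"
  shows "lay n (gcomm x y) = lay n (lbr x y)"
proof -
  have "lay n (gcomm x y - lbr x y) = 0"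
  proof (rule homogeneous_vanish[of n "\<lambda>x y. gcomm x y - lbr x y", OF _ _ assms])
    have "gcomm (dil s x) (dil s y) = dil s (gcomm x y)" for s
      by (simp add: gcomm_def dil_mul dil_minus)
    then show "lay n (gcomm (dil s x) (dil s y) - lbr (dil s x) (dil s y)) = s ^ n *\<^sub>R lay n (gcomm x y - lbr x y)" for s
      by (simp add: lay_dil linear_diff[OF linear_lay] scaleR_right_diff_distrib flip: dil_lbr)
    show "\<exists>d>0. \<forall>a b. norm a < d \<longrightarrow> norm b < d \<longrightarrow> norm (gcomm a b - lbr a b) \<le> \<epsilon> * norm a * norm b"
      if "\<epsilon> > 0" for \<epsilon> using gcomm_expansion[OF that] by metis
  qed
  then show ?thesis by (simp add: linear_diff[OF linear_lay])
qed

lemma lay_lbr: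
  assumes "x \<in> tail i" "y \<in> tail j" "1 \<le> j" "n \<le> i + j"
  shows "lay n (lbr x y) = (if n = i + j then lbr (lay i x) (lay j y) else 0)"
proof -
  have z: "lay n (lbr (lay a x) (lay b y)) = (if n = i + j \<and> a = i \<and> b = j then lbr (lay i x) (lay j y) else 0)"
    if "b \<ge> 1" for a b
  proof (cases "a < i \<or> b < j")
    case True
    then have "lay a x = 0 \<or> lay b y = 0" using assms by (auto simp: tail_def)
    then show ?thesis using True
      by (auto simp: bilinear_lzero[OF bilinear_lbr] bilinear_rzero[OF bilinear_lbr] linear_0[OF linear_lay])
  next
    case False
    then show ?thesis
      using lay_of_layer[OF lbr_layer[OF that lay_layer lay_layer], of n a x y] assms(4) by auto
  qed
  have "lay n (lbr x y) = lay n (lbr (\<Sum>i\<in>{1..l}. lay i x) (\<Sum>j\<in>{1..l}. lay j y))"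
    by (simp only: sum_lay)
  also have "\<dots> = (\<Sum>a\<in>{1..l}. \<Sum>b\<in>{1..l}. lay n (lbr (lay a x) (lay b y)))"
    by (simp only: bilinear_sum[OF bilinear_lbr] linear_sum[OF linear_lay] sum.cartesian_product case_prod_unfold)
  also have "\<dots> = (\<Sum>a\<in>{1..l}. \<Sum>b\<in>{1..l}. if n = i + j \<and> a = i \<and> b = j then lbr (lay i x) (lay j y) else 0)"
    using z by (intro sum.cong) auto
  also have "\<dots> = (if n = i + j then lbr (lay i x) (lay j y) else 0)"
  proof (cases "n = i + j \<and> i \<in> {1..l} \<and> j \<in> {1..l}")
    case True
    have "(\<Sum>a\<in>{1..l}. \<Sum>b\<in>{1..l}. if n = i + j \<and> a = i \<and> b = j then lbr (lay i x) (lay j y) else 0)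
        = (\<Sum>a\<in>{1..l}. if a = i then lbr (lay i x) (lay j y) else 0)"
      using True by (intro sum.cong) (auto simp: sum.delta)
    then show ?thesis using True by (simp add: sum.delta)
  next
    case False
    then have "n = i + j \<Longrightarrow> lbr (lay i x) (lay j y) = 0"
      using lay_outside[of i] lay_outside[of j] bilinear_lzero[OF bilinear_lbr] bilinear_rzero[OF bilinear_lbr]
      by fastforce
    then show ?thesis using False by (auto intro!: sum.neutral)
  qed
  finally show ?thesis .
qed

lemma gcomm_tail:
  assumes "x \<in> tail i" "y \<in> tail j" "1 \<le> j"
  shows "gcomm x y \<in> tail (i + j)" "lay (i + j) (gcomm x y) = lbr (lay i x) (lay j y)"
  using assms by (auto simp: tail_def[of "i + j"] lay_gcomm lay_lbr)

lemma mul_second_order: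
  obtains d K where "d > 0" "K \<ge> 0"
    and "\<And>x y. norm x < d \<Longrightarrow> norm y < d \<Longrightarrow> norm (x \<odot> y - (x + y)) \<le> K * norm x * norm y"
proof -
  obtain d where d: "d > 0" "\<And>x y. norm x < d \<Longrightarrow> norm y < d \<Longrightarrow>
      norm (x \<odot> y - x - y - D2mul 0 x y) \<le> 1 * norm x * norm y"
    using mul_expansion[OF zero_less_one] by blast
  have "bounded_bilinear (D2mul 0)" using bilinear_D2mul bilinear_conv_bounded_bilinear by blast
  then obtain C where C: "C > 0" "\<And>x y. norm (D2mul 0 x y) \<le> norm x * norm y * C"
    using bounded_bilinear.pos_bounded by blast
  show thesis
  proof
    show "norm (x \<odot> y - (x + y)) \<le> (1 + C) * norm x * norm y" if "norm x < d" "norm y < d" for x y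
    proof -
      have "norm (x \<odot> y - (x + y)) \<le> norm (x \<odot> y - x - y - D2mul 0 x y) + norm (D2mul 0 x y)"
        using norm_triangle_ineq[of "x \<odot> y - x - y - D2mul 0 x y" "D2mul 0 x y"] by (simp add: algebra_simps)
      then show ?thesis using d(2)[OF that] C(2)[of x y] by (simp add: algebra_simps)
    qed
  qed (use d C in auto)
qed

text \<open>For \<open>s\<close>-dilates of \<open>x\<close> and \<open>y\<close> the second-order
  error is at most a multiple of \<open>s ^ (2 * k)\<close>, whereas its part of degree
  \<open>n\<close> scales exactly as \<open>s ^ n\<close>. The estimate is big-O and not small-o,
  hence the strict bound on \<open>n\<close>.\<close>

lemma lay_mul:
  assumes x: "x \<in> tail k" and y: "y \<in> tail k" and n: "n < 2 * k"
  shows "lay n (x \<odot> y) = lay n x + lay n y"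
proof -
  obtain C where C: "C \<ge> 1" "\<And>s k x. 0 \<le> s \<Longrightarrow> s \<le> 1 \<Longrightarrow> x \<in> tail k \<Longrightarrow> norm (dil s x) \<le> C * s ^ k * norm x"
    using dil_tail_bound by blast
  obtain D where D: "D \<ge> 1" "\<And>j x. norm (lay j x) \<le> D * norm x" using lay_bound by blast
  obtain d K where d: "d > 0" "K \<ge> 0"
    "\<And>x y. norm x < d \<Longrightarrow> norm y < d \<Longrightarrow> norm (x \<odot> y - (x + y)) \<le> K * norm x * norm y"
    using mul_second_order by blast
  define M where "M = D * (K * (C * norm x) * (C * norm y))"
  define w where "w = lay n (x \<odot> y - (x + y))"
  have "((\<lambda>s. norm (dil s x)) \<longlongrightarrow> norm (dil 0 x)) (at_right 0)"
    "((\<lambda>s. norm (dil s y)) \<longlongrightarrow> norm (dil 0 y)) (at_right 0)"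
    by (intro tendsto_intros)+
  then have "\<forall>\<^sub>F s in at_right 0. norm (dil s x) < d \<and> norm (dil s y) < d \<and> 0 < s \<and> s < 1"
    using d(1) by (intro eventually_conj order_tendstoD(2)[of _ _ _ d] eventually_at_right_less
        eventually_at_right_real[THEN eventually_mono]) (auto simp: dil_zero_left)
  then have "\<forall>\<^sub>F s in at_right 0. norm w \<le> s * M"
  proof eventually_elim
    case (elim s)
    have "s ^ n *\<^sub>R w = lay n (dil s x \<odot> dil s y - (dil s x + dil s y))"
      by (simp add: w_def linear_diff[OF linear_lay] linear_add[OF linear_lay] lay_dil
          scaleR_right_diff_distrib scaleR_right_distrib flip: dil_mul)
    then have "s ^ n * norm w = norm (lay n (dil s x \<odot> dil s y - (dil s x + dil s y)))"
      using elim by (metis abs_of_nonneg norm_scaleR zero_le_power less_imp_le)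
    also have "\<dots> \<le> D * (K * norm (dil s x) * norm (dil s y))"
      using D(2)[of n "dil s x \<odot> dil s y - (dil s x + dil s y)"] d(3)[of "dil s x" "dil s y"] D(1) elim
      by (meson mult_left_mono order_trans zero_le_one)
    also have "\<dots> \<le> D * (K * (C * s ^ k * norm x) * (C * s ^ k * norm y))"
      using C(2)[of s x k] C(2)[of s y k] elim x y d(2) D(1) C(1)
      by (intro mult_left_mono mult_mono) auto
    also have "\<dots> = s ^ (2 * k) * M" by (simp add: M_def mult_2 mult_2_right power_add mult_ac)
    also have "\<dots> \<le> s ^ (Suc n) * M"
      using elim n d(2) C(1) D(1) by (intro mult_right_mono power_decreasing) (auto simp: M_def)
    finally show ?case using elim by (simp add: mult_ac)
  qed
  moreover have "((\<lambda>s. s * M) \<longlongrightarrow> 0 * M) (at_right 0)" by (intro tendsto_intros)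
  ultimately have "norm w \<le> 0 * M" by (intro tendsto_lowerbound) auto
  then show ?thesis
    by (simp add: w_def linear_diff[OF linear_lay] linear_add[OF linear_lay])
qed

lemma tail_mul:
  assumes "x \<in> tail k" "y \<in> tail k" "1 \<le> k"
  shows "x \<odot> y \<in> tail k" "lay k (x \<odot> y) = lay k x + lay k y"
proof -
  have "lay j (x \<odot> y) = 0" if "j < k" for j
    using lay_mul[OF assms(1,2), of j] assms that by (simp add: tail_def)
  then show "x \<odot> y \<in> tail k" by (simp add: tail_def)
  show "lay k (x \<odot> y) = lay k x + lay k y" using lay_mul[OF assms(1,2)] assms(3) by simp
qed

text \<open>Only the leading term is prescribed; components of degree above \<open>k\<close> are
  left free and get corrected later. The bounds \<open>n\<close> and \<open>C\<close> do not depend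
  on \<open>c\<close>, which makes generation quantitative.\<close>

definition reachable_layer :: "nat \<Rightarrow> 'a \<Rightarrow> bool" where
  "reachable_layer k w \<longleftrightarrow> (\<forall>R. \<exists>n C. \<forall>c. \<bar>c\<bar> \<le> R \<longrightarrow> (\<exists>q\<in>tail k. gen n C q \<and> lay k q = c *\<^sub>R w))"

lemma reachable_layer_1:
  assumes "u \<in> V 1" shows "reachable_layer 1 u"
  unfolding reachable_layer_def
proof (intro allI exI impI)
  fix R c :: real assume "\<bar>c\<bar> \<le> R"
  then have "gen 1 (R * norm u) (c *\<^sub>R u)"
    using assms subspace_scale[OF subspace_V1] by (intro gen_V1) (auto intro: mult_right_mono)
  moreover have "lay 1 (c *\<^sub>R u) = c *\<^sub>R u"
    using assms l_pos subspace_scale[OF subspace_V1] by (subst lay_self[of 1]) auto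
  ultimately show "\<exists>q\<in>tail 1. gen 1 (R * norm u) q \<and> lay 1 q = c *\<^sub>R u"
    using tail_1 by blast
qed

lemma reachable_layer_scale:
  assumes "reachable_layer k w" shows "reachable_layer k (r *\<^sub>R w)"
  unfolding reachable_layer_def
proof
  fix R :: real
  obtain n C where nC: "\<And>c. \<bar>c\<bar> \<le> R * \<bar>r\<bar> \<Longrightarrow> \<exists>q\<in>tail k. gen n C q \<and> lay k q = c *\<^sub>R w"
    using assms unfolding reachable_layer_def by meson
  have "\<exists>q\<in>tail k. gen n C q \<and> lay k q = c *\<^sub>R r *\<^sub>R w" if "\<bar>c\<bar> \<le> R" for c
    using nC[of "c * r"] that by (simp add: abs_mult mult_right_mono)
  then show "\<exists>n C. \<forall>c. \<bar>c\<bar> \<le> R \<longrightarrow> (\<exists>q\<in>tail k. gen n C q \<and> lay k q = c *\<^sub>R r *\<^sub>R w)" by blast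
qed

lemma reachable_layer_add:
  assumes "reachable_layer k v" "reachable_layer k w" "1 \<le> k" shows "reachable_layer k (v + w)"
  unfolding reachable_layer_def
proof
  fix R :: real
  obtain n C where nC: "\<And>c. \<bar>c\<bar> \<le> R \<Longrightarrow> \<exists>q\<in>tail k. gen n C q \<and> lay k q = c *\<^sub>R v"
    using assms unfolding reachable_layer_def by meson
  obtain m D where mD: "\<And>c. \<bar>c\<bar> \<le> R \<Longrightarrow> \<exists>q\<in>tail k. gen m D q \<and> lay k q = c *\<^sub>R w"
    using assms unfolding reachable_layer_def by meson
  have "\<exists>q\<in>tail k. gen (n + m) (max C D) q \<and> lay k q = c *\<^sub>R (v + w)" if c: "\<bar>c\<bar> \<le> R" for c
  proof -
    obtain p q where "p \<in> tail k" "gen n C p" "lay k p = c *\<^sub>R v" "q \<in> tail k" "gen m D q" "lay k q = c *\<^sub>R w"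
      using nC[OF c] mD[OF c] by blast
    then show ?thesis
      using tail_mul[of p k q] gen_mul[of n C p m D q] assms(3)
      by (intro bexI[of _ "p \<odot> q"]) (auto simp: scaleR_right_distrib)
  qed
  then show "\<exists>n C. \<forall>c. \<bar>c\<bar> \<le> R \<longrightarrow> (\<exists>q\<in>tail k. gen n C q \<and> lay k q = c *\<^sub>R (v + w))" by blast
qed

text \<open>By \<open>gcomm_tail\<close> the commutator of \<open>u\<close> with an element whose
  leading term is \<open>c w\<close> has leading term \<open>c [w, u]\<close>, one degree
  higher.\<close>

lemma reachable_layer_bracket:
  assumes "reachable_layer k w" "u \<in> V 1" shows "reachable_layer (Suc k) (lbr w u)"
  unfolding reachable_layer_def
proof
  fix R :: real
  obtain n C where nC: "\<And>c. \<bar>c\<bar> \<le> R \<Longrightarrow> \<exists>q\<in>tail k. gen n C q \<and> lay k q = c *\<^sub>R w"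
    using assms unfolding reachable_layer_def by meson
  let ?D = "max C (norm u)"
  have "\<exists>q\<in>tail (Suc k). gen (n + 1 + (1 + n)) ?D q \<and> lay (Suc k) q = c *\<^sub>R lbr w u" if c: "\<bar>c\<bar> \<le> R" for c
  proof -
    obtain q where q: "q \<in> tail k" "gen n C q" "lay k q = c *\<^sub>R w"
      using nC[OF c] by blast
    have u: "gen 1 (norm u) u" by (rule gen_V1[OF assms(2)]) simp
    have "gen (n + 1 + (1 + n)) (max ?D (max (norm u) C)) (gcomm q u)"
      unfolding gcomm_def by (intro gen_mul gen_minus q(2) u)
    moreover have "u \<in> tail 1" by (simp only: tail_1 UNIV_I)
    note gcomm_tail[OF q(1) this]
    moreover have "lay 1 u = u" using assms(2) l_pos by (subst lay_self[of 1]) auto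
    ultimately show ?thesis using q(3)
      by (intro bexI[of _ "gcomm q u"]) (auto simp: bilinear_lmul[OF bilinear_lbr] max.commute)
  qed
  then show "\<exists>n C. \<forall>c. \<bar>c\<bar> \<le> R \<longrightarrow> (\<exists>q\<in>tail (Suc k). gen n C q \<and> lay (Suc k) q = c *\<^sub>R lbr w u)" by blast
qed

lemma reachable_layer_0: "reachable_layer k 0"
  unfolding reachable_layer_def
proof (intro allI exI impI)
  show "\<exists>q\<in>tail k. gen 0 0 q \<and> lay k q = c *\<^sub>R 0" for c
    by (intro bexI[of _ 0]) (simp_all add: gen_0 linear_0[OF linear_lay] subspace_0[OF subspace_tail])
qed

lemma reachable_layer_all: "1 \<le> k \<Longrightarrow> w \<in> layer k \<Longrightarrow> reachable_layer k w"
proof (induction k arbitrary: w rule: nat_induct_at_least)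
  case base
  then show ?case using reachable_layer_1 l_pos by (simp add: layer_def)
next
  case (Suc k)
  show ?case
  proof (cases "k \<le> l")
    case True
    have "span {lbr x y | x y. x \<in> V k \<and> y \<in> V 1} \<subseteq> {w. reachable_layer (Suc k) w}"
    proof (rule span_minimal)
      show "{lbr x y | x y. x \<in> V k \<and> y \<in> V 1} \<subseteq> {w. reachable_layer (Suc k) w}"
        using Suc.IH True Suc.hyps by (auto simp: layer_def intro!: reachable_layer_bracket)
      show "subspace {w. reachable_layer (Suc k) w}"
        using reachable_layer_0 reachable_layer_add reachable_layer_scale by (simp add: subspace_def)
    qed
    then show ?thesis using Suc.prems span_brackets[OF Suc.hyps True] by blast
  next
    case False
    then show ?thesis using Suc.prems reachable_layer_0 by (simp add: layer_def)
  qed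
qed

lemma reachable_sum:
  assumes "finite B" "1 \<le> k" "\<And>b. b \<in> B \<Longrightarrow> reachable_layer k b"
  shows "\<exists>n C. \<forall>c. (\<forall>b\<in>B. \<bar>c b\<bar> \<le> R) \<longrightarrow> (\<exists>q\<in>tail k. gen n C q \<and> lay k q = (\<Sum>b\<in>B. c b *\<^sub>R b))"
  using assms(1,3)
proof (induction B rule: finite_induct)
  case empty
  have "\<exists>q\<in>tail k. gen 0 0 q \<and> lay k q = (\<Sum>b\<in>{}. c b *\<^sub>R b)" for c :: "'a \<Rightarrow> real"
    by (intro bexI[of _ 0]) (simp_all add: gen_0 linear_0[OF linear_lay] subspace_0[OF subspace_tail])
  then show ?case by blast
next
  case (insert b B)
  from insert.IH[OF insert.prems[OF insertI2]] obtain n C where nC: "\<And>c. (\<forall>b\<in>B. \<bar>c b\<bar> \<le> R) \<Longrightarrow> \<exists>q\<in>tail k. gen n C q \<and> lay k q = (\<Sum>b\<in>B. c b *\<^sub>R b)"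
    by blast
  obtain m D where mD: "\<And>c. \<bar>c\<bar> \<le> R \<Longrightarrow> \<exists>q\<in>tail k. gen m D q \<and> lay k q = c *\<^sub>R b"
    using insert.prems[of b] unfolding reachable_layer_def by (meson insertI1)
  have "\<exists>q\<in>tail k. gen (m + n) (max D C) q \<and> lay k q = (\<Sum>b\<in>insert b B. c b *\<^sub>R b)"
    if c: "\<forall>b\<in>insert b B. \<bar>c b\<bar> \<le> R" for c
  proof -
    obtain p q where "p \<in> tail k" "gen m D p" "lay k p = c b *\<^sub>R b"
      "q \<in> tail k" "gen n C q" "lay k q = (\<Sum>b\<in>B. c b *\<^sub>R b)"
      using nC[of c] mD[of "c b"] c by auto
    then show ?thesis
      using tail_mul[of p k q] gen_mul[of m D p n C q] assms(2) insert.hyps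
      by (intro bexI[of _ "p \<odot> q"]) auto
  qed
  then show ?case by blast
qed

text \<open>Descending induction on the degree: a generated \<open>q\<close> with the same component
  in layer \<open>k\<close> is split off, and the remainder, now in \<open>tail (Suc k)\<close> and
  bounded, is brought into the unit ball by a dilation that does not depend on
  \<open>x\<close>.\<close>

lemma gen_tail:
  "k \<le> Suc l \<Longrightarrow> 1 \<le> k \<Longrightarrow> \<exists>n C. \<forall>x\<in>tail k. norm x \<le> 1 \<longrightarrow> gen n C x"
proof (induction k rule: inc_induct)
  case base
  then show ?case using gen_0 tail_end by auto
next
  case (step k)
  then obtain m D where mD: "\<And>x. x \<in> tail (Suc k) \<Longrightarrow> norm x \<le> 1 \<Longrightarrow> gen m D x" by auto
  have k: "1 \<le> k" "k \<le> l" using step by auto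
  obtain K where K: "K \<ge> 1" "\<And>j x. norm (lay j x) \<le> K * norm x" using lay_bound by blast
  obtain B where B: "B \<subseteq> layer k" "pairwise orthogonal B" "\<And>x. x \<in> B \<Longrightarrow> norm x = 1"
    "independent B" "card B = dim (layer k)" "span B = layer k"
    using orthonormal_basis_subspace[OF subspace_layer[of k]] by blast
  have fin: "finite B" using B(4) independent_bound by blast
  obtain n C where nC: "\<And>c. (\<forall>b\<in>B. \<bar>c b\<bar> \<le> K) \<Longrightarrow> \<exists>q\<in>tail k. gen n C q \<and> lay k q = (\<Sum>b\<in>B. c b *\<^sub>R b)"
    using reachable_sum[OF fin k(1) reachable_layer_all[OF k(1)], of K] B(1) by blast
  obtain R where R: "\<And>x. gen n C x \<Longrightarrow> norm x \<le> R" using gen_bounded by blast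
  obtain M where M: "\<And>x y. norm x \<le> R \<Longrightarrow> norm y \<le> 1 \<Longrightarrow> norm (x \<odot> y) \<le> M" using mul_bounded by blast
  obtain E where E: "E \<ge> 1" "\<And>s x. 0 \<le> s \<Longrightarrow> s \<le> 1 \<Longrightarrow> norm (dil s x) \<le> E * s * norm x"
    using dil_bound by blast
  \<comment> \<open>\<open>M\<close> bounds the remainder \<open>r\<close> below, so
    \<open>dil s\<close> maps it into the unit ball; the added \<open>1\<close> keeps the
    denominator at least \<open>1\<close>.\<close>
  define s where "s = 1 / (E * (\<bar>M\<bar> + 1))"
  have s: "0 < s" "s \<le> 1" using E(1) mult_mono[of 1 E 1 "\<bar>M\<bar> + 1"] by (auto simp: s_def)
  have "gen (n + m) (max C (1 / s * D)) x" if x: "x \<in> tail k" "norm x \<le> 1" for x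
  proof -
    have "lay k x \<in> span B" using lay_layer B(6) by blast
    then have ex: "(\<Sum>b\<in>B. (lay k x \<bullet> b) *\<^sub>R b) = lay k x"
      using orthonormal_basis_expand[of B "lay k x"] B fin by (simp add: pairwise_def orthogonal_def)
    have "\<bar>lay k x \<bullet> b\<bar> \<le> K" if "b \<in> B" for b
    proof -
      have "\<bar>lay k x \<bullet> b\<bar> \<le> K * norm x"
        using Cauchy_Schwarz_ineq2[of "lay k x" b] B(3)[OF that] K(2)[of k x] by simp
      also have "\<dots> \<le> K" using mult_left_mono[of "norm x" 1 K] K(1) x(2) by simp
      finally show ?thesis .
    qed
    then obtain q where q: "q \<in> tail k" "gen n C q" "lay k q = lay k x"
      using nC[of "\<lambda>b. lay k x \<bullet> b"] ex by auto
    define r where "r = (- q) \<odot> x"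
    have nq: "- q \<in> tail k" using q(1) subspace_neg[OF subspace_tail] by blast
    have "lay k r = 0" "r \<in> tail k"
      unfolding r_def using tail_mul[OF nq x(1) k(1)] q(3) by (simp_all add: linear_neg[OF linear_lay])
    then have r: "r \<in> tail (Suc k)" by (auto simp: tail_def less_Suc_eq)
    have "norm r \<le> M" unfolding r_def using R[OF gen_minus[OF q(2)]] x(2) by (intro M) auto
    then have "norm (dil s r) \<le> E * s * M"
      using E(2)[of s r] s E(1) by (smt (verit) mult_left_mono mult_nonneg_nonneg)
    also have "\<dots> \<le> 1" using E(1) by (auto simp: s_def divide_simps)
    finally have "gen m D (dil s r)" using mD dil_tail[OF r] by blast
    from gen_dil[OF this, of "1 / s"] have "gen m (1 / s * D) r" using s by simp
    moreover have "x = q \<odot> r" by (simp add: r_def)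
    ultimately show ?thesis using gen_mul[OF q(2)] by simp
  qed
  then show ?case by blast
qed

lemma gen_unit_ball:
  obtains n C where "\<And>x. norm x \<le> 1 \<Longrightarrow> gen n C x"
  using gen_tail[of 1] tail_1 by auto

lemma generated_by_V1:
  obtains us where "set us \<subseteq> V 1" "x = prodl us"
proof -
  obtain n C where nC: "\<And>x. norm x \<le> 1 \<Longrightarrow> gen n C x" using gen_unit_ball by blast
  obtain E where E: "E \<ge> 1" "\<And>s x. 0 \<le> s \<Longrightarrow> s \<le> 1 \<Longrightarrow> norm (dil s x) \<le> E * s * norm x"
    using dil_bound by blast
  define s where "s = 1 / (E * (norm x + 1))"
  have s: "0 < s" "s \<le> 1" using E(1) mult_mono[of 1 E 1 "norm x + 1"]
    by (auto simp: s_def add_nonneg_pos)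
  have "norm (dil s x) \<le> E * s * norm x" using E(2) s by simp
  also have "\<dots> \<le> 1" using E(1) by (simp add: s_def divide_simps add_nonneg_pos)
  finally have "gen n C (dil s x)" by (rule nC)
  from gen_dil[OF this, of "1 / s"] s have "gen n (1 / s * C) x" by simp
  then show thesis unfolding gen_def using that by blast
qed

section \<open>The Carnot distance and its homogeneous norm\<close>

definition cdist :: "'a \<Rightarrow> 'a \<Rightarrow> real" where "cdist p q = Inf {L. reach p q L}"

definition cnorm :: "'a \<Rightarrow> real" where "cnorm x = cdist 0 x"

lemma reach_translate: "reach p q L \<longleftrightarrow> reach 0 ((- p) \<odot> q) L"
  using reach_mul_left[of p q L "- p"] reach_mul_left[of 0 "(- p) \<odot> q" L p] by auto

lemma gen_reach:
  assumes "gen n C x" shows "\<exists>L\<le>real n * \<bar>C\<bar>. reach 0 x L"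
proof -
  have "\<exists>L\<le>real (length us) * \<bar>C\<bar>. reach 0 (prodl us) L" if "\<forall>u\<in>set us. u \<in> V 1 \<and> norm u \<le> C" for us
    using that
  proof (induction us)
    case Nil
    show ?case using reach_ray[OF subspace_0[OF subspace_V1]] by (intro exI[of _ 0]) simp
  next
    case (Cons u us)
    then obtain L where L: "L \<le> real (length us) * \<bar>C\<bar>" "reach 0 (prodl us) L" by auto
    have u: "u \<in> V 1" "norm u \<le> C" using Cons.prems by auto
    have "reach u (u \<odot> prodl us) L" using L(2) reach_translate[of u] by simp
    from reach_trans[OF reach_ray[OF u(1)] this] L(1) u(2) show ?case
      by (intro exI[of _ "norm u + L"]) (auto simp: algebra_simps)
  qed
  moreover obtain us where us: "length us \<le> n" "\<forall>u\<in>set us. u \<in> V 1 \<and> norm u \<le> C" "x = prodl us"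
    using assms by (auto simp: gen_def)
  ultimately obtain L where L: "L \<le> real (length us) * \<bar>C\<bar>" "reach 0 x L" by blast
  have "real (length us) * \<bar>C\<bar> \<le> real n * \<bar>C\<bar>" using us(1) by (intro mult_right_mono) auto
  with L show ?thesis by (intro exI[of _ L]) auto
qed

lemma reach_ex: obtains L where "reach p q L"
proof -
  obtain us where us: "set us \<subseteq> V 1" "(- p) \<odot> q = prodl us" using generated_by_V1 by blast
  define C where "C = Max (insert 0 (norm ` set us))"
  have "gen (length us) C ((- p) \<odot> q)"
    unfolding gen_def us(2) using us(1) by (intro exI[of _ us]) (auto simp: C_def)
  from gen_reach[OF this] show thesis using that reach_translate by blast
qed

lemma bdd_below_reach: "bdd_below {L. reach p q L}"
  using reach_nonneg by (intro bdd_belowI[of _ 0]) auto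

lemma cdist_le: "reach p q L \<Longrightarrow> cdist p q \<le> L"
  unfolding cdist_def by (rule cInf_lower) (auto simp: bdd_below_reach)

lemma cdist_nonneg: "cdist p q \<ge> 0"
  unfolding cdist_def
proof (rule cInf_greatest)
  show "{L. reach p q L} \<noteq> {}" by (rule reach_ex[of p q]) auto
qed (simp add: reach_nonneg)

lemma cdist_lessD:
  assumes "cdist p q < M" obtains L where "reach p q L" "L < M"
proof -
  have "{L. reach p q L} \<noteq> {}" by (rule reach_ex[of p q]) auto
  from cInf_lessD[OF this assms[unfolded cdist_def]] that show thesis by blast
qed

lemma cdist_cnorm: "cdist p q = cnorm ((- p) \<odot> q)"
proof -
  have "{L. reach p q L} = {L. reach 0 ((- p) \<odot> q) L}" by (rule Collect_cong) (rule reach_translate)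
  then show ?thesis by (simp only: cnorm_def cdist_def)
qed

lemma cdist_sym: "cdist p q = cdist q p"
proof -
  have "{L. reach p q L} = {L. reach q p L}" by (rule Collect_cong) (blast intro: reach_sym)
  then show ?thesis by (simp only: cdist_def)
qed

lemma cdist_triangle: "cdist p r \<le> cdist p q + cdist q r"
proof (rule field_le_epsilon)
  fix e :: real assume e: "e > 0"
  obtain L where L: "reach p q L" "L < cdist p q + e / 2" using cdist_lessD[of p q "cdist p q + e / 2"] e by auto
  obtain M where M: "reach q r M" "M < cdist q r + e / 2" using cdist_lessD[of q r "cdist q r + e / 2"] e by auto
  show "cdist p r \<le> cdist p q + cdist q r + e"
    using cdist_le[OF reach_trans[OF L(1) M(1)]] L(2) M(2) by linarith
qed

lemma cnorm_nonneg: "cnorm x \<ge> 0"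
  by (simp add: cnorm_def cdist_nonneg)

lemma cnorm_V1_le: "u \<in> V 1 \<Longrightarrow> cnorm u \<le> norm u"
  unfolding cnorm_def by (intro cdist_le reach_ray)

lemma cnorm_0 [simp]: "cnorm 0 = 0"
  using cnorm_V1_le[OF subspace_0[OF subspace_V1]] cnorm_nonneg[of 0] by simp

lemma cdist_self [simp]: "cdist p p = 0"
  by (simp add: cdist_cnorm)

lemma cnorm_minus [simp]: "cnorm (- x) = cnorm x"
  using cdist_cnorm[of x 0] cdist_cnorm[of 0 x] cdist_sym[of 0 x] by simp

lemma cnorm_mul: "cnorm (x \<odot> y) \<le> cnorm x + cnorm y"
  using cdist_triangle[of 0 "x \<odot> y" x] cdist_cnorm[of x "x \<odot> y"] by (simp add: cnorm_def)

text \<open>Only one inequality needs curves; the other one follows by applying it to the inverse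
  dilation.\<close>

lemma cnorm_dil:
  assumes "s \<ge> 0" shows "cnorm (dil s x) = s * cnorm x"
proof -
  have le: "cnorm (dil s x) \<le> s * cnorm x" if s: "s > 0" for s x
  proof (rule field_le_epsilon)
    fix e :: real assume e: "e > 0"
    obtain L where L: "reach 0 x L" "L < cnorm x + e / s"
      using cdist_lessD[of 0 x "cnorm x + e / s"] e s unfolding cnorm_def by auto
    have "cnorm (dil s x) \<le> s * L"
      using cdist_le[OF reach_dil[OF s L(1)]] by (simp add: cnorm_def)
    also have "\<dots> \<le> s * (cnorm x + e / s)" using L(2) s by simp
    also have "\<dots> = s * cnorm x + e" using s by (simp add: algebra_simps)
    finally show "cnorm (dil s x) \<le> s * cnorm x + e" .
  qed
  show ?thesis
  proof (cases "s = 0")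
    case False
    then have s: "s > 0" using assms by simp
    have "cnorm (dil (1 / s) (dil s x)) \<le> 1 / s * cnorm (dil s x)" using le[of "1 / s" "dil s x"] s by simp
    then have "s * cnorm x \<le> cnorm (dil s x)" using s by (simp add: field_simps)
    then show ?thesis using le[OF s, of x] by simp
  qed (simp add: dil_zero_left)
qed

lemma cnorm_V1_scale: "u \<in> V 1 \<Longrightarrow> cnorm (r *\<^sub>R u) = \<bar>r\<bar> * cnorm u"
  using cnorm_dil[of "\<bar>r\<bar>" u] dil_V1[of u "\<bar>r\<bar>"] cnorm_minus[of "r *\<^sub>R u"] by (cases "r \<ge> 0") auto

text \<open>Elements of the unit ball are products of boundedly many bounded horizontal vectors,
  hence ends of curves of bounded length. A dilation passes to any ball.\<close>

lemma cnorm_bound: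
  obtains M where "\<And>x. norm x \<le> R \<Longrightarrow> cnorm x \<le> M"
proof -
  obtain n C where nC: "\<And>x. norm x \<le> 1 \<Longrightarrow> gen n C x" using gen_unit_ball by blast
  have 1: "cnorm x \<le> real n * \<bar>C\<bar>" if "norm x \<le> 1" for x
    using gen_reach[OF nC[OF that]] cdist_le[of 0 x] unfolding cnorm_def by (blast intro: order_trans)
  obtain E where E: "E \<ge> 1" "\<And>s x. 0 \<le> s \<Longrightarrow> s \<le> 1 \<Longrightarrow> norm (dil s x) \<le> E * s * norm x"
    using dil_bound by blast
  define s where "s = 1 / (E * (\<bar>R\<bar> + 1))"
  have s: "0 < s" "s \<le> 1" using E(1) mult_mono[of 1 E 1 "\<bar>R\<bar> + 1"] by (auto simp: s_def)
  show thesis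
  proof
    fix x :: 'a assume "norm x \<le> R"
    then have "norm (dil s x) \<le> E * s * (\<bar>R\<bar> + 1)"
      using E(2)[of s x] s E(1) by (smt (verit) mult_left_mono mult_nonneg_nonneg)
    also have "\<dots> = 1" using E(1) by (simp add: s_def divide_simps)
    finally have "cnorm (dil s x) \<le> real n * \<bar>C\<bar>" by (rule 1)
    then show "cnorm x \<le> real n * \<bar>C\<bar> / s" using s by (simp add: cnorm_dil pos_le_divide_eq mult.commute)
  qed
qed

text \<open>Short curves stay in the unit ball, and a dilation reduces the bound \<open>M\<close> to
  that case.\<close>

lemma bounded_cnorm:
  obtains R where "\<And>x. cnorm x \<le> M \<Longrightarrow> norm x \<le> R"
proof -
  obtain e where e: "e > 0" "\<And>x L. reach 0 x L \<Longrightarrow> L < e \<Longrightarrow> norm x \<le> 1"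
    using reach_short_bounded by blast
  have 1: "norm x \<le> 1" if "cnorm x < e" for x
    using cdist_lessD[of 0 x e] that e(2) unfolding cnorm_def by blast
  define s where "s = e / (\<bar>M\<bar> + 1)"
  have s: "s > 0" using e(1) by (simp add: s_def)
  have "bounded (dil (1 / s) ` cball 0 1)"
    using linear_dil linear_conv_bounded_linear by (intro bounded_linear_image bounded_cball) blast
  then obtain R where "\<forall>x\<in>cball 0 1. norm (dil (1 / s) x) \<le> R"
    by (auto simp: bounded_iff)
  then have R: "norm (dil (1 / s) x) \<le> R" if "norm x \<le> 1" for x using that by simp
  show thesis
  proof
    fix x assume "cnorm x \<le> M"
    then have "cnorm (dil s x) \<le> s * M" using s by (simp add: cnorm_dil)
    also have "\<dots> < s * (\<bar>M\<bar> + 1)" using s by (intro mult_strict_left_mono) auto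
    also have "\<dots> = e" by (simp add: s_def)
    finally have "norm (dil s x) \<le> 1" by (rule 1)
    from R[OF this] s show "norm x \<le> R" by simp
  qed
qed

text \<open>If \<open>cnorm x = 0\<close>, all dilates of \<open>x\<close> have \<open>cnorm\<close>
  zero and so lie in one bounded set; contracting them back shows that \<open>x\<close> is
  arbitrarily small.\<close>

lemma cnorm_pos: "x \<noteq> 0 \<Longrightarrow> cnorm x > 0"
proof (rule ccontr)
  assume x: "x \<noteq> 0" and "\<not> cnorm x > 0"
  then have 0: "cnorm x = 0" using cnorm_nonneg[of x] by linarith
  obtain R where R: "\<And>x. cnorm x \<le> 0 \<Longrightarrow> norm x \<le> R" using bounded_cnorm by blast
  obtain C where C: "C \<ge> 1" "\<And>s x. 0 \<le> s \<Longrightarrow> s \<le> 1 \<Longrightarrow> norm (dil s x) \<le> C * s * norm x"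
    using dil_bound by blast
  have Rn: "R \<ge> 0" using R[of x] 0 norm_ge_zero[of x] by linarith
  \<comment> \<open>Small enough to bring \<open>C * s * R\<close> below \<open>norm x\<close>; the
    denominator has \<open>R + 1\<close> because \<open>R\<close> may be \<open>0\<close>.\<close>
  define s where "s = min 1 (norm x / (2 * C * (R + 1)))"
  have s: "0 < s" "s \<le> 1" using x C(1) Rn by (auto simp: s_def)
  have "norm (dil (1 / s) x) \<le> R" using s 0 by (intro R) (simp add: cnorm_dil)
  moreover have "norm x \<le> C * s * norm (dil (1 / s) x)" using C(2)[of s "dil (1 / s) x"] s by simp
  ultimately have "norm x \<le> C * s * R" using C(1) s by (smt (verit) mult_left_mono mult_nonneg_nonneg)
  also have "\<dots> \<le> C * (norm x / (2 * C * (R + 1))) * R"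
    using C(1) Rn by (intro mult_right_mono mult_left_mono) (auto simp: s_def)
  also have "\<dots> = norm x / 2 * (R / (R + 1))" using C(1) by simp
  also have "\<dots> \<le> norm x / 2 * 1" using Rn by (intro mult_left_mono) auto
  finally show False using x by simp
qed

lemma cnorm_eq_0_iff [simp]: "cnorm x = 0 \<longleftrightarrow> x = 0"
  using cnorm_pos[of x] by (cases "x = 0") auto

lemma cnorm_le_0_iff [simp]: "cnorm x \<le> 0 \<longleftrightarrow> x = 0"
  using cnorm_nonneg[of x] by (auto simp flip: cnorm_eq_0_iff)

lemma cdist_eq_0_iff: "cdist p q = 0 \<longleftrightarrow> p = q"
  unfolding cdist_cnorm cnorm_eq_0_iff by (metis mul_cancel1(2) mul_minus_left mul_0_right)

text \<open>A Euclidean ball of radius comparable to \<open>s ^ l\<close> is mapped by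
  \<open>dil (1 / s)\<close> into the unit ball, where \<open>cnorm\<close> is bounded; homogeneity
  supplies the factor \<open>s\<close>.\<close>

lemma tendsto_cnorm_0: "(cnorm \<longlongrightarrow> 0) (nhds 0)"
proof (rule tendstoI)
  fix e :: real assume e: "e > 0"
  obtain M where M: "\<And>x. norm x \<le> 1 \<Longrightarrow> cnorm x \<le> M" using cnorm_bound by blast
  obtain C where C: "C \<ge> 1" "\<And>s x. 0 < s \<Longrightarrow> s \<le> 1 \<Longrightarrow> norm (dil (1 / s) x) \<le> C * (1 / s) ^ l * norm x"
    using dil_inverse_bound by blast
  define K where "K = \<bar>M\<bar> + 1"
  have K: "K > 0" "M \<le> K" by (auto simp: K_def)
  define s where "s = min 1 (e / (2 * K))"
  have s: "0 < s" "s \<le> 1" using e K by (auto simp: s_def)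
  show "\<forall>\<^sub>F x in nhds 0. dist (cnorm x) 0 < e"
    unfolding eventually_nhds_metric
  proof (intro exI[of _ "s ^ l / C"] conjI allI impI)
    show "s ^ l / C > 0" using s C(1) by simp
    fix x :: 'a assume "dist x 0 < s ^ l / C"
    then have "C * (1 / s) ^ l * norm x \<le> C * (1 / s) ^ l * (s ^ l / C)"
      using C(1) s by (intro mult_left_mono) auto
    also have "\<dots> = 1" using C(1) s by (simp add: power_divide)
    finally have "norm (dil (1 / s) x) \<le> 1" using C(2)[OF s, of x] by linarith
    from M[OF this] have "cnorm x \<le> s * M" using s by (simp add: cnorm_dil field_simps)
    also have "\<dots> \<le> s * K" using s K by (intro mult_left_mono) auto
    also have "\<dots> \<le> e / (2 * K) * K" using K by (intro mult_right_mono) (auto simp: s_def)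
    also have "\<dots> < e" using e K by simp
    finally show "dist (cnorm x) 0 < e" using cnorm_nonneg[of x] by simp
  qed
qed

lemma tendsto_cnorm [tendsto_intros]:
  assumes "(f \<longlongrightarrow> x) F" shows "((\<lambda>i. cnorm (f i)) \<longlongrightarrow> cnorm x) F"
proof -
  have "((\<lambda>i. (- x) \<odot> f i) \<longlongrightarrow> (- x) \<odot> x) F" by (intro tendsto_intros assms)
  then have "((\<lambda>i. cnorm ((- x) \<odot> f i)) \<longlongrightarrow> 0) F"
    using filterlim_compose[OF tendsto_cnorm_0] by simp
  then show ?thesis
  proof (rule Lim_transform_bound[THEN LIM_zero_cancel, rotated])
    have "\<bar>cnorm (f i) - cnorm x\<bar> \<le> cnorm ((- x) \<odot> f i)" for i
      using cnorm_mul[of x "(- x) \<odot> f i"] cnorm_mul[of "f i" "(- f i) \<odot> x"]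
        cnorm_minus[of "(- x) \<odot> f i"] by (simp add: minus_mul del: cnorm_minus)
    then show "\<forall>\<^sub>F i in F. norm (cnorm (f i) - cnorm x) \<le> norm (cnorm ((- x) \<odot> f i))"
      using cnorm_nonneg by (simp add: abs_of_nonneg)
  qed
qed

text \<open>Normalizing \<open>x\<close> to \<open>cnorm x = 1\<close> by a dilation leaves a
  bounded set, and \<open>cnorm\<close> is bounded on its image under the continuous map
  \<open>\<phi>\<close>.\<close>

lemma homogeneous_cnorm_bound:
  assumes "continuous_on UNIV \<phi>" and "\<And>s x. s > 0 \<Longrightarrow> \<phi> (dil s x) = dil s (\<phi> x)" and "\<phi> 0 = 0"
  obtains K where "K > 0" "\<And>x. cnorm (\<phi> x) \<le> K * cnorm x"
proof -
  obtain R where R: "\<And>x. cnorm x \<le> 1 \<Longrightarrow> norm x \<le> R" using bounded_cnorm by blast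
  have "bounded (\<phi> ` cball 0 R)"
    by (intro compact_imp_bounded compact_continuous_image continuous_on_subset[OF assms(1)]) auto
  then obtain S where "\<forall>x\<in>cball 0 R. norm (\<phi> x) \<le> S" by (auto simp: bounded_iff)
  then have S: "norm (\<phi> x) \<le> S" if "norm x \<le> R" for x using that by simp
  obtain M where M: "\<And>x. norm x \<le> S \<Longrightarrow> cnorm x \<le> M" using cnorm_bound by blast
  show thesis
  proof
    show "\<bar>M\<bar> + 1 > 0" by simp
    fix x show "cnorm (\<phi> x) \<le> (\<bar>M\<bar> + 1) * cnorm x"
    proof (cases "x = 0")
      case False
      then have c: "cnorm x > 0" by (rule cnorm_pos)
      have "cnorm (dil (1 / cnorm x) x) \<le> 1" using c by (simp add: cnorm_dil)
      then have "cnorm (\<phi> (dil (1 / cnorm x) x)) \<le> M" using R S M by blast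
      then have "cnorm (\<phi> x) \<le> M * cnorm x" using c by (simp add: assms(2) cnorm_dil pos_divide_le_eq)
      also have "\<dots> \<le> (\<bar>M\<bar> + 1) * cnorm x" using c by (intro mult_right_mono) auto
      finally show ?thesis .
    qed (simp add: assms(3))
  qed
qed

end

section \<open>The Pansu differential of a continuously differentiable quasiconformal map\<close>

context exp_chart begin

lemma continuous_on_Ad [continuous_intros]:
  "continuous_on S f \<Longrightarrow> continuous_on S g \<Longrightarrow> continuous_on S (\<lambda>x. Ad (f x) (g x))"
  unfolding Ad_def by (intro continuous_intros)

lemma Ad_norm_bound:
  obtains C where "C > 0" "\<And>k v. norm k \<le> R \<Longrightarrow> norm (Ad k v) \<le> C * norm v"
proof -
  have "compact ((\<lambda>(p, v). Ad p v) ` (cball 0 R \<times> cball 0 1))"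
    by (intro compact_continuous_image compact_Times compact_cball)
      (auto simp: case_prod_unfold intro!: continuous_intros)
  then obtain C where "\<forall>p\<in>cball 0 R. \<forall>v\<in>cball 0 1. norm (Ad p v) \<le> C"
    by (auto dest!: compact_imp_bounded simp: bounded_iff)
  then have C: "norm (Ad p v) \<le> C" if "norm p \<le> R" "norm v \<le> 1" for p v
    using that by simp
  show thesis
  proof
    show "\<bar>C\<bar> + 1 > 0" by simp
    show "norm (Ad p v) \<le> (\<bar>C\<bar> + 1) * norm v" if p: "norm p \<le> R" for p v
    proof (cases "v = 0")
      case False
      have "norm (Ad p (v /\<^sub>R norm v)) \<le> C" using False by (intro C[OF p]) simp
      then have "norm (Ad p v) \<le> C * norm v"
        using False by (simp add: linear_cmul[OF linear_Ad] divide_inverse_commute[symmetric] pos_divide_le_eq)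
      also have "\<dots> \<le> (\<bar>C\<bar> + 1) * norm v" by (intro mult_right_mono) auto
      finally show ?thesis .
    qed (simp add: linear_0[OF linear_Ad])
  qed
qed

end

text \<open>The distortion condition multiplied out: at each point and small scale, no point at
  distance at most \<open>s\<close> is sent more than \<open>K\<close> times farther than a point at
  distance at least \<open>s\<close>. The threshold \<open>s0\<close> may depend on
  \<open>p\<close>.\<close>

locale C1_qc_map = stratified_chart mul V l
  for mul :: "'a::euclidean_space \<Rightarrow> 'a \<Rightarrow> 'a"  (infixl \<open>\<odot>\<close> 70) and V l +
  fixes f :: "'a \<Rightarrow> 'a" and K :: real
  assumes C1: "Ck 1 f" and K1: "K \<ge> 1"
    and qc: "\<And>p. \<exists>s0>0. \<forall>s x y. 0 < s \<longrightarrow> s < s0 \<longrightarrow> cdist x p \<le> s \<longrightarrow> s \<le> cdist y p \<longrightarrow>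
      cdist (f x) (f p) \<le> K * cdist (f y) (f p)"
    and inj: "inj f"
begin

text \<open>\<open>f\<close> recentred by left translations so that both \<open>p\<close> and
  \<open>f p\<close> become \<open>0\<close>.\<close>

definition incr :: "'a \<Rightarrow> 'a \<Rightarrow> 'a" where "incr p y = (- f p) \<odot> f (p \<odot> y)"

text \<open>The ordinary differential of \<open>f\<close> in left trivializations. On
  \<open>V 1\<close> it turns out to be the Pansu differential.\<close>

definition A :: "'a \<Rightarrow> 'a \<Rightarrow> 'a" where "A p v = mc (f p) (frechet_derivative f (at p) (lin p v))"

lemma f_has_derivative: "(f has_derivative frechet_derivative f (at p)) (at p)"
  by (rule Ck_Suc_has_derivative[of 0]) (use C1 in simp)

lemma continuous_on_f [continuous_intros]: "continuous_on S g \<Longrightarrow> continuous_on S (\<lambda>x. f (g x))"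
  using continuous_on_compose2[OF Ck_continuous[OF C1]] by auto

lemma linear_A: "linear (A p)"
proof -
  have "linear (mc (f p) \<circ> (frechet_derivative f (at p) \<circ> lin p))"
    by (intro linear_compose linear_mc linear_lin has_derivative_linear[OF f_has_derivative])
  then show ?thesis by (simp add: A_def[abs_def] comp_def)
qed

lemma continuous_on_A [continuous_intros]:
  "continuous_on S g \<Longrightarrow> continuous_on S k \<Longrightarrow> continuous_on S (\<lambda>x. A (g x) (k x))"
  unfolding A_def by (intro continuous_intros C1_derivative_continuous[OF C1])

lemma has_lvel_f:
  assumes "has_lvel c w t" shows "has_lvel (\<lambda>s. f (c s)) (A (c t) w) t"
proof -
  have "(c has_derivative (\<lambda>h. h *\<^sub>R lin (c t) w)) (at t)"
    using assms by (simp add: has_lvel_def has_vector_derivative_def)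
  from has_derivative_compose[OF this f_has_derivative]
  have "((\<lambda>s. f (c s)) has_vector_derivative frechet_derivative f (at (c t)) (lin (c t) w)) (at t)"
    by (simp add: has_vector_derivative_def linear_cmul[OF has_derivative_linear[OF f_has_derivative]])
  from has_lvelI[OF this] show ?thesis by (simp add: A_def)
qed

lemma incr_0 [simp]: "incr p 0 = 0" by (simp add: incr_def)

text \<open>A cocycle identity: the second increment is taken at the shifted base point. It reduces
  the Pansu differential to horizontal directions.\<close>

lemma incr_mul: "incr p (x \<odot> y) = incr p x \<odot> incr (p \<odot> x) y"
  by (simp add: incr_def mul_assoc)

lemma cdist_f: "cdist (f (p \<odot> y)) (f p) = cnorm (incr p y)"
  using cdist_sym[of "f (p \<odot> y)" "f p"] by (simp add: cdist_cnorm incr_def)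

lemma cdist_mul_self: "cdist (p \<odot> y) p = cnorm y"
  using cdist_sym[of "p \<odot> y" p] by (simp add: cdist_cnorm)

lemma qc_incr:
  obtains s0 where "s0 > 0" "\<And>s x y. 0 < s \<Longrightarrow> s < s0 \<Longrightarrow> cnorm x \<le> s \<Longrightarrow> s \<le> cnorm y \<Longrightarrow>
    cnorm (incr p x) \<le> K * cnorm (incr p y)"
proof -
  obtain s0 where s0: "s0 > 0" "\<And>s x y. 0 < s \<Longrightarrow> s < s0 \<Longrightarrow> cdist x p \<le> s \<Longrightarrow> s \<le> cdist y p \<Longrightarrow>
      cdist (f x) (f p) \<le> K * cdist (f y) (f p)"
    using qc[of p] by metis
  show thesis
  proof
    show "cnorm (incr p x) \<le> K * cnorm (incr p y)"
      if "0 < s" "s < s0" "cnorm x \<le> s" "s \<le> cnorm y" for s x y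
      using s0(2)[OF that(1,2), of "p \<odot> x" "p \<odot> y"] that(3,4) by (simp add: cdist_f cdist_mul_self)
  qed (rule s0(1))
qed

lemma has_lvel_incr: "has_lvel (\<lambda>t. incr p (t *\<^sub>R v)) (A (p \<odot> (t *\<^sub>R v)) v) t"
  unfolding incr_def by (intro has_lvel_mul_left has_lvel_f has_lvel_ray)

lemma incr_vector_derivative: "((\<lambda>t. incr p (t *\<^sub>R v)) has_vector_derivative A p v) (at 0)"
  using has_lvel_incr[of p v 0] by (simp add: has_lvel_def)

text \<open>A curve that stays bounded after rescaling has its layer \<open>j\<close> of size
  \<open>s ^ j\<close>; for \<open>j \<ge> 2\<close> this is negligible against \<open>s\<close>, so
  the layer does not contribute to the derivative.\<close>

lemma lay_vanish_if_bounded: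
  assumes a: "((\<lambda>s. k s /\<^sub>R s) \<longlongrightarrow> a) (at_right 0)" and j: "2 \<le> j"
    and b: "\<forall>\<^sub>F s in at_right 0. norm (dil (1 / s) (k s)) \<le> R"
  shows "lay j a = 0"
proof -
  obtain D where D: "D \<ge> 1" "\<And>j x. norm (lay j x) \<le> D * norm x" using lay_bound by blast
  have "\<forall>\<^sub>F s in at_right (0::real). 0 < s \<and> s < 1"
    by (rule eventually_at_right_real[THEN eventually_mono, of 0 1]) auto
  with b have "\<forall>\<^sub>F s in at_right 0. norm (lay j (k s /\<^sub>R s)) \<le> s * (D * R)"
  proof eventually_elim
    case (elim s)
    then have s: "0 < s" "s < 1" by auto
    have "(1 / s) ^ j * norm (lay j (k s)) = norm (lay j (dil (1 / s) (k s)))"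
      using s by (simp add: lay_dil)
    also have "\<dots> \<le> D * R" using D(2)[of j "dil (1 / s) (k s)"] elim(1) D(1)
      by (meson mult_left_mono order_trans zero_le_one)
    finally have le: "norm (lay j (k s)) \<le> s ^ j * (D * R)" using s by (simp add: field_simps power_divide)
    have "R \<ge> 0" using elim(1) norm_ge_zero[of "dil (1 / s) (k s)"] by linarith
    then have nn: "D * R \<ge> 0" using D(1) by simp
    have "s ^ j \<le> s ^ 2" using s j by (intro power_decreasing) auto
    then have "norm (lay j (k s)) \<le> s\<^sup>2 * (D * R)" using le mult_right_mono[OF _ nn] by (meson order_trans)
    then show ?case using s by (simp add: linear_cmul[OF linear_lay] field_simps power2_eq_square)
  qed
  moreover have "((\<lambda>s. norm (lay j (k s /\<^sub>R s))) \<longlongrightarrow> norm (lay j a)) (at_right 0)"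
    by (intro tendsto_norm bounded_linear.tendsto[OF bounded_linear_lay a])
  moreover have "((\<lambda>s. s * (D * R)) \<longlongrightarrow> 0 * (D * R)) (at_right 0)" by (intro tendsto_intros)
  ultimately have "norm (lay j a) \<le> 0 * (D * R)" by (intro tendsto_le[of "at_right 0"]) auto
  then show ?thesis by simp
qed

lemma V1_if_lay_vanish:
  assumes "\<And>j. 2 \<le> j \<Longrightarrow> lay j a = 0" shows "a \<in> V 1"
proof -
  have "lay 1 a = a"
  proof (rule eq_if_lay_eq)
    fix j assume "1 \<le> j" "j \<le> l"
    then show "lay j (lay 1 a) = lay j a"
      using assms[of j] lay_of_layer[OF lay_layer, of j 1 a] by (cases "j = 1") auto
  qed
  then show ?thesis using lay_in[of 1 a] l_pos by simp
qed

text \<open>In direction of the last layer, the increment of \<open>f\<close> at distance \<open>s\<close> is of Euclidean size \<open>s ^ l\<close>,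
  hence of Carnot size \<open>s\<close>; quasiconformality forces the same in horizontal directions.\<close>

lemma contact:
  assumes u: "u \<in> V 1" shows "A p u \<in> V 1"
proof (cases "u = 0")
  case True
  then show ?thesis using linear_0[OF linear_A] subspace_0[OF subspace_V1] by simp
next
  case False
  have "V l \<noteq> {0}" using strat by (simp add: stratified_algebra_def)
  then obtain z0 where z0: "z0 \<in> V l" "z0 \<noteq> 0"
    using subspace_0[OF subspace_V[OF l_pos order_refl]] by blast
  \<comment> \<open>Rescaled so that \<open>dil s z\<close> and \<open>s u\<close> have the same
    distance \<open>s * cnorm u\<close> from \<open>0\<close>, the scale at which they are
    compared.\<close>
  define z where "z = dil (cnorm u / cnorm z0) z0"
  have cz: "cnorm z = cnorm u" using z0 cnorm_pos[of z0] cnorm_nonneg[of u] by (simp add: z_def cnorm_dil)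
  have zl: "dil s z = s ^ l *\<^sub>R z" for s
  proof -
    have "z0 \<in> layer l" using z0 l_pos by (simp add: layer_def)
    then have "z \<in> layer l" using subspace_scale[OF subspace_layer] by (simp add: z_def dil_layer)
    then show ?thesis by (rule dil_layer)
  qed
  obtain s0 where s0: "s0 > 0" "\<And>s x y. 0 < s \<Longrightarrow> s < s0 \<Longrightarrow> cnorm x \<le> s \<Longrightarrow> s \<le> cnorm y \<Longrightarrow>
    cnorm (incr p x) \<le> K * cnorm (incr p y)" using qc_incr by blast
  obtain E where E: "E \<ge> 1" "\<And>s x. 0 < s \<Longrightarrow> s \<le> 1 \<Longrightarrow> norm (dil (1 / s) x) \<le> E * (1 / s) ^ l * norm x"
    using dil_inverse_bound by blast
  let ?R = "E * (norm (A p z) + 1)"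
  obtain M where M: "\<And>x. norm x \<le> ?R \<Longrightarrow> cnorm x \<le> M" using cnorm_bound by blast
  obtain R' where R': "\<And>x. cnorm x \<le> K * M \<Longrightarrow> norm x \<le> R'" using bounded_cnorm by blast
  have lim: "((\<lambda>t. incr p (t *\<^sub>R v) /\<^sub>R t) \<longlongrightarrow> A p v) (at_right 0)" for v
    using incr_vector_derivative[of p v] filterlim_at_split unfolding has_vector_derivative_quotient by auto
  \<comment> \<open>The derivative in direction \<open>z\<close> is used at time
    \<open>s ^ l\<close>, because \<open>dil s z = s ^ l z\<close>.\<close>
  have "filterlim (\<lambda>s::real. s ^ l) (at_right 0) (at_right 0)"
  proof -
    have "((\<lambda>s::real. s ^ l) \<longlongrightarrow> 0 ^ l) (at_right 0)" by (intro tendsto_intros)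
    then show ?thesis
      using l_pos eventually_at_right_less[of "0::real"]
      by (auto simp: filterlim_at power_0_left elim!: eventually_mono)
  qed
  from filterlim_compose[OF lim[of z] this]
  have "((\<lambda>s. norm (incr p (s ^ l *\<^sub>R z) /\<^sub>R s ^ l)) \<longlongrightarrow> norm (A p z)) (at_right 0)"
    by (rule tendsto_norm)
  then have "\<forall>\<^sub>F s in at_right 0. norm (incr p (s ^ l *\<^sub>R z) /\<^sub>R s ^ l) < norm (A p z) + 1"
    by (rule order_tendstoD(2)) simp
  moreover have "\<forall>\<^sub>F s in at_right (0::real). 0 < s \<and> s < min 1 (s0 / cnorm u)"
    by (rule eventually_at_right_real[THEN eventually_mono, of 0 "min 1 (s0 / cnorm u)"])
      (use s0 False cnorm_pos in auto)
  ultimately have bd: "\<forall>\<^sub>F s in at_right 0. norm (dil (1 / s) (incr p (s *\<^sub>R u))) \<le> R'"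
  proof eventually_elim
    case (elim s)
    then have s: "0 < s" "s < 1" "s * cnorm u < s0"
      using cnorm_pos[OF False] by (auto simp: field_simps)
    have "norm (incr p (s ^ l *\<^sub>R z)) \<le> s ^ l * (norm (A p z) + 1)"
      using elim(1) s by (simp add: divide_inverse_commute[symmetric] pos_divide_less_eq mult.commute)
    then have "E * (1 / s) ^ l * norm (incr p (s ^ l *\<^sub>R z)) \<le> E * (1 / s) ^ l * (s ^ l * (norm (A p z) + 1))"
      using E(1) s by (intro mult_left_mono) auto
    also have "\<dots> = ?R" using s by (simp add: power_divide)
    finally have "norm (dil (1 / s) (incr p (s ^ l *\<^sub>R z))) \<le> ?R"
      using E(2)[of s "incr p (s ^ l *\<^sub>R z)"] s by linarith
    from M[OF this] have 1: "1 / s * cnorm (incr p (s ^ l *\<^sub>R z)) \<le> M"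
      using s cnorm_dil[of "1 / s"] by simp
    have "cnorm (incr p (s *\<^sub>R u)) \<le> K * cnorm (incr p (s ^ l *\<^sub>R z))"
    proof (rule s0(2)[OF _ s(3)])
      show "0 < s * cnorm u" using s cnorm_pos[OF False] by simp
      show "cnorm (s *\<^sub>R u) \<le> s * cnorm u" using s by (simp add: cnorm_V1_scale[OF u])
      show "s * cnorm u \<le> cnorm (s ^ l *\<^sub>R z)" using s cnorm_dil[of s z] by (simp add: zl cz)
    qed
    then have "1 / s * cnorm (incr p (s *\<^sub>R u)) \<le> 1 / s * (K * cnorm (incr p (s ^ l *\<^sub>R z)))"
      using s by (intro mult_left_mono) auto
    also have "\<dots> = K * (1 / s * cnorm (incr p (s ^ l *\<^sub>R z)))" by simp
    also have "\<dots> \<le> K * M" using 1 K1 by (intro mult_left_mono) auto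
    finally show ?case using s cnorm_dil[of "1 / s"] by (intro R') simp
  qed
  show ?thesis
    by (intro V1_if_lay_vanish lay_vanish_if_bounded[OF lim _ bd])
qed

text \<open>The limit is uniform in the base point \<open>q\<close>, since increments along products
  are taken at moving points. By \<open>contact\<close> the velocities of \<open>f\<close> along the
  line are horizontal, where \<open>dil (1 / s)\<close> is plain division by \<open>s\<close>; so
  the rescaled curve has a left velocity of the form \<open>A _ u\<close>, close to \<open>a\<close>
  by continuity.\<close>

lemma Pansu_V1:
  assumes u: "u \<in> V 1" and "\<epsilon> > 0"
  shows "\<exists>\<delta>>0. \<forall>q s. dist q p < \<delta> \<longrightarrow> 0 < s \<longrightarrow> s < \<delta> \<longrightarrow> dist (dil (1 / s) (incr q (s *\<^sub>R u))) (A p u) < \<epsilon>"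
proof -
  define a where "a = A p u"
  have a: "a \<in> V 1" unfolding a_def by (rule contact[OF u])
  obtain C where C: "C > 0" "\<And>p v. norm p \<le> 1 \<Longrightarrow> norm (lin p v) \<le> C * norm v" using lin_bound by blast
  obtain D where D: "D > 0" "\<And>k v. norm k \<le> norm a \<Longrightarrow> norm (Ad k v) \<le> D * norm v" using Ad_norm_bound by blast
  have "((\<lambda>y. y \<odot> a) \<longlongrightarrow> 0 \<odot> a) (nhds 0)" by (intro tendsto_intros filterlim_ident)
  then have "\<forall>\<^sub>F y in nhds 0. dist (y \<odot> a) a < \<epsilon>" using \<open>\<epsilon> > 0\<close> by (simp add: tendsto_iff)
  then obtain \<kappa>0 where \<kappa>0: "\<kappa>0 > 0" "\<And>y. dist y 0 < \<kappa>0 \<Longrightarrow> dist (y \<odot> a) a < \<epsilon>"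
    unfolding eventually_nhds_metric by blast
  \<comment> \<open>Below \<open>1\<close> so that \<open>first_exit\<close> applies, and strictly
    below \<open>\<kappa>0\<close> for the final estimate; \<open>\<eta>\<close> is
    \<open>\<kappa>\<close> divided by the bounds for \<open>lin\<close> and
    \<open>Ad\<close>.\<close>
  define \<kappa> where "\<kappa> = min (\<kappa>0 / 2) (1 / 2)"
  have \<kappa>: "0 < \<kappa>" "\<kappa> < \<kappa>0" "\<kappa> < 1" using \<kappa>0 by (auto simp: \<kappa>_def)
  define \<eta> where "\<eta> = \<kappa> / (C * D)"
  have \<eta>: "\<eta> > 0" "C * (D * \<eta>) = \<kappa>" using \<kappa> C(1) D(1) by (auto simp: \<eta>_def)
  have "continuous_on UNIV (\<lambda>z. A (fst z \<odot> (snd z *\<^sub>R u)) u)" by (intro continuous_intros)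
  then have "isCont (\<lambda>z. A (fst z \<odot> (snd z *\<^sub>R u)) u) (p, 0)" by (simp add: continuous_on_eq_continuous_at)
  then obtain d where d: "d > 0" "\<And>z. dist z (p, 0) < d \<Longrightarrow> dist (A (fst z \<odot> (snd z *\<^sub>R u)) u) a < \<eta>"
    using \<eta>(1) unfolding continuous_at_eps_delta by (auto simp: a_def)
  show ?thesis
  proof (intro exI[of _ "d / 2"] conjI allI impI)
    show "d / 2 > 0" using d by simp
    fix q and s :: real assume q: "dist q p < d / 2" and s: "0 < s" "s < d / 2"
    have near: "norm (A (q \<odot> ((t * s) *\<^sub>R u)) u - a) \<le> \<eta>" if t: "0 \<le> t" "t \<le> 1" for t
    proof -
      have "\<bar>t * s\<bar> \<le> s" using t s by (simp add: abs_mult mult_left_le_one_le)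
      then have "\<bar>t * s\<bar> < d / 2" using s by linarith
      then have "dist (q, t * s) (p, 0) < d"
        using q norm_Pair_le[of "q - p" "t * s"] by (simp add: dist_norm)
      from d(2)[OF this] show ?thesis by (simp add: dist_norm)
    qed
    define c where "c t = dil (1 / s) (incr q ((t * s) *\<^sub>R u))" for t
    have vc: "has_lvel c (A (q \<odot> ((t * s) *\<^sub>R u)) u) t" for t
    proof -
      have "((\<lambda>t. t * s) has_real_derivative s) (at t)" by (auto intro!: derivative_eq_intros)
      from has_lvel_compose[OF has_lvel_incr[of q u] this]
      have "has_lvel (\<lambda>t. incr q ((t * s) *\<^sub>R u)) (s *\<^sub>R A (q \<odot> ((t * s) *\<^sub>R u)) u) t" .
      from has_lvel_hom[OF linear_dil dil_mul this, of "1 / s"]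
      show ?thesis using s
        by (simp add: c_def[abs_def] linear_cmul[OF linear_dil] dil_V1[OF contact[OF u]])
    qed
    \<comment> \<open>Deviation from the ray of \<open>a\<close>. Because \<open>Ad_self\<close>
      fixes \<open>a\<close>, its velocity is \<open>Ad\<close> applied to the difference of the two
      velocities.\<close>
    define y where "y t = c t \<odot> (t *\<^sub>R (- a))" for t
    have vy: "has_lvel y (Ad (t *\<^sub>R a) (A (q \<odot> ((t * s) *\<^sub>R u)) u - a)) t" for t
      using has_lvel_mul[OF vc has_lvel_ray[of "- a"]]
      by (simp add: y_def[abs_def] linear_diff[OF linear_Ad] Ad_self)
    have "norm (y 1) \<le> \<kappa> * 1"
    proof (rule first_exit)
      show "(y has_vector_derivative lin (y t) (Ad (t *\<^sub>R a) (A (q \<odot> ((t * s) *\<^sub>R u)) u - a))) (at t)" for t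
        using vy by (simp add: has_lvel_def)
      show "y 0 = 0" by (simp add: y_def c_def)
      show "norm (lin (y t) (Ad (t *\<^sub>R a) (A (q \<odot> ((t * s) *\<^sub>R u)) u - a))) \<le> \<kappa>"
        if t: "0 \<le> t" "t \<le> 1" and "norm (y t) \<le> 1" for t
      proof -
        have "norm (lin (y t) (Ad (t *\<^sub>R a) (A (q \<odot> ((t * s) *\<^sub>R u)) u - a)))
            \<le> C * norm (Ad (t *\<^sub>R a) (A (q \<odot> ((t * s) *\<^sub>R u)) u - a))"
          by (rule C(2)) fact
        also have "\<dots> \<le> C * (D * norm (A (q \<odot> ((t * s) *\<^sub>R u)) u - a))"
          using C(1) t by (intro mult_left_mono D(2)) (auto simp: mult_left_le_one_le)
        also have "\<dots> \<le> C * (D * \<eta>)"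
          using near[OF t] C(1) D(1) by (intro mult_left_mono) auto
        finally show ?thesis by (simp add: \<eta>)
      qed
      show "((\<lambda>t. \<kappa> * t) has_vector_derivative \<kappa>) (at t)" for t
        by (auto intro!: derivative_eq_intros)
    qed (use \<kappa> in \<open>auto intro: continuous_intros\<close>)
    then have "dist (y 1) 0 < \<kappa>0" using \<kappa> by simp
    from \<kappa>0(2)[OF this] show "dist (dil (1 / s) (incr q (s *\<^sub>R u))) (A p u) < \<epsilon>"
      by (simp add: y_def c_def a_def)
  qed
qed

lemma Pansu_V1_filter:
  assumes u: "u \<in> V 1" and q: "(q \<longlongrightarrow> p) F" and s: "(s \<longlongrightarrow> 0) F" "\<forall>\<^sub>F i in F. s i > 0"
  shows "((\<lambda>i. dil (1 / s i) (incr (q i) (s i *\<^sub>R u))) \<longlongrightarrow> A p u) F"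
proof (rule tendstoI)
  fix \<epsilon> :: real assume "\<epsilon> > 0"
  then obtain \<delta> where \<delta>: "\<delta> > 0" "\<And>q s. dist q p < \<delta> \<Longrightarrow> 0 < s \<Longrightarrow> s < \<delta> \<Longrightarrow>
      dist (dil (1 / s) (incr q (s *\<^sub>R u))) (A p u) < \<epsilon>"
    using Pansu_V1[OF u, of \<epsilon> p] by metis
  from tendstoD[OF q \<delta>(1)] order_tendstoD(2)[OF s(1) \<delta>(1)] s(2)
  show "\<forall>\<^sub>F i in F. dist (dil (1 / s i) (incr (q i) (s i *\<^sub>R u))) (A p u) < \<epsilon>"
    by eventually_elim (rule \<delta>(2))
qed

text \<open>One letter is peeled off with \<open>incr_mul\<close>. The base point for the remaining
  word moves to \<open>q i \<odot> (s i u)\<close>, which still converges to \<open>p\<close>;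
  therefore \<open>q\<close> varies in the induction.\<close>

lemma Pansu_prodl:
  assumes "set us \<subseteq> V 1" "(q \<longlongrightarrow> p) F" and s: "(s \<longlongrightarrow> 0) F" "\<forall>\<^sub>F i in F. s i > 0"
  shows "((\<lambda>i. dil (1 / s i) (incr (q i) (dil (s i) (prodl us)))) \<longlongrightarrow> prodl (map (A p) us)) F"
  using assms(1,2)
proof (induction us arbitrary: q)
  case (Cons u us)
  then have u: "u \<in> V 1" by simp
  have "((\<lambda>i. q i \<odot> (s i *\<^sub>R u)) \<longlongrightarrow> p \<odot> (0 *\<^sub>R u)) F" by (intro tendsto_intros Cons.prems s)
  then have "((\<lambda>i. dil (1 / s i) (incr (q i \<odot> (s i *\<^sub>R u)) (dil (s i) (prodl us)))) \<longlongrightarrow> prodl (map (A p) us)) F"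
    using Cons by simp
  from tendsto_mul[OF Pansu_V1_filter[OF u Cons.prems(2) s] this]
  show ?case by (simp add: dil_mul incr_mul dil_V1[OF u])
qed simp

section \<open>The Pansu differential as an endomorphism of group and algebra\<close>

definition pansu :: "'a \<Rightarrow> 'a \<Rightarrow> 'a" where
  "pansu p x = Lim (at_right 0) (\<lambda>s. dil (1 / s) (incr p (dil s x)))"

text \<open>Every element has a factorization into horizontal vectors, so this settles the existence
  of the limit everywhere. The right-hand side is thereby independent of the factorization, and
  multiplicativity is immediate.\<close>

lemma pansu_prodl: "set us \<subseteq> V 1 \<Longrightarrow> pansu p (prodl us) = prodl (map (A p) us)"
  unfolding pansu_def
  by (intro tendsto_Lim Pansu_prodl tendsto_const tendsto_ident_at eventually_at_right_less) simp_all

lemma pansu_V1: "u \<in> V 1 \<Longrightarrow> pansu p u = A p u"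
  using pansu_prodl[of "[u]" p] by simp

lemma pansu_0 [simp]: "pansu p 0 = 0"
  using pansu_prodl[of "[]" p] by simp

lemma pansu_mul: "pansu p (x \<odot> y) = pansu p x \<odot> pansu p y"
proof -
  obtain us vs where "set us \<subseteq> V 1" "x = prodl us" "set vs \<subseteq> V 1" "y = prodl vs"
    using generated_by_V1 by metis
  then show ?thesis
    using pansu_prodl[of "us @ vs" p] by (simp add: prodl_append pansu_prodl)
qed

lemma pansu_minus: "pansu p (- x) = - pansu p x"
proof -
  have "pansu p (- x) \<odot> pansu p x = 0" by (simp flip: pansu_mul)
  then have "pansu p (- x) \<odot> pansu p x \<odot> (- pansu p x) = 0 \<odot> (- pansu p x)" by simp
  then show ?thesis by (simp only: mul_cancel2 mul_0_left)
qed

lemma pansu_dil: "pansu p (dil s x) = dil s (pansu p x)"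
proof -
  obtain us where us: "set us \<subseteq> V 1" "x = prodl us" using generated_by_V1 by blast
  have "set (map (dil s) us) \<subseteq> V 1" using us dil_V1 subspace_scale[OF subspace_V1] by auto
  from pansu_prodl[OF this, of p] have "pansu p (dil s x) = prodl (map (A p \<circ> dil s) us)"
    by (simp add: us dil_prodl comp_def)
  also have "map (A p \<circ> dil s) us = map (dil s \<circ> A p) us"
    using us contact by (auto simp: dil_V1 subset_eq linear_cmul[OF linear_A])
  finally show ?thesis using us by (simp add: pansu_prodl dil_prodl comp_def)
qed

text \<open>Elements of the unit ball are words of bounded length with bounded letters, and
  \<open>A p\<close> maps letters to letters in \<open>V 1\<close> with a bounded factor.\<close>

lemma pansu_bounded: obtains R where "\<And>x. norm x \<le> 1 \<Longrightarrow> norm (pansu p x) \<le> R"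
proof -
  obtain n C where nC: "\<And>x. norm x \<le> 1 \<Longrightarrow> gen n C x" using gen_unit_ball by blast
  have "bounded_linear (A p)" using linear_A linear_conv_bounded_linear by blast
  then obtain B where B: "B > 0" "\<And>u. norm (A p u) \<le> norm u * B" using bounded_linear.pos_bounded by blast
  obtain R where R: "\<And>x. gen n (C * B) x \<Longrightarrow> norm x \<le> R" using gen_bounded by blast
  show thesis
  proof
    fix x :: 'a assume "norm x \<le> 1"
    then obtain us where us: "length us \<le> n" "\<forall>u\<in>set us. u \<in> V 1 \<and> norm u \<le> C" "x = prodl us"
      using nC by (auto simp: gen_def)
    have "norm (A p u) \<le> C * B" if "u \<in> set us" for u
    proof -
      have "norm u * B \<le> C * B" using us that B(1) by (intro mult_right_mono) auto
      then show ?thesis using B(2)[of u] by linarith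
    qed
    then have "gen n (C * B) (pansu p x)"
      unfolding gen_def using us contact by (intro exI[of _ "map (A p) us"]) (auto simp: pansu_prodl subset_eq)
    then show "norm (pansu p x) \<le> R" by (rule R)
  qed
qed

lemma pansu_tendsto_0: "((\<lambda>x. pansu p x) \<longlongrightarrow> 0) (nhds 0)"
proof (rule tendstoI)
  fix e :: real assume e: "e > 0"
  obtain R where R: "\<And>x. norm x \<le> 1 \<Longrightarrow> norm (pansu p x) \<le> R" using pansu_bounded by blast
  define Q where "Q = R + 1"
  have Q: "Q > 0" "R \<le> Q" using R[of 0] by (auto simp: Q_def)
  obtain C where C: "C \<ge> 1" "\<And>s x. 0 < s \<Longrightarrow> s \<le> 1 \<Longrightarrow> norm (dil (1 / s) x) \<le> C * (1 / s) ^ l * norm x"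
    using dil_inverse_bound by blast
  obtain E where E: "E \<ge> 1" "\<And>s x. 0 \<le> s \<Longrightarrow> s \<le> 1 \<Longrightarrow> norm (dil s x) \<le> E * s * norm x"
    using dil_bound by blast
  define s where "s = min 1 (e / (2 * (E * Q)))"
  have s: "0 < s" "s \<le> 1" using e E(1) Q by (auto simp: s_def)
  show "\<forall>\<^sub>F x in nhds 0. dist (pansu p x) 0 < e"
    unfolding eventually_nhds_metric
  proof (intro exI[of _ "s ^ l / C"] conjI allI impI)
    show "s ^ l / C > 0" using s C(1) by simp
    fix x :: 'a assume "dist x 0 < s ^ l / C"
    then have "C * (1 / s) ^ l * norm x \<le> C * (1 / s) ^ l * (s ^ l / C)"
      using C(1) s by (intro mult_left_mono) auto
    also have "\<dots> = 1" using C(1) s by (simp add: power_divide)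
    finally have "norm (dil (1 / s) x) \<le> 1" using C(2)[OF s, of x] by linarith
    from R[OF this] have r: "norm (pansu p (dil (1 / s) x)) \<le> R" .
    have "pansu p x = dil s (pansu p (dil (1 / s) x))" using s by (simp add: pansu_dil)
    then have "norm (pansu p x) \<le> E * s * norm (pansu p (dil (1 / s) x))" using E(2)[of s] s by simp
    also have "\<dots> \<le> E * s * Q" using r E(1) s Q by (intro mult_left_mono) auto
    also have "\<dots> \<le> E * (e / (2 * (E * Q))) * Q"
      using E(1) Q by (intro mult_right_mono mult_left_mono) (auto simp: s_def)
    also have "\<dots> = e / 2" using E(1) Q by simp
    also have "\<dots> < e" using e by simp
    finally show "dist (pansu p x) 0 < e" by simp
  qed
qed

lemma tendsto_pansu [tendsto_intros]:
  assumes "(g \<longlongrightarrow> x) F" shows "((\<lambda>i. pansu p (g i)) \<longlongrightarrow> pansu p x) F"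
proof -
  have "((\<lambda>i. (- x) \<odot> g i) \<longlongrightarrow> (- x) \<odot> x) F" by (intro tendsto_intros assms)
  then have "((\<lambda>i. pansu p ((- x) \<odot> g i)) \<longlongrightarrow> 0) F"
    using filterlim_compose[OF pansu_tendsto_0] by simp
  from tendsto_mul[OF tendsto_const[of "pansu p x"] this] show ?thesis
    by (simp flip: pansu_mul)
qed

lemma pansu_nat: "pansu p (real n *\<^sub>R x) = real n *\<^sub>R pansu p x"
proof (induction n)
  case (Suc n)
  have "real (Suc n) *\<^sub>R y = (real n *\<^sub>R y) \<odot> y" for y :: 'a
    using ray_add[of "real n" 1 y] by (simp add: add.commute)
  then show ?case by (simp only: pansu_mul Suc)
qed simp

text \<open>Natural multiples are powers, so multiplicativity gives natural and then rational
  factors; continuity extends this to the closure of the rationals.\<close>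

lemma pansu_scaleR: "pansu p (t *\<^sub>R x) = t *\<^sub>R pansu p x"
proof -
  have nat_div: "pansu p (x /\<^sub>R real n) = pansu p x /\<^sub>R real n" if "n > 0" for n
    using pansu_nat[of p n "x /\<^sub>R real n"] that by simp
  have frac: "pansu p ((real m / real n) *\<^sub>R x) = (real m / real n) *\<^sub>R pansu p x" if "n > 0" for m n
    using pansu_nat[of p m "x /\<^sub>R real n"] nat_div[OF that] by (simp add: divide_inverse)
  have "closed {t. pansu p (t *\<^sub>R x) = t *\<^sub>R pansu p x}"
    by (intro closed_Collect_eq) (auto simp: continuous_on_def intro!: tendsto_intros)
  moreover have "\<rat> \<subseteq> {t. pansu p (t *\<^sub>R x) = t *\<^sub>R pansu p x}"
  proof
    fix r :: real assume "r \<in> \<rat>"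
    then obtain m n :: nat where mn: "n \<noteq> 0" "\<bar>r\<bar> = real m / real n" by (rule Rats_abs_nat_div_natE)
    have "pansu p (\<bar>r\<bar> *\<^sub>R x) = \<bar>r\<bar> *\<^sub>R pansu p x" unfolding mn(2) using mn(1) by (intro frac) simp
    then show "r \<in> {t. pansu p (t *\<^sub>R x) = t *\<^sub>R pansu p x}"
      using pansu_minus[of p "r *\<^sub>R x"] by (cases "r \<ge> 0") auto
  qed
  ultimately have "closure \<rat> \<subseteq> {t. pansu p (t *\<^sub>R x) = t *\<^sub>R pansu p x}" by (rule closure_minimal[rotated])
  then show ?thesis using Rats_closure_real by blast
qed

lemma linear_pansu: "linear (pansu p)"
proof (rule linearI)
  fix x y :: 'a
  have "((\<lambda>n. pansu p (real n *\<^sub>R ((x /\<^sub>R real n) \<odot> (y /\<^sub>R real n)))) \<longlongrightarrow> pansu p (x + y)) sequentially"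
    by (intro tendsto_pansu Trotter)
  moreover have "((\<lambda>n. real n *\<^sub>R ((pansu p x /\<^sub>R real n) \<odot> (pansu p y /\<^sub>R real n)))
      \<longlongrightarrow> pansu p x + pansu p y) sequentially"
    by (rule Trotter)
  ultimately show "pansu p (x + y) = pansu p x + pansu p y"
    by (simp add: pansu_scaleR pansu_mul LIMSEQ_unique)
qed (rule pansu_scaleR)

lemma pansu_lbr: "pansu p (lbr x y) = lbr (pansu p x) (pansu p y)"
  by (rule lbr_hom_if_hom[OF linear_pansu pansu_mul])

text \<open>The distortion inequality at scale \<open>s * cnorm u\<close>, divided by
  \<open>s\<close>, passes to the limit because \<open>cnorm\<close> is continuous.\<close>

lemma cnorm_A_le:
  assumes u: "u \<in> V 1" "u \<noteq> 0" and w: "w \<in> V 1" and le: "cnorm w \<le> cnorm u"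
  shows "cnorm (A p w) \<le> K * cnorm (A p u)"
proof -
  obtain s0 where s0: "s0 > 0" "\<And>s x y. 0 < s \<Longrightarrow> s < s0 \<Longrightarrow> cnorm x \<le> s \<Longrightarrow> s \<le> cnorm y \<Longrightarrow>
    cnorm (incr p x) \<le> K * cnorm (incr p y)" using qc_incr by blast
  have lim: "((\<lambda>s. cnorm (dil (1 / s) (incr p (s *\<^sub>R v)))) \<longlongrightarrow> cnorm (A p v)) (at_right 0)" if "v \<in> V 1" for v
    by (intro tendsto_cnorm Pansu_V1_filter[OF that] tendsto_const tendsto_ident_at eventually_at_right_less)
  have "\<forall>\<^sub>F s in at_right (0::real). 0 < s \<and> s < s0 / cnorm u"
    by (rule eventually_at_right_real[THEN eventually_mono, of 0 "s0 / cnorm u"])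
      (use s0 u cnorm_pos in auto)
  then have "\<forall>\<^sub>F s in at_right 0. cnorm (dil (1 / s) (incr p (s *\<^sub>R w))) \<le> K * cnorm (dil (1 / s) (incr p (s *\<^sub>R u)))"
  proof eventually_elim
    case (elim s)
    have "cnorm (incr p (s *\<^sub>R w)) \<le> K * cnorm (incr p (s *\<^sub>R u))"
      using elim u cnorm_pos[of u] le w
      by (intro s0(2)[of "s * cnorm u"]) (auto simp: cnorm_V1_scale field_simps)
    then show ?case using elim by (simp add: cnorm_dil divide_right_mono)
  qed
  then show ?thesis
    by (intro tendsto_le[OF _ tendsto_mult_left[OF lim[OF u(1)]] lim[OF w]]) simp_all
qed

end

section \<open>The finest decomposition\<close>

locale decomposed_chart = stratified_chart mul V l
  for mul :: "'a::euclidean_space \<Rightarrow> 'a \<Rightarrow> 'a"  (infixl \<open>\<odot>\<close> 70) and V l +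
  fixes m :: nat and g :: "nat \<Rightarrow> 'a set"
  assumes finest: "finest_decomposition lbr V l m g"
begin

definition \<pi> :: "nat \<Rightarrow> 'a \<Rightarrow> 'a" where "\<pi> = summand {1..m} g"

lemma ds: "direct_sum {1..m} g UNIV"
  using finest by (simp add: finest_decomposition_def)

lemma linear_\<pi>: "linear (\<pi> k)"
  unfolding \<pi>_def by (rule linear_summand[OF ds])

lemma \<pi>_in: "k \<in> {1..m} \<Longrightarrow> \<pi> k x \<in> g k"
  unfolding \<pi>_def by (rule summand_in[OF ds])

lemma sum_\<pi>: "(\<Sum>k\<in>{1..m}. \<pi> k x) = x"
  unfolding \<pi>_def by (rule sum_summand[OF ds])

lemma \<pi>_eqI: "(\<And>i. i \<in> {1..m} \<Longrightarrow> u i \<in> g i) \<Longrightarrow> x = (\<Sum>i\<in>{1..m}. u i) \<Longrightarrow> k \<in> {1..m} \<Longrightarrow> \<pi> k x = u k"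
  unfolding \<pi>_def by (rule summand_eqI[OF ds])

lemma \<pi>_self: "i \<in> {1..m} \<Longrightarrow> x \<in> g i \<Longrightarrow> \<pi> k x = (if k = i then x else 0)"
  unfolding \<pi>_def by (rule summand_self[OF ds]) auto

lemma subspace_g: "k \<in> {1..m} \<Longrightarrow> subspace (g k)"
  by (rule direct_sum_subspace[OF ds])

lemma g_disjoint: "i \<in> {1..m} \<Longrightarrow> k \<in> {1..m} \<Longrightarrow> x \<in> g i \<Longrightarrow> x \<in> g k \<Longrightarrow> x \<noteq> 0 \<Longrightarrow> i = k"
  using \<pi>_self[of i x k] \<pi>_self[of k x k] by (auto split: if_splits)

lemma g_lbr: "k \<in> {1..m} \<Longrightarrow> x \<in> g k \<Longrightarrow> y \<in> g k \<Longrightarrow> lbr x y \<in> g k"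
  using finest by (auto simp: finest_decomposition_def stratified_algebra_def)

lemma g_commute: "i \<in> {1..m} \<Longrightarrow> k \<in> {1..m} \<Longrightarrow> i \<noteq> k \<Longrightarrow> x \<in> g i \<Longrightarrow> y \<in> g k \<Longrightarrow> lbr x y = 0"
  using finest unfolding finest_decomposition_def by blast

lemma \<pi>_lbr:
  assumes k: "k \<in> {1..m}" shows "\<pi> k (lbr x y) = lbr (\<pi> k x) (\<pi> k y)"
proof (rule \<pi>_eqI[OF _ _ k])
  show "lbr (\<pi> i x) (\<pi> i y) \<in> g i" if "i \<in> {1..m}" for i
    using that by (intro g_lbr \<pi>_in)
  have "lbr x y = lbr (\<Sum>i\<in>{1..m}. \<pi> i x) (\<Sum>j\<in>{1..m}. \<pi> j y)" by (simp only: sum_\<pi>)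
  also have "\<dots> = (\<Sum>i\<in>{1..m}. \<Sum>j\<in>{1..m}. lbr (\<pi> i x) (\<pi> j y))"
    by (simp only: bilinear_sum[OF bilinear_lbr] sum.cartesian_product case_prod_unfold)
  also have "\<dots> = (\<Sum>i\<in>{1..m}. \<Sum>j\<in>{1..m}. if j = i then lbr (\<pi> i x) (\<pi> i y) else 0)"
    using g_commute[OF _ _ _ \<pi>_in \<pi>_in] by (intro sum.cong) auto
  also have "\<dots> = (\<Sum>i\<in>{1..m}. lbr (\<pi> i x) (\<pi> i y))" by (intro sum.cong) auto
  finally show "lbr x y = (\<Sum>i\<in>{1..m}. lbr (\<pi> i x) (\<pi> i y))" .
qed

lemma \<pi>_mul: "k \<in> {1..m} \<Longrightarrow> \<pi> k (x \<odot> y) = \<pi> k x \<odot> \<pi> k y"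
  by (rule hom_if_lbr_hom[OF linear_\<pi> \<pi>_lbr])

text \<open>The point is the bound on the step. Since \<open>V (Suc l) = {0}\<close>, the bracket
  condition of a longer stratification would successively make all further
  \<open>g k \<inter> V j\<close> trivial, including the last layer, which must not be.\<close>

lemma g_stratified:
  assumes "k \<in> {1..m}"
  obtains n where "n \<le> l" "direct_sum {1..n} (\<lambda>j. g k \<inter> V j) (g k)"
    "\<And>j. j \<in> {1..n} \<Longrightarrow> span {lbr x y | x y. x \<in> g k \<inter> V j \<and> y \<in> g k \<inter> V 1} = g k \<inter> V (Suc j)"
proof -
  obtain n where st: "stratified_algebra lbr (g k) (\<lambda>j. g k \<inter> V j) n"
    using finest assms unfolding finest_decomposition_def by blast
  then have sp: "span {lbr x y | x y. x \<in> g k \<inter> V j \<and> y \<in> g k \<inter> V 1} = g k \<inter> V (Suc j)" if "j \<in> {1..n}" for j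
    using that unfolding stratified_algebra_def by blast
  have "n \<le> l"
  proof (rule ccontr)
    assume n: "\<not> n \<le> l"
    have "g k \<inter> V (Suc l + i) \<subseteq> {0}" if "Suc l + i \<le> n" for i
      using that
    proof (induction i)
      case 0
      show ?case using strat by (auto simp: stratified_algebra_def)
    next
      case (Suc i)
      then have "{lbr x y | x y. x \<in> g k \<inter> V (Suc l + i) \<and> y \<in> g k \<inter> V 1} \<subseteq> {0}"
        using bilinear_lzero[OF bilinear_lbr] by auto
      from span_mono[OF this] show ?case using sp[of "Suc l + i"] Suc.prems by (simp add: span_eq_iff[THEN iffD2])
    qed
    from this[of "n - Suc l"] n have "g k \<inter> V n \<subseteq> {0}" by simp
    moreover have "subspace (g k \<inter> V n)" "g k \<inter> V n \<noteq> {0}"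
      using st n unfolding stratified_algebra_def direct_sum_def by auto
    ultimately show False using subspace_0 by blast
  qed
  with sp st that show thesis unfolding stratified_algebra_def by blast
qed

text \<open>The layers of a summand lie in the layers of the whole algebra, so the decomposition of
  \<open>x\<close> inside \<open>g k\<close> is its decomposition in the whole.\<close>

lemma g_lay:
  assumes k: "k \<in> {1..m}" and x: "x \<in> g k" shows "lay j x \<in> g k"
proof -
  obtain n where n: "n \<le> l" "direct_sum {1..n} (\<lambda>j. g k \<inter> V j) (g k)"
    using g_stratified[OF k] by metis
  define u where "u = component {1..n} (\<lambda>j. g k \<inter> V j) x"
  have u: "u i \<in> g k" "u i \<in> V i" if "i \<in> {1..n}" for i
    using direct_sum_component_in[OF n(2) x that] by (auto simp: u_def)
  have "lay j x = (\<Sum>i\<in>{1..n}. lay j (u i))"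
    using direct_sum_component(2)[OF n(2) x] linear_sum[OF linear_lay] by (metis u_def)
  also have "\<dots> = (\<Sum>i\<in>{1..n}. if j = i then u i else 0)"
  proof (intro sum.cong refl)
    fix i assume "i \<in> {1..n}"
    then show "lay j (u i) = (if j = i then u i else 0)"
      using lay_self[of i "u i" j] u(2)[of i] n(1) by simp
  qed
  finally show ?thesis using u(1) subspace_0[OF subspace_g[OF k]] by simp
qed

lemma \<pi>_lay:
  assumes k: "k \<in> {1..m}" shows "\<pi> k (lay j x) = lay j (\<pi> k x)"
proof (rule \<pi>_eqI[OF _ _ k])
  show "lay j (\<pi> i x) \<in> g i" if "i \<in> {1..m}" for i using that by (intro g_lay \<pi>_in)
  show "lay j x = (\<Sum>i\<in>{1..m}. lay j (\<pi> i x))"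
    by (simp only: linear_sum[OF linear_lay, symmetric] sum_\<pi>)
qed

lemma \<pi>_V1:
  assumes "k \<in> {1..m}" "u \<in> V 1" shows "\<pi> k u \<in> V 1"
proof -
  have "lay 1 u = u" using assms(2) l_pos by (subst lay_self[of 1]) auto
  then have "\<pi> k u = lay 1 (\<pi> k u)" using \<pi>_lay[OF assms(1), of 1 u] by simp
  then show ?thesis using lay_in[of 1 "\<pi> k u"] l_pos by simp
qed

text \<open>Without horizontal vectors all brackets that span the higher layers vanish, and the
  summand would be \<open>{0}\<close>.\<close>

lemma g_horizontal:
  assumes k: "k \<in> {1..m}" obtains u where "u \<in> V 1" "u \<in> g k" "u \<noteq> 0"
proof -
  obtain n where n: "n \<le> l" "direct_sum {1..n} (\<lambda>j. g k \<inter> V j) (g k)"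
    and sp: "\<And>j. j \<in> {1..n} \<Longrightarrow> span {lbr x y | x y. x \<in> g k \<inter> V j \<and> y \<in> g k \<inter> V 1} = g k \<inter> V (Suc j)"
    by (rule g_stratified[OF k], rule that)
  have "\<not> g k \<inter> V 1 \<subseteq> {0}"
  proof
    assume z: "g k \<inter> V 1 \<subseteq> {0}"
    have "g k \<inter> V j \<subseteq> {0}" if "j \<in> {1..n}" for j
    proof (cases "j = 1")
      case False
      with that have "j = Suc (j - 1)" "j - 1 \<in> {1..n}" by auto
      then obtain i where i: "j = Suc i" "i \<in> {1..n}" by blast
      have "{lbr x y | x y. x \<in> g k \<inter> V i \<and> y \<in> g k \<inter> V 1} \<subseteq> {0}"
        using z bilinear_rzero[OF bilinear_lbr] by auto
      from span_mono[OF this] show ?thesis using sp[OF i(2)] i(1) by (simp add: span_eq_iff[THEN iffD2])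
    qed (use z in simp)
    then have "component {1..n} (\<lambda>j. g k \<inter> V j) x j = 0" if "x \<in> g k" "j \<in> {1..n}" for x j
      using direct_sum_component_in[OF n(2) that] that(2) by blast
    then have "x = 0" if "x \<in> g k" for x
      by (intro direct_sum_component(2)[OF n(2) that, THEN trans] sum.neutral ballI) (use that in blast)
    moreover have "g k \<noteq> {0}" using finest k unfolding finest_decomposition_def by blast
    ultimately show False using subspace_0[OF subspace_g[OF k]] by blast
  qed
  then show thesis using that by blast
qed

lemma prodl_commuting:
  assumes "distinct ks" "set ks \<subseteq> {1..m}" "\<And>k. k \<in> set ks \<Longrightarrow> p k \<in> g k"
  shows "prodl (map p ks) = (\<Sum>k\<in>set ks. p k)"
  using assms
proof (induction ks)
  case (Cons k ks)
  have "lbr (p k) (\<Sum>i\<in>set ks. p i) = (\<Sum>i\<in>set ks. lbr (p k) (p i))"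
    using bilinear_lbr by (simp add: bilinear_def linear_sum)
  also have "\<dots> = 0"
  proof (intro sum.neutral ballI)
    fix i assume "i \<in> set ks"
    then show "lbr (p k) (p i) = 0" using Cons.prems by (intro g_commute[of k i]) auto
  qed
  finally show ?case using Cons by (simp add: mul_eq_add_if_commute)
qed simp

text \<open>Each horizontal letter is the product of its components, which commute and remain
  horizontal.\<close>

lemma generated_by_horizontal:
  obtains us where "\<And>u. u \<in> set us \<Longrightarrow> u \<in> V 1 \<and> (\<exists>k\<in>{1..m}. u \<in> g k)" "x = prodl us"
proof -
  obtain vs where vs: "set vs \<subseteq> V 1" "x = prodl vs" using generated_by_V1 by blast
  have "\<exists>us. (\<forall>u\<in>set us. u \<in> V 1 \<and> (\<exists>k\<in>{1..m}. u \<in> g k)) \<and> prodl vs = prodl us"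
    using vs(1)
  proof (induction vs)
    case (Cons v vs)
    then obtain us where us: "\<forall>u\<in>set us. u \<in> V 1 \<and> (\<exists>k\<in>{1..m}. u \<in> g k)" "prodl vs = prodl us" by auto
    have "prodl (map (\<lambda>k. \<pi> k v) [1..<Suc m]) = (\<Sum>k\<in>set [1..<Suc m]. \<pi> k v)"
      by (intro prodl_commuting \<pi>_in) auto
    also have "set [1..<Suc m] = {1..m}" by auto
    also have "(\<Sum>k\<in>{1..m}. \<pi> k v) = v" by (rule sum_\<pi>)
    finally have "prodl (v # vs) = prodl (map (\<lambda>k. \<pi> k v) [1..<Suc m] @ us)"
      by (simp only: prodl_append us(2) prodl_Cons)
    moreover have "u \<in> V 1 \<and> (\<exists>k\<in>{1..m}. u \<in> g k)" if "u \<in> set (map (\<lambda>k. \<pi> k v) [1..<Suc m] @ us)" for u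
    proof (cases "u \<in> set us")
      case False
      with that have "u \<in> (\<lambda>k. \<pi> k v) ` {1..m}" by auto
      then obtain k where "k \<in> {1..m}" "u = \<pi> k v" by blast
      then show ?thesis using \<pi>_V1[of k v] \<pi>_in[of k v] Cons.prems by auto
    qed (use us in blast)
    ultimately show ?case by blast
  qed (auto intro: exI[of _ "[]"])
  then show thesis using vs(2) that by blast
qed

text \<open>The layers are eigenspaces of \<open>dil 2\<close> for the distinct eigenvalues
  \<open>2 ^ j\<close>, so commuting with this one dilation is enough to preserve them.\<close>

lemma graded_if_dil:
  assumes "linear \<phi>" "\<And>x. \<phi> (dil 2 x) = dil 2 (\<phi> x)"
  shows "lay i (\<phi> x) = \<phi> (lay i x)"
proof -
  have z: "lay i (\<phi> (lay j x)) = (if i = j then \<phi> (lay j x) else 0)" if j: "j \<in> {1..l}" for i j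
  proof -
    have off: "lay i (\<phi> (lay j x)) = 0" if "i \<noteq> j" for i
    proof -
      have "2 ^ i *\<^sub>R lay i (\<phi> (lay j x)) = lay i (\<phi> (dil 2 (lay j x)))" by (simp add: assms(2) lay_dil)
      also have "\<dots> = 2 ^ j *\<^sub>R lay i (\<phi> (lay j x))"
        by (simp add: dil_layer[OF lay_layer] linear_cmul[OF assms(1)] linear_cmul[OF linear_lay])
      finally show ?thesis using that by (simp add: scaleR_cancel_right)
    qed
    show ?thesis
    proof (cases "i = j")
      case True
      have "\<phi> (lay j x) = (\<Sum>i\<in>{1..l}. lay i (\<phi> (lay j x)))" by (simp only: sum_lay)
      also have "\<dots> = (\<Sum>i\<in>{1..l}. if i = j then lay j (\<phi> (lay j x)) else 0)"
        using off by (intro sum.cong) auto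
      also have "\<dots> = lay j (\<phi> (lay j x))" using j by simp
      finally show ?thesis using True by simp
    qed (use off in auto)
  qed
  have "lay i (\<phi> x) = lay i (\<phi> (\<Sum>j\<in>{1..l}. lay j x))" by (simp only: sum_lay)
  also have "\<dots> = (\<Sum>j\<in>{1..l}. lay i (\<phi> (lay j x)))"
    by (simp only: linear_sum[OF assms(1)] linear_sum[OF linear_lay])
  also have "\<dots> = (\<Sum>j\<in>{1..l}. if i = j then \<phi> (lay j x) else 0)" using z by (intro sum.cong) auto
  also have "\<dots> = \<phi> (lay i x)"
    using lay_outside[of i x] linear_0[OF assms(1)] by auto
  finally show ?thesis .
qed

text \<open>The images of the summands form another decomposition into graded ideals; each of them is a
  sum of some of the \<open>g k\<close>, and counting leaves exactly one for each.\<close>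

lemma automorphism_permutes:
  assumes lin: "linear \<phi>" and "bij \<phi>" and br: "\<And>x y. \<phi> (lbr x y) = lbr (\<phi> x) (\<phi> y)"
    and d: "\<And>x. \<phi> (dil 2 x) = dil 2 (\<phi> x)"
  shows "\<exists>\<sigma>. \<sigma> permutes {1..m} \<and> (\<forall>i\<in>{1..m}. \<phi> ` g i = g (\<sigma> i))"
proof -
  define \<psi> where "\<psi> = inv_into UNIV \<phi>"
  have \<psi>: "\<phi> (\<psi> x) = x" "\<psi> (\<phi> x) = x" for x
    using \<open>bij \<phi>\<close> by (simp_all add: \<psi>_def bij_is_surj bij_is_inj surj_f_inv_f)
  have lin\<psi>: "linear \<psi>"
  proof (rule linearI)
    fix x y :: 'a and r :: real
    show "\<psi> (x + y) = \<psi> x + \<psi> y" using \<psi>(2)[of "\<psi> x + \<psi> y"] by (simp add: linear_add[OF lin] \<psi>(1))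
    show "\<psi> (r *\<^sub>R x) = r *\<^sub>R \<psi> x" using \<psi>(2)[of "r *\<^sub>R \<psi> x"] by (simp add: linear_cmul[OF lin] \<psi>(1))
  qed
  have "direct_sum {1..m} (\<lambda>i. \<phi> ` g i) UNIV"
    unfolding direct_sum_def
  proof (intro conjI ballI)
    show "subspace (\<phi> ` g i)" if "i \<in> {1..m}" for i
      using lin subspace_g[OF that] by (rule linear_subspace_image)
    fix x :: 'a
    let ?u = "\<lambda>i\<in>{1..m}. \<phi> (\<pi> i (\<psi> x))"
    show "\<exists>!u. u \<in> (\<Pi>\<^sub>E i\<in>{1..m}. \<phi> ` g i) \<and> x = (\<Sum>i\<in>{1..m}. u i)"
    proof (rule ex1I[of _ ?u])
      have "(\<Sum>i\<in>{1..m}. ?u i) = (\<Sum>i\<in>{1..m}. \<phi> (\<pi> i (\<psi> x)))" by (intro sum.cong) auto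
      also have "\<dots> = x" by (simp only: linear_sum[OF lin, symmetric] sum_\<pi> \<psi>)
      finally show "?u \<in> (\<Pi>\<^sub>E i\<in>{1..m}. \<phi> ` g i) \<and> x = (\<Sum>i\<in>{1..m}. ?u i)"
        using \<pi>_in by auto
      fix u assume u: "u \<in> (\<Pi>\<^sub>E i\<in>{1..m}. \<phi> ` g i) \<and> x = (\<Sum>i\<in>{1..m}. u i)"
      have "\<pi> i (\<psi> x) = \<psi> (u i)" if "i \<in> {1..m}" for i
      proof (rule \<pi>_eqI[OF _ _ that])
        show "\<psi> (u i) \<in> g i" if "i \<in> {1..m}" for i
        proof -
          have "u i \<in> \<phi> ` g i" using u that by (auto simp: PiE_iff)
          then show ?thesis using \<psi>(2) by auto
        qed
        show "\<psi> x = (\<Sum>i\<in>{1..m}. \<psi> (u i))" using u by (simp add: linear_sum[OF lin\<psi>])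
      qed
      then show "u = ?u" using u by (intro PiE_ext[of u "{1..m}" _ ?u]) (auto simp: \<psi>)
    qed
  qed auto
  moreover have "\<forall>i\<in>{1..m}. graded_ideal lbr V l (\<phi> ` g i)"
  proof
    fix i assume i: "i \<in> {1..m}"
    show "graded_ideal lbr V l (\<phi> ` g i)"
    unfolding graded_ideal_def
  proof (intro conjI ballI allI)
    show "subspace (\<phi> ` g i)" using lin subspace_g[OF i] by (rule linear_subspace_image)
    show "lbr x y \<in> \<phi> ` g i" if x: "x \<in> \<phi> ` g i" for x y
    proof -
      obtain a where a: "x = \<phi> a" "a \<in> g i" using x by blast
      have "lbr a (\<psi> y) = \<pi> i (lbr a (\<psi> y))"
      proof -
        have "lbr a (\<psi> y) = (\<Sum>k\<in>{1..m}. \<pi> k (lbr a (\<psi> y)))" by (simp only: sum_\<pi>)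
        also have "\<dots> = (\<Sum>k\<in>{1..m}. if k = i then \<pi> i (lbr a (\<psi> y)) else 0)"
          using \<pi>_lbr[of _ a] \<pi>_self[OF i a(2)] bilinear_lzero[OF bilinear_lbr] by (intro sum.cong) auto
        finally show ?thesis using i by simp
      qed
      then have "lbr a (\<psi> y) \<in> g i" using \<pi>_in[OF i] by metis
      moreover have "lbr x y = \<phi> (lbr a (\<psi> y))" by (simp add: a br \<psi>)
      ultimately show ?thesis by blast
    qed
    show "component {1..l} V x j \<in> \<phi> ` g i" if x: "x \<in> \<phi> ` g i" and j: "j \<in> {1..l}" for x j
    proof -
      obtain a where a: "x = \<phi> a" "a \<in> g i" using x by blast
      have "component {1..l} V x j = \<phi> (lay j a)"
        using graded_if_dil[OF lin d, of j a] j by (simp add: a lay_def summand_def)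
      then show ?thesis using g_lay[OF i a(2)] by blast
    qed
  qed
  qed
  ultimately obtain J where J: "disjoint_family_on J {1..m}" "(\<Union>i\<in>{1..m}. J i) = {1..m}"
    "\<And>i. i \<in> {1..m} \<Longrightarrow> \<phi> ` g i = span (\<Union>k\<in>J i. g k)"
    using finest[unfolded finest_decomposition_def, THEN conjunct2, THEN conjunct2, THEN conjunct2,
        rule_format, of m "\<lambda>i. \<phi> ` g i"] by auto
  have "\<exists>k. k \<in> J i" if i: "i \<in> {1..m}" for i
  proof (rule ccontr)
    assume "\<not> (\<exists>k. k \<in> J i)"
    then have "J i = {}" by blast
    then have 0: "\<phi> ` g i = {0}" using J(3)[OF i] by simp
    obtain u where "u \<in> g i" "u \<noteq> 0" using g_horizontal[OF i] by blast
    then have "\<phi> u = 0" using 0 by blast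
    then show False using \<psi>(2)[of u] linear_0[OF lin\<psi>] \<open>u \<noteq> 0\<close> by simp
  qed
  \<comment> \<open>A choice of one index from each \<open>J i\<close>. Disjointness makes it
    injective, finiteness makes it onto, and then no \<open>J i\<close> has room for a second
    index.\<close>
  then obtain \<tau> where \<tau>: "\<And>i. i \<in> {1..m} \<Longrightarrow> \<tau> i \<in> J i" by metis
  have inj: "inj_on \<tau> {1..m}"
    using J(1) \<tau> unfolding disjoint_family_on_def inj_on_def by (metis disjoint_iff)
  have sub: "\<tau> ` {1..m} \<subseteq> {1..m}" using \<tau> J(2) by blast
  have surj: "\<tau> ` {1..m} = {1..m}" using endo_inj_surj[OF finite_atLeastAtMost sub inj] .
  have Ji: "J i = {\<tau> i}" if i: "i \<in> {1..m}" for i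
  proof (intro equalityI subsetI)
    fix k assume k: "k \<in> J i"
    then have "k \<in> {1..m}" using J(2) i by blast
    then obtain j where j: "j \<in> {1..m}" "k = \<tau> j" using surj by (metis imageE)
    then have "k \<in> J j" using \<tau> by blast
    then have "i = j" using J(1) k i j(1) unfolding disjoint_family_on_def by (metis disjoint_iff)
    then show "k \<in> {\<tau> i}" using j by simp
  qed (use \<tau> i in auto)
  define \<sigma> where "\<sigma> i = (if i \<in> {1..m} then \<tau> i else i)" for i
  have "bij_betw \<tau> {1..m} {1..m}"
    using inj surj unfolding bij_betw_def by blast
  then have "bij_betw \<sigma> {1..m} {1..m}"
    by (rule bij_betw_cong[THEN iffD1, rotated]) (simp add: \<sigma>_def)
  then have "\<sigma> permutes {1..m}" by (rule bij_imp_permutes) (auto simp: \<sigma>_def)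
  moreover have "\<phi> ` g i = g (\<sigma> i)" if i: "i \<in> {1..m}" for i
  proof -
    have "\<tau> i \<in> {1..m}" using sub i by blast
    then have "span (g (\<tau> i)) = g (\<tau> i)" using subspace_g by (simp add: span_eq_iff)
    then show ?thesis using J(3)[OF i] Ji[OF i] i by (simp add: \<sigma>_def)
  qed
  ultimately show ?thesis by blast
qed

end

section \<open>The Pansu differential permutes the factors\<close>

locale qc_split = C1_qc_map mul V l f K + decomposed_chart mul V l m g
  for mul :: "'a::euclidean_space \<Rightarrow> 'a \<Rightarrow> 'a"  (infixl \<open>\<odot>\<close> 70) and V l f K m g +
  assumes m2: "m > 1"
begin

definition regular :: "'a \<Rightarrow> bool" where "regular p \<longleftrightarrow> (\<exists>u\<in>V 1. A p u \<noteq> 0)"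

text \<open>Quasiconformality leaves no intermediate rank: a nonzero kernel vector, scaled up, would
  dominate a vector that is not annihilated.\<close>

lemma regular_inj:
  assumes "regular p" "u \<in> V 1" "A p u = 0" shows "u = 0"
proof (rule ccontr)
  assume u: "u \<noteq> 0"
  obtain w where w: "w \<in> V 1" "A p w \<noteq> 0" using assms(1) by (auto simp: regular_def)
  define t where "t = cnorm w / cnorm u"
  have "w \<noteq> 0" using w linear_0[OF linear_A] by auto
  then have t: "t > 0" using u cnorm_pos by (simp add: t_def)
  have "cnorm (t *\<^sub>R u) = t * cnorm u" using t by (simp add: cnorm_V1_scale[OF assms(2)])
  then have "cnorm w \<le> cnorm (t *\<^sub>R u)" using u by (simp add: t_def)
  then have "cnorm (A p w) \<le> K * cnorm (A p (t *\<^sub>R u))"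
    using t u w(1) assms(2) subspace_scale[OF subspace_V1] by (intro cnorm_A_le) auto
  also have "\<dots> = 0" using assms(3) by (simp add: linear_cmul[OF linear_A])
  finally show False using w(2) by simp
qed

text \<open>Injectivity on \<open>V 1\<close> gives surjectivity onto \<open>V 1\<close> by
  dimension. As \<open>V 1\<close> generates, \<open>pansu p\<close> is onto, and a linear
  surjection of a finite-dimensional space to itself is bijective.\<close>

lemma regular_bij_pansu:
  assumes p: "regular p" shows "bij (pansu p)"
proof -
  have "A p ` V 1 = V 1"
  proof (rule subspace_dim_equal)
    show "subspace (A p ` V 1)" by (rule linear_subspace_image[OF linear_A subspace_V1])
    show "A p ` V 1 \<subseteq> V 1" using contact by blast
    have "inj_on (A p) (V 1)"
    proof (rule inj_onI)
      fix u w assume uw: "u \<in> V 1" "w \<in> V 1" "A p u = A p w"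
      then have "u - w = 0"
        using regular_inj[OF p, of "u - w"] subspace_diff[OF subspace_V1] by (simp add: linear_diff[OF linear_A])
      then show "u = w" by simp
    qed
    then show "dim (V 1) \<le> dim (A p ` V 1)"
      using dim_image_eq[OF linear_A, of p "V 1"] span_eq_iff[THEN iffD2, OF subspace_V1]
      by (simp only: order_refl)
  qed (rule subspace_V1)
  have "\<exists>y. pansu p y = x" for x
  proof -
    obtain us where us: "set us \<subseteq> V 1" "x = prodl us" using generated_by_V1 by blast
    have "\<exists>y. pansu p y = prodl us" using us(1)
    proof (induction us)
      case Nil
      show ?case by (intro exI[of _ 0]) simp
    next
      case (Cons u us)
      then obtain y where y: "pansu p y = prodl us" by auto
      have "u \<in> A p ` V 1" using \<open>A p ` V 1 = V 1\<close> Cons.prems by simp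
      then obtain w where w: "w \<in> V 1" "A p w = u" by blast
      show ?case by (intro exI[of _ "w \<odot> y"]) (simp add: pansu_mul pansu_V1[OF w(1)] y w(2))
    qed
    then show ?thesis using us by simp
  qed
  then have "surj (pansu p)" by (auto simp: surj_def) metis
  then show ?thesis
    using linear_surjective_imp_injective[OF linear_pansu] by (simp add: bij_def)
qed

definition \<sigma> :: "'a \<Rightarrow> nat \<Rightarrow> nat" where
  "\<sigma> p = (SOME \<sigma>. \<sigma> permutes {1..m} \<and> (\<forall>i\<in>{1..m}. pansu p ` g i = g (\<sigma> i)))"

lemma \<sigma>:
  assumes "regular p"
  shows "\<sigma> p permutes {1..m}" "\<And>i. i \<in> {1..m} \<Longrightarrow> pansu p ` g i = g (\<sigma> p i)"
proof -
  have "\<exists>\<sigma>. \<sigma> permutes {1..m} \<and> (\<forall>i\<in>{1..m}. pansu p ` g i = g (\<sigma> i))"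
    by (rule automorphism_permutes[OF linear_pansu regular_bij_pansu[OF assms] pansu_lbr pansu_dil])
  from someI_ex[OF this] show "\<sigma> p permutes {1..m}" "\<And>i. i \<in> {1..m} \<Longrightarrow> pansu p ` g i = g (\<sigma> p i)"
    unfolding \<sigma>_def by blast+
qed

lemma \<sigma>_in: "regular p \<Longrightarrow> i \<in> {1..m} \<Longrightarrow> \<sigma> p i \<in> {1..m}"
  using permutes_in_image[OF \<sigma>(1)] by blast

lemma \<sigma>_inj: "regular p \<Longrightarrow> \<sigma> p i = \<sigma> p k \<Longrightarrow> i = k"
  using permutes_inj[OF \<sigma>(1)] by (auto dest: injD)

lemma A_in: "regular p \<Longrightarrow> i \<in> {1..m} \<Longrightarrow> u \<in> V 1 \<Longrightarrow> u \<in> g i \<Longrightarrow> A p u \<in> g (\<sigma> p i)"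
  using imageI[of u "g i" "pansu p"] \<sigma>(2)[of p i] pansu_V1[of u p] by simp

lemma tendsto_A [tendsto_intros]:
  assumes "(q \<longlongrightarrow> p) F" shows "((\<lambda>i. A (q i) u) \<longlongrightarrow> A p u) F"
proof -
  have "continuous_on UNIV (\<lambda>p. A p u)" by (intro continuous_intros)
  then have "isCont (\<lambda>p. A p u) p" by (simp add: continuous_on_eq_continuous_at)
  from isCont_tendsto_compose[OF this assms] show ?thesis .
qed

text \<open>For a nonzero horizontal \<open>u\<close> in \<open>g i\<close>, the vector
  \<open>A p u\<close> avoids the closed subspaces \<open>g k\<close> with \<open>k\<close> other
  than \<open>\<sigma> p i\<close>. This persists nearby and leaves only one summand for
  \<open>A q u\<close>.\<close>

lemma \<sigma>_locally_constant:
  assumes p: "regular p"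
  shows "\<forall>\<^sub>F q in nhds p. regular q \<and> (\<forall>i\<in>{1..m}. \<sigma> q i = \<sigma> p i)"
proof -
  have t: "((\<lambda>q. A q u) \<longlongrightarrow> A p u) (nhds p)" for u by (intro tendsto_A filterlim_ident)
  obtain u where u: "u \<in> V 1" "A p u \<noteq> 0" using p by (auto simp: regular_def)
  have "\<forall>\<^sub>F q in nhds p. A q u \<noteq> 0" by (rule tendsto_imp_eventually_ne[OF t u(2)])
  then have reg: "\<forall>\<^sub>F q in nhds p. regular q" by eventually_elim (use u(1) in \<open>auto simp: regular_def\<close>)
  have "\<forall>\<^sub>F q in nhds p. regular q \<longrightarrow> \<sigma> q i = \<sigma> p i" if i: "i \<in> {1..m}" for i
  proof -
    obtain u where u: "u \<in> V 1" "u \<in> g i" "u \<noteq> 0" using g_horizontal[OF i] by blast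
    have nz: "A p u \<noteq> 0" using regular_inj[OF p u(1)] u(3) by blast
    have "\<forall>\<^sub>F q in nhds p. A q u \<notin> g k" if k: "k \<in> {1..m} - {\<sigma> p i}" for k
    proof -
      have "A p u \<notin> g k" using g_disjoint[OF \<sigma>_in[OF p i] _ A_in[OF p i u(1,2)] _ nz, of k] k by auto
      moreover have "open (- g k)" using closed_subspace[OF subspace_g[of k]] k by auto
      ultimately have "\<forall>\<^sub>F q in nhds p. A q u \<in> - g k" using topological_tendstoD[OF t] by blast
      then show ?thesis by simp
    qed
    then have "\<forall>\<^sub>F q in nhds p. \<forall>k\<in>{1..m} - {\<sigma> p i}. A q u \<notin> g k"
      by (intro eventually_ball_finite) auto
    then show ?thesis
    proof eventually_elim
      case (elim q)
      then show ?case using A_in[OF _ i u(1,2), of q] \<sigma>_in[OF _ i, of q] by blast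
    qed
  qed
  then have "\<forall>\<^sub>F q in nhds p. \<forall>i\<in>{1..m}. regular q \<longrightarrow> \<sigma> q i = \<sigma> p i"
    by (intro eventually_ball_finite) auto
  with reg show ?thesis by eventually_elim blast
qed

section \<open>Independence of the coordinates in the other factors\<close>

text \<open>Along the line the left velocity of \<open>f\<close> lies in
  \<open>g (\<sigma> p i)\<close>, so its projection to any other factor of the target
  vanishes.\<close>

lemma f_component_const:
  assumes i: "i \<in> {1..m}" "k \<in> {1..m}" "i \<noteq> k" and u: "u \<in> V 1" "u \<in> g i"
    and reg: "regular p" and r: "\<And>t. 0 \<le> t \<Longrightarrow> t \<le> 1 \<Longrightarrow> regular (q \<odot> (t *\<^sub>R u)) \<and> \<sigma> (q \<odot> (t *\<^sub>R u)) i = \<sigma> p i"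
  shows "\<pi> (\<sigma> p k) (f (q \<odot> u)) = \<pi> (\<sigma> p k) (f q)"
proof -
  have k': "\<sigma> p k \<in> {1..m}" using \<sigma>_in[OF reg i(2)] .
  have "has_lvel (\<lambda>t. \<pi> (\<sigma> p k) (f (q \<odot> (t *\<^sub>R u)))) 0 t" if t: "0 \<le> t" "t \<le> 1" for t
  proof -
    have "\<pi> (\<sigma> p k) (A (q \<odot> (t *\<^sub>R u)) u) = 0"
      using A_in[of "q \<odot> (t *\<^sub>R u)" i u] r[OF t] i(1) u \<pi>_self[OF \<sigma>_in[OF reg i(1)]] \<sigma>_inj[OF reg, of k i] i(3)
      by auto
    moreover have "has_lvel (\<lambda>t. f (q \<odot> (t *\<^sub>R u))) (A (q \<odot> (t *\<^sub>R u)) u) t"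
      by (intro has_lvel_f has_lvel_mul_left has_lvel_ray)
    ultimately show ?thesis using has_lvel_hom[OF linear_\<pi> \<pi>_mul[OF k']] by metis
  qed
  from has_lvel_0_const[OF this] show ?thesis by simp
qed

lemma commute_mul:
  assumes "i \<in> {1..m}" "k \<in> {1..m}" "i \<noteq> k" "u \<in> g i" "w \<in> g k"
  shows "u \<odot> w = w \<odot> u"
  using g_commute[OF assms] g_commute[of k i w u] assms by (simp add: mul_eq_add_if_commute add.commute)

text \<open>Directions in different factors commute, so the line along \<open>w\<close> may be
  shifted along \<open>u\<close> before or after. By \<open>f_component_const\<close> the relevant
  component of \<open>f\<close> does not notice the shift; differentiating along \<open>w\<close>
  gives the claim.\<close>

lemma A_locally_const:
  assumes i: "i \<in> {1..m}" "k \<in> {1..m}" "i \<noteq> k" and u: "u \<in> V 1" "u \<in> g i" and w: "w \<in> V 1" "w \<in> g k"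
    and q: "regular q"
  shows "\<forall>\<^sub>F t in nhds 0. A (q \<odot> (t *\<^sub>R u)) w = A q w"
proof -
  have sc: "t *\<^sub>R v \<in> V 1" "t *\<^sub>R v \<in> g j" if "v \<in> V 1" "v \<in> g j" "j \<in> {1..m}" for t v j
    using that subspace_scale[OF subspace_V1] subspace_scale[OF subspace_g] by auto
  have k': "\<sigma> q k \<in> {1..m}" using \<sigma>_in[OF q i(2)] .
  obtain e where e: "e > 0" "\<And>p. dist p q < e \<Longrightarrow> regular p \<and> (\<forall>i\<in>{1..m}. \<sigma> p i = \<sigma> q i)"
    using \<sigma>_locally_constant[OF q] unfolding eventually_nhds_metric by blast
  have "continuous_on UNIV (\<lambda>z. q \<odot> (fst z *\<^sub>R w) \<odot> (snd z *\<^sub>R u))" by (intro continuous_intros)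
  then have "isCont (\<lambda>z. q \<odot> (fst z *\<^sub>R w) \<odot> (snd z *\<^sub>R u)) (0, 0)" by (simp add: continuous_on_eq_continuous_at)
  then obtain d where d: "d > 0" "\<And>z. dist z (0, 0) < d \<Longrightarrow> dist (q \<odot> (fst z *\<^sub>R w) \<odot> (snd z *\<^sub>R u)) q < e"
    using e(1) unfolding continuous_at_eps_delta by fastforce
  have near: "regular (q \<odot> (s *\<^sub>R w) \<odot> (t *\<^sub>R u)) \<and> (\<forall>i\<in>{1..m}. \<sigma> (q \<odot> (s *\<^sub>R w) \<odot> (t *\<^sub>R u)) i = \<sigma> q i)"
    if "\<bar>s\<bar> < d / 2" "\<bar>t\<bar> < d / 2" for s t
  proof -
    have "dist (s, t) (0, 0) < d" using norm_Pair_le[of s t] that by (simp add: dist_norm flip: zero_prod_def)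
    from e(2)[OF d(2)[OF this]] show ?thesis by simp
  qed
  show ?thesis
    unfolding eventually_nhds_metric
  proof (intro exI[of _ "d / 2"] conjI allI impI)
    show "d / 2 > 0" using d by simp
    fix t :: real assume "dist t 0 < d / 2"
    then have t: "\<bar>t\<bar> < d / 2" by simp
    have eq: "\<pi> (\<sigma> q k) (f (q \<odot> (t *\<^sub>R u) \<odot> (s *\<^sub>R w))) = \<pi> (\<sigma> q k) (f (q \<odot> (s *\<^sub>R w)))" if s: "\<bar>s\<bar> < d / 2" for s
    proof -
      have "\<pi> (\<sigma> q k) (f (q \<odot> (s *\<^sub>R w) \<odot> (t *\<^sub>R u))) = \<pi> (\<sigma> q k) (f (q \<odot> (s *\<^sub>R w)))"
      proof (rule f_component_const[OF i sc[OF u i(1)] q])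
        fix r :: real assume r: "0 \<le> r" "r \<le> 1"
        have "\<bar>r * t\<bar> \<le> \<bar>t\<bar>" using r by (simp add: abs_mult mult_left_le_one_le)
        then have "\<bar>r * t\<bar> < d / 2" using t by linarith
        from near[OF s this] i(1) show "regular (q \<odot> (s *\<^sub>R w) \<odot> (r *\<^sub>R t *\<^sub>R u)) \<and>
            \<sigma> (q \<odot> (s *\<^sub>R w) \<odot> (r *\<^sub>R t *\<^sub>R u)) i = \<sigma> q i" by simp
      qed
      moreover have "q \<odot> (t *\<^sub>R u) \<odot> (s *\<^sub>R w) = q \<odot> (s *\<^sub>R w) \<odot> (t *\<^sub>R u)"
        using commute_mul[OF i sc(2)[OF u i(1)] sc(2)[OF w i(2)]] by (simp add: mul_assoc)
      ultimately show ?thesis by simp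
    qed
    have lv: "has_lvel (\<lambda>s. \<pi> (\<sigma> q k) (f (x \<odot> (s *\<^sub>R w)))) (\<pi> (\<sigma> q k) (A x w)) 0" for x
    proof -
      have "has_lvel (\<lambda>s. f (x \<odot> (s *\<^sub>R w))) (A (x \<odot> (0 *\<^sub>R w)) w) 0"
        by (intro has_lvel_f has_lvel_mul_left has_lvel_ray)
      from has_lvel_hom[OF linear_\<pi> \<pi>_mul[OF k'] this] show ?thesis by simp
    qed
    have "has_lvel (\<lambda>s. \<pi> (\<sigma> q k) (f (q \<odot> (s *\<^sub>R w)))) (\<pi> (\<sigma> q k) (A (q \<odot> (t *\<^sub>R u)) w)) 0"
      unfolding has_lvel_def
    proof (rule has_vector_derivative_transform_within_open[where S = "{- d / 2 <..< d / 2}"])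
      show "((\<lambda>s. \<pi> (\<sigma> q k) (f (q \<odot> (t *\<^sub>R u) \<odot> (s *\<^sub>R w)))) has_vector_derivative
          lin (\<pi> (\<sigma> q k) (f (q \<odot> (0 *\<^sub>R w)))) (\<pi> (\<sigma> q k) (A (q \<odot> (t *\<^sub>R u)) w))) (at 0)"
        using lv[of "q \<odot> (t *\<^sub>R u)"] eq[of 0] d(1) by (simp add: has_lvel_def)
    qed (use d(1) eq in \<open>auto simp: abs_less_iff\<close>)
    from has_lvel_unique[OF this lv] have "\<pi> (\<sigma> q k) (A (q \<odot> (t *\<^sub>R u)) w) = \<pi> (\<sigma> q k) (A q w)" .
    moreover have "A (q \<odot> (t *\<^sub>R u)) w \<in> g (\<sigma> q k)" "A q w \<in> g (\<sigma> q k)"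
      using A_in[OF q i(2) w] A_in[of "q \<odot> (t *\<^sub>R u)", OF _ i(2) w] near[of 0 t] t i(2) d(1) by auto
    ultimately show "A (q \<odot> (t *\<^sub>R u)) w = A q w" using \<pi>_self[OF k'] by simp
  qed
qed

text \<open>An open-closed argument in \<open>t\<close>. Openness requires regularity at the point
  reached, and this is free: the differential there has the nonzero value \<open>A p w\<close> at
  \<open>w\<close>.\<close>

lemma A_const:
  assumes i: "i \<in> {1..m}" "k \<in> {1..m}" "i \<noteq> k" and u: "u \<in> V 1" "u \<in> g i" and w: "w \<in> V 1" "w \<in> g k"
    and p: "regular p"
  shows "A (p \<odot> (t *\<^sub>R u)) w = A p w"
proof (cases "w = 0")
  case True
  then show ?thesis using linear_0[OF linear_A] by simp
next
  case False
  define S where "S = {t. A (p \<odot> (t *\<^sub>R u)) w = A p w}"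
  have "closed S" unfolding S_def by (intro closed_Collect_eq continuous_intros)
  moreover have "open S"
    unfolding open_dist
  proof
    fix t assume t: "t \<in> S"
    then have "A (p \<odot> (t *\<^sub>R u)) w \<noteq> 0" using regular_inj[OF p w(1)] False by (auto simp: S_def)
    then have "regular (p \<odot> (t *\<^sub>R u))" using w(1) by (auto simp: regular_def)
    from A_locally_const[OF i u w this]
    obtain d where d: "d > 0" "\<And>r. dist r 0 < d \<Longrightarrow> A (p \<odot> (t *\<^sub>R u) \<odot> (r *\<^sub>R u)) w = A (p \<odot> (t *\<^sub>R u)) w"
      unfolding eventually_nhds_metric by blast
    have "y \<in> S" if "dist y t < d" for y
    proof -
      have "p \<odot> (t *\<^sub>R u) \<odot> ((y - t) *\<^sub>R u) = p \<odot> (y *\<^sub>R u)"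
        using ray_add[of t "y - t" u] by (simp add: mul_assoc)
      then show ?thesis using d(2)[of "y - t"] that t by (simp add: S_def dist_norm)
    qed
    then show "\<exists>e>0. \<forall>y. dist y t < e \<longrightarrow> y \<in> S" using d(1) by blast
  qed
  moreover have "0 \<in> S" by (simp add: S_def)
  ultimately have "S = UNIV" using clopen[of S] by blast
  then show ?thesis by (auto simp: S_def)
qed

lemma other_index: obtains k where "k \<in> {1..m}" "k \<noteq> i"
  using m2 that[of 1] that[of 2] by (cases "i = 1") auto

text \<open>A second factor serves as witness: the differential on \<open>g k\<close> is unaffected
  by the move along \<open>u\<close>, so it stays nonzero.\<close>

lemma regular_step:
  assumes i: "i \<in> {1..m}" and u: "u \<in> V 1" "u \<in> g i" and p: "regular p"
  shows "regular (p \<odot> u)"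
proof -
  obtain k where k: "k \<in> {1..m}" "k \<noteq> i" using other_index by blast
  obtain w where w: "w \<in> V 1" "w \<in> g k" "w \<noteq> 0" using g_horizontal[OF k(1)] by blast
  have "A (p \<odot> u) w = A p w" using A_const[OF i k(1) k(2)[symmetric] u w(1,2) p, of 1] by simp
  then show ?thesis using regular_inj[OF p w(1)] w(1,3) unfolding regular_def by metis
qed

text \<open>Otherwise \<open>f\<close> would be constant along every horizontal line, against
  injectivity.\<close>

lemma regular_exists: "\<exists>p. regular p"
proof (rule ccontr)
  assume "\<nexists>p. regular p"
  then have z: "A p u = 0" if "u \<in> V 1" for p u using that by (auto simp: regular_def)
  have s: "f (p \<odot> u) = f p" if u: "u \<in> V 1" for p u
  proof -
    have "has_lvel (\<lambda>t. f (p \<odot> (t *\<^sub>R u))) (A (p \<odot> (t *\<^sub>R u)) u) t" for t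
      by (intro has_lvel_f has_lvel_mul_left has_lvel_ray)
    then have "has_lvel (\<lambda>t. f (p \<odot> (t *\<^sub>R u))) 0 t" for t using z[OF u] by simp
    from has_lvel_0_const[OF this] show ?thesis by simp
  qed
  obtain u where u: "u \<in> V 1" "u \<noteq> 0" using g_horizontal[of 1] m2 by auto
  show False using s[OF u(1), of 0] u(2) inj by (auto dest: injD)
qed

lemma regular: "regular p"
proof -
  obtain p0 where p0: "regular p0" using regular_exists by blast
  have "regular (q \<odot> prodl us)" if "\<And>u. u \<in> set us \<Longrightarrow> u \<in> V 1 \<and> (\<exists>k\<in>{1..m}. u \<in> g k)" "regular q" for us q
    using that
  proof (induction us arbitrary: q)
    case (Cons u us)
    obtain k where k: "k \<in> {1..m}" "u \<in> g k" "u \<in> V 1" using Cons.prems(1)[of u] by auto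
    have "regular (q \<odot> u \<odot> prodl us)"
      using Cons.prems regular_step[OF k(1,3,2)] by (intro Cons.IH) auto
    then show ?case by (simp add: mul_assoc)
  qed simp
  moreover obtain us where us: "\<And>u. u \<in> set us \<Longrightarrow> u \<in> V 1 \<and> (\<exists>k\<in>{1..m}. u \<in> g k)" "(- p0) \<odot> p = prodl us"
    using generated_by_horizontal[of "(- p0) \<odot> p"] by metis
  ultimately have "regular (p0 \<odot> ((- p0) \<odot> p))" using p0 by metis
  then show ?thesis by simp
qed

lemma \<sigma>_eq:
  assumes i: "i \<in> {1..m}" shows "\<sigma> p i = \<sigma> 0 i"
proof -
  have "(\<lambda>p. \<sigma> p i) constant_on UNIV"
  proof (rule locally_constant_imp_constant)
    show "\<exists>T. openin (top_of_set UNIV) T \<and> p \<in> T \<and> (\<forall>q\<in>T. \<sigma> q i = \<sigma> p i)" for p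
    proof -
      have "\<forall>\<^sub>F q in nhds p. \<sigma> q i = \<sigma> p i"
        using \<sigma>_locally_constant[OF regular[of p]] by eventually_elim (use i in blast)
      then show ?thesis by (auto simp: eventually_nhds)
    qed
  qed auto
  then show ?thesis by (auto simp: constant_on_def)
qed

text \<open>In a word for \<open>x\<close>, letters of factor \<open>k\<close> are absorbed into the
  base point \<open>q\<close>, while a letter from another factor is carried to the end by
  commutation, where it has no effect on this component.\<close>

lemma f_component:
  assumes k: "k \<in> {1..m}" shows "\<pi> (\<sigma> 0 k) (f x) = \<pi> (\<sigma> 0 k) (f (\<pi> k x))"
proof -
  have step: "\<pi> (\<sigma> 0 k) (f (q \<odot> u)) = \<pi> (\<sigma> 0 k) (f q)"
    if "i \<in> {1..m}" "i \<noteq> k" "u \<in> V 1" "u \<in> g i" for i u q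
    by (rule f_component_const[OF that(1) k that(2-4) regular]) (intro conjI regular \<sigma>_eq that)
  have "\<pi> (\<sigma> 0 k) (f (q \<odot> prodl us)) = \<pi> (\<sigma> 0 k) (f (q \<odot> \<pi> k (prodl us)))"
    if "\<And>u. u \<in> set us \<Longrightarrow> u \<in> V 1 \<and> (\<exists>k\<in>{1..m}. u \<in> g k)" for us q
    using that
  proof (induction us arbitrary: q)
    case Nil
    show ?case by (simp add: linear_0[OF linear_\<pi>])
  next
    case (Cons u us)
    obtain i where i: "i \<in> {1..m}" "u \<in> g i" "u \<in> V 1" using Cons.prems[of u] by auto
    have IH: "\<pi> (\<sigma> 0 k) (f (q \<odot> u \<odot> prodl us)) = \<pi> (\<sigma> 0 k) (f (q \<odot> u \<odot> \<pi> k (prodl us)))"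
      using Cons.prems by (intro Cons.IH) auto
    show ?case
    proof (cases "i = k")
      case True
      then show ?thesis using IH \<pi>_self[OF i(1,2), of k] by (simp add: \<pi>_mul[OF k] mul_assoc)
    next
      case False
      have "q \<odot> u \<odot> \<pi> k (prodl us) = q \<odot> \<pi> k (prodl us) \<odot> u"
        using commute_mul[OF i(1) k False i(2) \<pi>_in[OF k]] by (simp add: mul_assoc)
      then show ?thesis using IH step[OF i(1) False i(3,2), of "q \<odot> \<pi> k (prodl us)"] \<pi>_self[OF i(1,2), of k] False
        by (simp add: \<pi>_mul[OF k] mul_assoc)
    qed
  qed
  moreover obtain us where us: "\<And>u. u \<in> set us \<Longrightarrow> u \<in> V 1 \<and> (\<exists>k\<in>{1..m}. u \<in> g k)" "x = prodl us"
    using generated_by_horizontal[of x] by metis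
  ultimately have "\<pi> (\<sigma> 0 k) (f (0 \<odot> x)) = \<pi> (\<sigma> 0 k) (f (0 \<odot> \<pi> k x))" by metis
  then show ?thesis by simp
qed

text \<open>Obtained by differentiating \<open>f_component\<close> along \<open>w\<close>; the
  projection loses nothing, since \<open>A\<close> maps \<open>w\<close> into
  \<open>g (\<sigma> 0 k)\<close> at every point.\<close>

lemma A_component:
  assumes k: "k \<in> {1..m}" and w: "w \<in> V 1" "w \<in> g k" shows "A x w = A (\<pi> k x) w"
proof -
  have k': "\<sigma> 0 k \<in> {1..m}" using \<sigma>_in[OF regular k] .
  have lv: "has_lvel (\<lambda>s. \<pi> (\<sigma> 0 k) (f (y \<odot> (s *\<^sub>R w)))) (\<pi> (\<sigma> 0 k) (A y w)) 0" for y
  proof -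
    have "has_lvel (\<lambda>s. f (y \<odot> (s *\<^sub>R w))) (A (y \<odot> (0 *\<^sub>R w)) w) 0"
      by (intro has_lvel_f has_lvel_mul_left has_lvel_ray)
    from has_lvel_hom[OF linear_\<pi> \<pi>_mul[OF k'] this] show ?thesis by simp
  qed
  have "\<pi> (\<sigma> 0 k) (f (x \<odot> (s *\<^sub>R w))) = \<pi> (\<sigma> 0 k) (f (\<pi> k x \<odot> (s *\<^sub>R w)))" for s
    using f_component[OF k, of "x \<odot> (s *\<^sub>R w)"] \<pi>_self[OF k w(2), of k]
    by (simp add: \<pi>_mul[OF k] linear_cmul[OF linear_\<pi>])
  then have "\<pi> (\<sigma> 0 k) (A x w) = \<pi> (\<sigma> 0 k) (A (\<pi> k x) w)"
    using has_lvel_unique[OF lv[of x]] lv[of "\<pi> k x"] by simp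
  moreover have "A y w \<in> g (\<sigma> 0 k)" for y
    using A_in[OF regular k w, of y] \<sigma>_eq[OF k, of y] by simp
  ultimately show ?thesis using \<pi>_self[OF k'] by simp
qed

end

section \<open>Bi-Lipschitz bounds\<close>

context stratified_chart begin

lemma reach_cdist_subcurve:
  assumes "hcurve c X" "t \<in> {0..1}" "t' \<in> {0..1}"
  shows "cdist (c t') (c t) \<le> \<bar>arclen X t' - arclen X t\<bar>"
proof (cases "t' \<le> t")
  case True
  then show ?thesis using cdist_le[OF reach_subcurve[OF assms(1), of t' t]] assms by simp
next
  case False
  then show ?thesis using cdist_le[OF reach_subcurve[OF assms(1), of t t']] assms cdist_sym[of "c t'" "c t"] by simp
qed

lemma continuous_on_arclen: "hcurve c X \<Longrightarrow> continuous_on {0..1} (arclen X)"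
  by (rule DERIV_continuous_on[OF arclen_derivative[OF hcurve_continuous]])

lemma arclen_near:
  assumes "hcurve c X" "t \<in> {0..1}" "e > 0"
  obtains d where "d > 0" "\<And>t'. t' \<in> {0..1} \<Longrightarrow> \<bar>t' - t\<bar> < d \<Longrightarrow> \<bar>arclen X t' - arclen X t\<bar> < e"
  using continuous_on_arclen[OF assms(1)] assms(2,3) that
  unfolding continuous_on_iff dist_real_def by meson

text \<open>The admissible time span \<open>d\<close> near \<open>t\<close> is not uniform in
  \<open>t\<close>, so the local bounds are put together by bisection; they add up by the triangle
  inequality and additivity of arc length.\<close>

lemma lipschitz_along_curve:
  assumes h: "hcurve c X" and b: "0 \<le> b" "b \<le> 1"
    and loc: "\<And>t. 0 \<le> t \<Longrightarrow> t \<le> b \<Longrightarrow> \<exists>d>0. \<forall>t'. 0 \<le> t' \<longrightarrow> t' \<le> b \<longrightarrow> \<bar>t' - t\<bar> < d \<longrightarrow>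
      cdist (h t') (h t) \<le> M * \<bar>arclen X t' - arclen X t\<bar>"
  shows "cdist (h 0) (h b) \<le> M * arclen X b"
proof -
  have "0 \<le> (0::real) \<longrightarrow> b \<le> b \<longrightarrow> cdist (h 0) (h b) \<le> M * (arclen X b - arclen X 0)"
    using b(1)
  proof (induction rule: Bolzano[where P = "\<lambda>u v. 0 \<le> u \<longrightarrow> v \<le> b \<longrightarrow> cdist (h u) (h v) \<le> M * (arclen X v - arclen X u)"])
    case (trans u v w)
    show ?case
    proof (intro impI)
      assume "0 \<le> u" "w \<le> b"
      then show "cdist (h u) (h w) \<le> M * (arclen X w - arclen X u)"
        using trans cdist_triangle[of "h u" "h w" "h v"] by (simp add: algebra_simps)
    qed
  next
    case (local t)
    obtain d where d: "d > 0" "\<And>t'. 0 \<le> t' \<Longrightarrow> t' \<le> b \<Longrightarrow> \<bar>t' - t\<bar> < d \<Longrightarrow>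
      cdist (h t') (h t) \<le> M * \<bar>arclen X t' - arclen X t\<bar>" using loc[OF local] by blast
    have mono: "arclen X u \<le> arclen X v" if "0 \<le> u" "u \<le> v" "v \<le> b" for u v
      using reach_nonneg[OF reach_subcurve[OF assms(1), of u v]] that b by simp
    show ?case
    proof (intro exI[of _ d] conjI allI impI)
      fix u v assume uv: "u \<le> t \<and> t \<le> v \<and> v - u < d" and "0 \<le> u" "v \<le> b"
      then have "cdist (h u) (h t) \<le> M * (arclen X t - arclen X u)" "cdist (h v) (h t) \<le> M * (arclen X v - arclen X t)"
        using d(2)[of u] d(2)[of v] mono[of u t] mono[of t v] local by auto
      then show "cdist (h u) (h v) \<le> M * (arclen X v - arclen X u)"
        using cdist_triangle[of "h u" "h v" "h t"] cdist_sym[of "h v" "h t"] by (simp add: algebra_simps)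
    qed (rule d(1))
  qed
  then show ?thesis by simp
qed

end

context qc_split begin

text \<open>The stretching of a vector of the first factor depends only on the first coordinate, and
  that of a vector of the second factor only on the second one; quasiconformality makes the two
  comparable, so both are bounded above and below.\<close>

lemma stretch_bounds:
  obtains w c C where "w \<in> V 1" "cnorm w = 1" "0 < c" "\<And>x. c \<le> cnorm (A x w)" "\<And>x. cnorm (A x w) \<le> C"
proof -
  have idx: "1 \<in> {1..m}" "2 \<in> {1..m}" using m2 by auto
  have unit: "\<exists>w. w \<in> V 1 \<and> w \<in> g k \<and> cnorm w = 1" if k: "k \<in> {1..m}" for k
  proof -
    obtain u where u: "u \<in> V 1" "u \<in> g k" "u \<noteq> 0" using g_horizontal[OF k] by blast
    then show ?thesis
      using subspace_scale[OF subspace_V1 u(1)] subspace_scale[OF subspace_g[OF k] u(2)] cnorm_pos[OF u(3)]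
      by (intro exI[of _ "(1 / cnorm u) *\<^sub>R u"]) (simp add: cnorm_V1_scale[OF u(1)])
  qed
  obtain v where v: "v \<in> V 1" "v \<in> g 1" "cnorm v = 1" using unit[OF idx(1)] by blast
  obtain w where w: "w \<in> V 1" "w \<in> g 2" "cnorm w = 1" using unit[OF idx(2)] by blast
  have nz: "v \<noteq> 0" "w \<noteq> 0" using v w by auto
  define \<beta> where "\<beta> = cnorm (A 0 w)"
  have "A 0 w \<noteq> 0" using regular_inj[OF regular w(1)] nz by blast
  then have \<beta>: "\<beta> > 0" unfolding \<beta>_def by (rule cnorm_pos)
  \<comment> \<open>The comparison is made at \<open>\<pi> 1 x\<close>, whose second coordinate is
    trivial: there the stretching of \<open>w\<close> is the fixed number \<open>\<beta>\<close>,
    while that of \<open>v\<close> is the same as at \<open>x\<close>.\<close>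
  have \<beta>x: "cnorm (A (\<pi> 1 x) w) = \<beta>" for x
    using A_component[OF idx(2) w(1,2), of "\<pi> 1 x"] \<pi>_self[OF idx(1) \<pi>_in[OF idx(1)], of 2 x] by (simp add: \<beta>_def)
  show thesis
  proof
    show "v \<in> V 1" "cnorm v = 1" using v by auto
    show "\<beta> / K > 0" using \<beta> K1 by simp
    fix x
    have "\<beta> \<le> K * cnorm (A (\<pi> 1 x) v)" unfolding \<beta>x[of x, symmetric]
      using v w nz by (intro cnorm_A_le) auto
    then show "\<beta> / K \<le> cnorm (A x v)"
      using K1 A_component[OF idx(1) v(1,2), of x] by (simp add: pos_divide_le_eq mult.commute)
    have "cnorm (A (\<pi> 1 x) v) \<le> K * cnorm (A (\<pi> 1 x) w)"
      using v w nz by (intro cnorm_A_le) auto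
    then show "cnorm (A x v) \<le> K * \<beta>"
      using A_component[OF idx(1) v(1,2), of x] \<beta>x[of x] by simp
  qed
qed

text \<open>The stretching of one fixed horizontal vector controls all increments, by the distortion
  inequality used in both directions. The lower bound is stated for every \<open>s\<close> up to the
  distance, so it also covers points far from \<open>p\<close>; this makes up for the unknown
  continuity of the inverse of \<open>f\<close>.\<close>

lemma local_lipschitz:
  obtains M where "M > 0"
    and "\<And>p. \<exists>r>0. (\<forall>x. cdist x p < r \<longrightarrow> cdist (f x) (f p) \<le> M * cdist x p) \<and>
      (\<forall>s x. 0 < s \<longrightarrow> s < r \<longrightarrow> s \<le> cdist x p \<longrightarrow> s \<le> M * cdist (f x) (f p))"
proof -
  obtain w c C where w: "w \<in> V 1" "cnorm w = 1" and c: "0 < c" "\<And>x. c \<le> cnorm (A x w)" "\<And>x. cnorm (A x w) \<le> C"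
    using stretch_bounds by metis
  have C: "C > 0" using c(1) c(2)[of 0] c(3)[of 0] by linarith
  \<comment> \<open>For small \<open>s\<close> the increment along \<open>s w\<close> has size
    between \<open>s * c / 2\<close> and \<open>2 * C * s\<close>; the factor \<open>K\<close> is
    the price of replacing \<open>s w\<close> by another point.\<close>
  define M where "M = max (2 * K * C) (2 * K / c)"
  have M: "M > 0" "2 * K * C \<le> M" "2 * K / c \<le> M" using K1 C c(1) by (auto simp: M_def less_max_iff_disj)
  show thesis
  proof
    show "M > 0" by (rule M(1))
    fix p
    obtain s0 where s0: "s0 > 0" "\<And>s x y. 0 < s \<Longrightarrow> s < s0 \<Longrightarrow> cnorm x \<le> s \<Longrightarrow> s \<le> cnorm y \<Longrightarrow>
      cnorm (incr p x) \<le> K * cnorm (incr p y)" using qc_incr by blast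
    have lim: "((\<lambda>s. cnorm (dil (1 / s) (incr p (s *\<^sub>R w)))) \<longlongrightarrow> cnorm (A p w)) (at_right 0)"
      by (intro tendsto_cnorm Pansu_V1_filter[OF w(1)] tendsto_const tendsto_ident_at eventually_at_right_less)
    have "c / 2 < cnorm (A p w)" "cnorm (A p w) < 2 * C" using c(1) c(2)[of p] c(3)[of p] C by linarith+
    then have "\<forall>\<^sub>F s in at_right 0. c / 2 < cnorm (dil (1 / s) (incr p (s *\<^sub>R w))) \<and>
        cnorm (dil (1 / s) (incr p (s *\<^sub>R w))) < 2 * C"
      by (intro eventually_conj order_tendstoD[OF lim])
    then obtain b where b: "b > 0" "\<And>s. 0 < s \<Longrightarrow> s < b \<Longrightarrow> c / 2 < cnorm (dil (1 / s) (incr p (s *\<^sub>R w))) \<and>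
        cnorm (dil (1 / s) (incr p (s *\<^sub>R w))) < 2 * C"
      unfolding eventually_at_right_field by auto
    have bs: "s * c \<le> 2 * cnorm (incr p (s *\<^sub>R w))" "cnorm (incr p (s *\<^sub>R w)) \<le> 2 * C * s" if "0 < s" "s < b" for s
      using b(2)[OF that] that(1) by (simp_all add: cnorm_dil field_simps)
    show "\<exists>r>0. (\<forall>x. cdist x p < r \<longrightarrow> cdist (f x) (f p) \<le> M * cdist x p) \<and>
      (\<forall>s x. 0 < s \<longrightarrow> s < r \<longrightarrow> s \<le> cdist x p \<longrightarrow> s \<le> M * cdist (f x) (f p))"
    proof (intro exI[of _ "min s0 b"] conjI allI impI)
      show "min s0 b > 0" using s0 b by simp
      fix x
      define y where "y = (- p) \<odot> x"
      have y: "x = p \<odot> y" by (simp add: y_def)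
      have cd: "cdist x p = cnorm y" "cdist (f x) (f p) = cnorm (incr p y)"
        unfolding y by (simp_all add: cdist_mul_self cdist_f)
      have cs: "cnorm (s *\<^sub>R w) = s" if "s > 0" for s using that w by (simp add: cnorm_V1_scale)
      show "cdist (f x) (f p) \<le> M * cdist x p" if lt: "cdist x p < min s0 b"
      proof (cases "y = 0")
        case False
        define s where "s = cnorm y"
        have s: "0 < s" "s < s0" "s < b" using False lt cnorm_pos by (auto simp: s_def cd)
        have "cnorm (incr p y) \<le> K * cnorm (incr p (s *\<^sub>R w))"
          using s cs by (intro s0(2)[of s]) (auto simp: s_def)
        also have "\<dots> \<le> K * (2 * C * s)" using bs(2)[OF s(1,3)] K1 by (intro mult_left_mono) auto
        also have "\<dots> = 2 * K * C * s" by simp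
        also have "\<dots> \<le> M * s" using M(2) s by (intro mult_right_mono) auto
        finally show ?thesis by (simp add: cd s_def)
      qed (simp add: cd)
      show "s \<le> M * cdist (f x) (f p)" if s: "0 < s" "s < min s0 b" "s \<le> cdist x p" for s
      proof -
        have "cnorm (incr p (s *\<^sub>R w)) \<le> K * cnorm (incr p y)"
          using s cs by (intro s0(2)[of s]) (auto simp: cd)
        then have "s * c \<le> 2 * K * cnorm (incr p y)" using bs(1)[of s] s by simp
        then have "s \<le> 2 * K / c * cnorm (incr p y)" using c(1) by (simp add: field_simps)
        also have "\<dots> \<le> M * cnorm (incr p y)" using M(3) cnorm_nonneg by (intro mult_right_mono)
        finally show ?thesis by (simp add: cd)
      qed
    qed
  qed
qed

lemma open_range_f: "open (range f)"
  by (rule invariance_of_domain[OF Ck_continuous[OF C1] open_UNIV inj])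

lemma f_bilipschitz:
  obtains M where "M > 0" "\<And>p q. cdist (f p) (f q) \<le> M * cdist p q" "\<And>p q. cdist p q \<le> M * cdist (f p) (f q)"
proof -
  obtain M where M: "M > 0" and loc: "\<And>p. \<exists>r>0. (\<forall>x. cdist x p < r \<longrightarrow> cdist (f x) (f p) \<le> M * cdist x p) \<and>
      (\<forall>s x. 0 < s \<longrightarrow> s < r \<longrightarrow> s \<le> cdist x p \<longrightarrow> s \<le> M * cdist (f x) (f p))"
    using local_lipschitz by metis
  have upper: "cdist (f (c 0)) (f (c 1)) \<le> M * arclen X 1" if h: "hcurve c X" for c X
  proof (rule lipschitz_along_curve[OF h, of 1 "\<lambda>t. f (c t)"])
    fix t :: real assume t: "0 \<le> t" "t \<le> 1"
    obtain r where r: "r > 0" "\<And>x. cdist x (c t) < r \<Longrightarrow> cdist (f x) (f (c t)) \<le> M * cdist x (c t)"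
      using loc[of "c t"] by blast
    obtain d where d: "d > 0" "\<And>t'. t' \<in> {0..1} \<Longrightarrow> \<bar>t' - t\<bar> < d \<Longrightarrow> \<bar>arclen X t' - arclen X t\<bar> < r"
      using arclen_near[OF h _ r(1), of t] t by auto
    have "cdist (f (c t')) (f (c t)) \<le> M * \<bar>arclen X t' - arclen X t\<bar>"
      if t': "0 \<le> t'" "t' \<le> 1" "\<bar>t' - t\<bar> < d" for t'
    proof -
      have le: "cdist (c t') (c t) \<le> \<bar>arclen X t' - arclen X t\<bar>"
        using t t' by (intro reach_cdist_subcurve[OF h]) auto
      then have "cdist (f (c t')) (f (c t)) \<le> M * cdist (c t') (c t)"
        using d(2)[of t'] t' by (intro r(2)) auto
      also have "\<dots> \<le> M * \<bar>arclen X t' - arclen X t\<bar>" using le M by (intro mult_left_mono) auto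
      finally show ?thesis .
    qed
    then show "\<exists>d>0. \<forall>t'. 0 \<le> t' \<longrightarrow> t' \<le> 1 \<longrightarrow> \<bar>t' - t\<bar> < d \<longrightarrow>
        cdist (f (c t')) (f (c t)) \<le> M * \<bar>arclen X t' - arclen X t\<bar>"
      using d(1) by blast
  qed auto
  define h where "h = inv_into UNIV f"
  have hf: "h (f x) = x" for x using inj by (simp add: h_def)
  have fh: "f (h y) = y" if "y \<in> range f" for y using that by (simp add: h_def f_inv_into_f)
  \<comment> \<open>Along a curve inside the range, the lower bound in \<open>loc\<close> acts as a
    local Lipschitz bound for the inverse. Continuity of the inverse is not presupposed: for values
    close enough, the bound at \<open>s = r / 2\<close> already forces the preimages to be
    close.\<close>
  have lift: "cdist (h (\<gamma> 0)) (h (\<gamma> b)) \<le> M * arclen X b"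
    if hc: "hcurve \<gamma> X" and b: "0 \<le> b" "b \<le> 1" and im: "\<And>t. 0 \<le> t \<Longrightarrow> t \<le> b \<Longrightarrow> \<gamma> t \<in> range f" for \<gamma> X b
  proof (rule lipschitz_along_curve[OF hc b, of "\<lambda>t. h (\<gamma> t)"])
    fix t :: real assume t: "0 \<le> t" "t \<le> b"
    obtain r where r: "r > 0" "\<And>s x. 0 < s \<Longrightarrow> s < r \<Longrightarrow> s \<le> cdist x (h (\<gamma> t)) \<Longrightarrow> s \<le> M * cdist (f x) (f (h (\<gamma> t)))"
      using loc[of "h (\<gamma> t)"] by blast
    have "r / 2 / M > 0" using r M by simp
    then obtain d where d: "d > 0" "\<And>t'. t' \<in> {0..1} \<Longrightarrow> \<bar>t' - t\<bar> < d \<Longrightarrow> \<bar>arclen X t' - arclen X t\<bar> < r / 2 / M"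
      using arclen_near[OF hc, of t "r / 2 / M"] t b by auto
    have "cdist (h (\<gamma> t')) (h (\<gamma> t)) \<le> M * \<bar>arclen X t' - arclen X t\<bar>"
      if t': "0 \<le> t'" "t' \<le> b" "\<bar>t' - t\<bar> < d" for t'
    proof -
      have "cdist (\<gamma> t') (\<gamma> t) \<le> \<bar>arclen X t' - arclen X t\<bar>"
        using t t' b by (intro reach_cdist_subcurve[OF hc]) auto
      then have le: "M * cdist (\<gamma> t') (\<gamma> t) \<le> M * \<bar>arclen X t' - arclen X t\<bar>"
        using M by (intro mult_left_mono) auto
      have "M * \<bar>arclen X t' - arclen X t\<bar> < M * (r / 2 / M)"
        using d(2)[of t'] t' b M by (intro mult_strict_left_mono) auto
      moreover have "M * (r / 2 / M) = r / 2" using M by simp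
      ultimately have lt: "M * cdist (\<gamma> t') (\<gamma> t) < r / 2" using le by linarith
      have s: "s \<le> M * cdist (\<gamma> t') (\<gamma> t)" if "0 < s" "s < r" "s \<le> cdist (h (\<gamma> t')) (h (\<gamma> t))" for s
        using r(2)[OF that] fh[OF im[OF t'(1,2)]] fh[OF im[OF t]] by simp
      have "cdist (h (\<gamma> t')) (h (\<gamma> t)) < r / 2" using s[of "r / 2"] lt r(1) by linarith
      then have "cdist (h (\<gamma> t')) (h (\<gamma> t)) \<le> M * cdist (\<gamma> t') (\<gamma> t)"
        using s[of "cdist (h (\<gamma> t')) (h (\<gamma> t))"] cdist_nonneg[of "h (\<gamma> t')" "h (\<gamma> t)"]
          cdist_nonneg[of "\<gamma> t'" "\<gamma> t"] M r(1) by (cases "cdist (h (\<gamma> t')) (h (\<gamma> t)) = 0") auto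
      then show ?thesis using le by linarith
    qed
    then show "\<exists>d>0. \<forall>t'. 0 \<le> t' \<longrightarrow> t' \<le> b \<longrightarrow> \<bar>t' - t\<bar> < d \<longrightarrow>
        cdist (h (\<gamma> t')) (h (\<gamma> t)) \<le> M * \<bar>arclen X t' - arclen X t\<bar>"
      using d(1) by blast
  qed
  \<comment> \<open>Up to the first time outside the open range, the lift stays in a bounded set by
    \<open>lift\<close>. The image of a closed ball is compact, hence closed, so the point reached
    at that time is a value of \<open>f\<close> after all.\<close>
  have in_range: "\<gamma> t \<in> range f" if hc: "hcurve \<gamma> X" and "\<gamma> 0 \<in> range f" and t: "0 \<le> t" "t \<le> 1" for \<gamma> X t
  proof (rule ccontr)
    assume nt: "\<gamma> t \<notin> range f"
    have cont: "continuous_on S \<gamma>" for S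
      using hc continuous_on_subset[OF Ck_continuous[OF smooth_Ck]] unfolding hcurve_def by blast
    define E where "E = {0..1} \<inter> \<gamma> -` (- range f)"
    have cl: "closed E" unfolding E_def
      using open_range_f by (intro continuous_closed_preimage cont) auto
    have ne: "E \<noteq> {}" "bdd_below E" using t nt by (auto simp: E_def)
    define t0 where "t0 = Inf E"
    have t0: "t0 \<in> E" unfolding t0_def by (rule closed_contains_Inf[OF ne cl])
    then have t0b: "0 < t0" "t0 \<le> 1" using \<open>\<gamma> 0 \<in> range f\<close> by (cases "t0 = 0"; auto simp: E_def)+
    have before: "\<gamma> s \<in> range f" if "0 \<le> s" "s < t0" for s
    proof (rule ccontr)
      assume "\<gamma> s \<notin> range f"
      then have "s \<in> E" using that t0b by (auto simp: E_def)
      then have "t0 \<le> s" unfolding t0_def using ne(2) by (rule cInf_lower)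
      then show False using that by simp
    qed
    define p where "p = h (\<gamma> 0)"
    obtain R where R: "\<And>x. cnorm x \<le> M * arclen X 1 \<Longrightarrow> norm x \<le> R" using bounded_cnorm by blast
    obtain R' where R': "\<And>x y. norm x \<le> norm p \<Longrightarrow> norm y \<le> R \<Longrightarrow> norm (x \<odot> y) \<le> R'" using mul_bounded by blast
    have inB: "\<gamma> s \<in> f ` cball 0 R'" if s: "0 \<le> s" "s < t0" for s
    proof -
      have "cdist p (h (\<gamma> s)) \<le> M * arclen X s"
        unfolding p_def using s t0b before by (intro lift[OF hc]) auto
      also have "\<dots> \<le> M * arclen X 1"
        using reach_nonneg[OF reach_subcurve[OF hc, of s 1]] s t0b M by (intro mult_left_mono) auto
      finally have "norm (p \<odot> ((- p) \<odot> h (\<gamma> s))) \<le> R'" by (intro R' R) (simp_all add: cdist_cnorm)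
      then have "h (\<gamma> s) \<in> cball 0 R'" by simp
      then show ?thesis using fh[OF before[OF s]] by (metis imageI)
    qed
    have "closed (f ` cball 0 R')"
      by (intro compact_imp_closed compact_continuous_image continuous_on_f continuous_on_id compact_cball)
    moreover have "(\<gamma> \<longlongrightarrow> \<gamma> t0) (at_left t0)"
      using cont[of UNIV] filterlim_at_split unfolding continuous_on_def by auto
    moreover have "\<forall>\<^sub>F s in at_left t0. \<gamma> s \<in> f ` cball 0 R'"
      using eventually_at_left_real[OF t0b(1)] by eventually_elim (use inB in auto)
    ultimately have "\<gamma> t0 \<in> f ` cball 0 R'" by (intro Lim_in_closed_set) auto
    then show False using t0 by (auto simp: E_def)
  qed
  show thesis
  proof
    show "M > 0" by (rule M)
    fix p q
    show "cdist (f p) (f q) \<le> M * cdist p q"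
    proof (rule field_le_epsilon)
      fix e :: real assume e: "e > 0"
      obtain L where L: "reach p q L" "L < cdist p q + e / M" using cdist_lessD[of p q "cdist p q + e / M"] e M by auto
      then obtain c X where cX: "hcurve c X" "c 0 = p" "c 1 = q" "L = arclen X 1" by (auto simp: reach_def)
      have "cdist (f p) (f q) \<le> M * L" using upper[OF cX(1)] cX by simp
      also have "\<dots> \<le> M * (cdist p q + e / M)" using L(2) M by (intro mult_left_mono) auto
      also have "\<dots> = M * cdist p q + e" using M by (simp add: algebra_simps)
      finally show "cdist (f p) (f q) \<le> M * cdist p q + e" .
    qed
    show "cdist p q \<le> M * cdist (f p) (f q)"
    proof (rule field_le_epsilon)
      fix e :: real assume e: "e > 0"
      obtain L where L: "reach (f p) (f q) L" "L < cdist (f p) (f q) + e / M"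
        using cdist_lessD[of "f p" "f q" "cdist (f p) (f q) + e / M"] e M by auto
      then obtain c X where cX: "hcurve c X" "c 0 = f p" "c 1 = f q" "L = arclen X 1" by (auto simp: reach_def)
      have "cdist (h (c 0)) (h (c 1)) \<le> M * arclen X 1"
        using in_range[OF cX(1)] cX(2) by (intro lift[OF cX(1)]) auto
      then have "cdist p q \<le> M * L" using cX by (simp add: hf)
      also have "\<dots> \<le> M * (cdist (f p) (f q) + e / M)" using L(2) M by (intro mult_left_mono) auto
      also have "\<dots> = M * cdist (f p) (f q) + e" using M by (simp add: algebra_simps)
      finally show "cdist p q \<le> M * cdist (f p) (f q) + e" .
    qed
  qed
qed

section \<open>The automorphism split off from the map\<close>

text \<open>The base point \<open>0\<close> is a mere choice, as the permutation is the same at all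
  points.\<close>

definition \<phi> :: "'a \<Rightarrow> 'a" where "\<phi> = pansu 0"
definition \<psi> :: "'a \<Rightarrow> 'a" where "\<psi> = inv_into UNIV \<phi>"

lemma \<phi>\<psi> [simp]: "\<phi> (\<psi> x) = x" "\<psi> (\<phi> x) = x"
  using regular_bij_pansu[OF regular, of 0]
  by (simp_all add: \<psi>_def \<phi>_def bij_is_surj bij_is_inj surj_f_inv_f)

lemma linear_\<phi>: "linear \<phi>"
  unfolding \<phi>_def by (rule linear_pansu)

lemma linear_\<psi>: "linear \<psi>"
proof (rule linearI)
  fix x y :: 'a and r :: real
  show "\<psi> (x + y) = \<psi> x + \<psi> y" using \<phi>\<psi>(2)[of "\<psi> x + \<psi> y"] by (simp add: linear_add[OF linear_\<phi>] \<phi>\<psi>(1))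
  show "\<psi> (r *\<^sub>R x) = r *\<^sub>R \<psi> x" using \<phi>\<psi>(2)[of "r *\<^sub>R \<psi> x"] by (simp add: linear_cmul[OF linear_\<phi>] \<phi>\<psi>(1))
qed

lemma \<phi>_mul: "\<phi> (x \<odot> y) = \<phi> x \<odot> \<phi> y"
  unfolding \<phi>_def by (rule pansu_mul)

lemma \<psi>_mul: "\<psi> (x \<odot> y) = \<psi> x \<odot> \<psi> y"
  using \<phi>\<psi>(2)[of "\<psi> x \<odot> \<psi> y"] by (simp add: \<phi>_mul \<phi>\<psi>(1))

lemma \<phi>_dil: "\<phi> (dil s x) = dil s (\<phi> x)"
  unfolding \<phi>_def by (rule pansu_dil)

lemma \<psi>_dil: "\<psi> (dil s x) = dil s (\<psi> x)"
  using \<phi>\<psi>(2)[of "dil s (\<psi> x)"] by (simp add: \<phi>_dil \<phi>\<psi>(1))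

text \<open>By left invariance of the distance a bound for \<open>cnorm\<close> suffices, and
  homogeneity provides it.\<close>

lemma hom_lipschitz:
  assumes "linear \<rho>" "\<And>x y. \<rho> (x \<odot> y) = \<rho> x \<odot> \<rho> y" "\<And>s x. \<rho> (dil s x) = dil s (\<rho> x)"
  obtains M where "M > 0" "\<And>p q. cdist (\<rho> p) (\<rho> q) \<le> M * cdist p q"
proof -
  have "continuous_on UNIV \<rho>"
    using assms(1) linear_continuous_on linear_conv_bounded_linear by blast
  then obtain M where M: "M > 0" "\<And>x. cnorm (\<rho> x) \<le> M * cnorm x"
    using homogeneous_cnorm_bound[of \<rho>] assms(3) linear_0[OF assms(1)] by metis
  have "cdist (\<rho> p) (\<rho> q) \<le> M * cdist p q" for p q
    using M(2)[of "(- p) \<odot> q"] by (simp add: cdist_cnorm assms(2) linear_neg[OF assms(1)])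
  then show thesis using M(1) that by blast
qed

text \<open>\<open>\<psi>\<close> carries the factor \<open>\<sigma> 0 k\<close> back to the factor
  \<open>k\<close>, so the splitting of \<open>f\<close> into permuted components becomes one
  without permutation.\<close>

lemma \<pi>_\<psi>_f:
  assumes k: "k \<in> {1..m}" shows "\<pi> k (\<psi> (f x)) = \<pi> k (\<psi> (f (\<pi> k x)))"
proof -
  have k': "\<sigma> 0 k \<in> {1..m}" using \<sigma>_in[OF regular k] .
  have c: "\<pi> k (\<psi> y) = \<psi> (\<pi> (\<sigma> 0 k) y)" for y
  proof -
    have "y = \<phi> (\<Sum>i\<in>{1..m}. \<pi> i (\<psi> y))" by (simp only: sum_\<pi> \<phi>\<psi>)
    also have "\<dots> = (\<Sum>i\<in>{1..m}. \<phi> (\<pi> i (\<psi> y)))" by (rule linear_sum[OF linear_\<phi>])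
    finally have y: "y = (\<Sum>i\<in>{1..m}. \<phi> (\<pi> i (\<psi> y)))" .
    have mem: "\<phi> (\<pi> i (\<psi> y)) \<in> g (\<sigma> 0 i)" if "i \<in> {1..m}" for i
      using \<sigma>(2)[OF regular that, of 0] \<pi>_in[OF that] unfolding \<phi>_def by blast
    have "\<pi> (\<sigma> 0 k) y = (\<Sum>i\<in>{1..m}. \<pi> (\<sigma> 0 k) (\<phi> (\<pi> i (\<psi> y))))"
      by (subst (1) y) (rule linear_sum[OF linear_\<pi>])
    also have "\<dots> = (\<Sum>i\<in>{1..m}. if k = i then \<phi> (\<pi> i (\<psi> y)) else 0)"
    proof (rule sum.cong)
      fix i assume i: "i \<in> {1..m}"
      show "\<pi> (\<sigma> 0 k) (\<phi> (\<pi> i (\<psi> y))) = (if k = i then \<phi> (\<pi> i (\<psi> y)) else 0)"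
        using \<pi>_self[OF \<sigma>_in[OF regular i] mem[OF i], of "\<sigma> 0 k"] \<sigma>_inj[OF regular, of 0 k i] by auto
    qed simp
    also have "\<dots> = \<phi> (\<pi> k (\<psi> y))" using k by simp
    finally show ?thesis by simp
  qed
  show ?thesis using f_component[OF k, of x] by (simp add: c)
qed

end

section \<open>From the group to its exponential chart\<close>

locale lie_exp =
  fixes G :: "'g monoid" and ex :: "'a::euclidean_space \<Rightarrow> 'g" and br :: "'a \<Rightarrow> 'a \<Rightarrow> 'a"
  assumes lie: "lie_group_exp G ex br"
begin

sublocale G: group G
  using lie by (simp add: lie_group_exp_def)

definition gmul :: "'a \<Rightarrow> 'a \<Rightarrow> 'a" where "gmul x y = glog ex (ex x \<otimes>\<^bsub>G\<^esub> ex y)"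

lemma bij_ex: "bij_betw ex UNIV (carrier G)"
  using lie by (simp add: lie_group_exp_def)

lemma ex_in [simp]: "ex x \<in> carrier G"
  using bij_ex by (auto simp: bij_betw_def)

lemma glog_ex [simp]: "glog ex (ex x) = x"
  using bij_ex by (simp add: glog_def bij_betw_def)

lemma ex_glog [simp]: "p \<in> carrier G \<Longrightarrow> ex (glog ex p) = p"
  using bij_ex by (simp add: glog_def bij_betw_def f_inv_into_f)

lemma ex_gmul: "ex (gmul x y) = ex x \<otimes>\<^bsub>G\<^esub> ex y"
  by (simp add: gmul_def)

sublocale exp_chart gmul
proof
  show "gmul (gmul x y) z = gmul x (gmul y z)" for x y z
    by (simp add: gmul_def G.m_assoc)
  show "(s + t) *\<^sub>R x = gmul (s *\<^sub>R x) (t *\<^sub>R x)" for s t x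
    using lie glog_ex[of "(s + t) *\<^sub>R x"] unfolding gmul_def lie_group_exp_def by metis
  show "smooth (\<lambda>(x, y). gmul x y)"
    using lie by (simp add: gmul_def lie_group_exp_def)
qed

lemma left_translate_eq:
  assumes "p \<in> carrier G" shows "left_translate G ex p y = lin (glog ex p) y"
proof -
  have "((\<lambda>t. gmul (glog ex p) (t *\<^sub>R y)) has_vector_derivative lin (glog ex p) y) (at 0)"
    using has_lvel_mul_left[OF has_lvel_ray, of "glog ex p" y 0] by (simp add: has_lvel_def)
  from vector_derivative_at[OF this] show ?thesis
    using assms by (simp add: left_translate_def gmul_def)
qed

text \<open>In the chart the left-invariant field of \<open>v\<close> is \<open>lin p v\<close>, the
  derivative of the product in its right factor; differentiating it in \<open>p\<close> gives
  \<open>D2mul\<close>.\<close>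

lemma lbr_eq: "lbr = br"
proof (intro ext)
  fix x y
  have D: "((\<lambda>p. left_translate G ex (ex p) v) has_derivative (\<lambda>u. D2mul (0, 0) u v)) (at 0)" for v
  proof -
    have "((\<lambda>p. (p, 0)) has_derivative (\<lambda>u. (u, 0))) (at 0)" by (auto intro!: derivative_eq_intros)
    from has_derivative_compose[OF this Dmul_has_derivative[of "(0, v)"]]
    show ?thesis by (simp add: left_translate_eq lin_def D2mul_def)
  qed
  have "br x y = frechet_derivative (\<lambda>p. left_translate G ex (ex p) y) (at 0) x -
      frechet_derivative (\<lambda>p. left_translate G ex (ex p) x) (at 0) y"
    using lie unfolding lie_group_exp_def by blast
  then show "lbr x y = br x y"
    by (simp add: frechet_derivative_at[OF D, symmetric] lbr_def)
qed

end

locale carnot_exp = lie_exp G ex br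
  for G :: "'g monoid" and ex :: "'a::euclidean_space \<Rightarrow> 'g" and br +
  fixes V :: "nat \<Rightarrow> 'a set" and l :: nat
  assumes st: "stratified_algebra br UNIV V l"
begin

sublocale stratified_chart gmul V l
  by unfold_locales (simp add: lbr_eq st)

lemma horizontal_curve_iff:
  "horizontal_curve G ex V \<gamma> X \<longleftrightarrow> (\<forall>t. \<gamma> t \<in> carrier G) \<and> hcurve (glog ex \<circ> \<gamma>) X"
proof (cases "\<forall>t. \<gamma> t \<in> carrier G")
  case True
  then show ?thesis by (auto simp: horizontal_curve_def hcurve_def has_lvel_def left_translate_eq)
qed (auto simp only: horizontal_curve_def)

text \<open>\<open>ex\<close> and \<open>glog ex\<close> carry the horizontal curves of the group
  and of the chart into each other with the same field \<open>X\<close>, hence with the same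
  length.\<close>

lemma carnot_dist_eq:
  assumes "p \<in> carrier G" "q \<in> carrier G"
  shows "carnot_dist G ex V p q = cdist (glog ex p) (glog ex q)"
proof -
  have "{integral {0..1} (\<lambda>t. norm (X t)) | \<gamma> X. horizontal_curve G ex V \<gamma> X \<and> \<gamma> 0 = p \<and> \<gamma> 1 = q}
      = {L. reach (glog ex p) (glog ex q) L}" (is "?A = ?B")
  proof (intro equalityI subsetI)
    fix L assume "L \<in> ?A"
    then obtain \<gamma> X where "L = integral {0..1} (\<lambda>t. norm (X t))" "horizontal_curve G ex V \<gamma> X" "\<gamma> 0 = p" "\<gamma> 1 = q"
      by blast
    then show "L \<in> ?B"
      unfolding reach_def horizontal_curve_iff
      by (intro CollectI exI[of _ "glog ex \<circ> \<gamma>"] exI[of _ X]) (auto simp: arclen_def)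
  next
    fix L assume "L \<in> ?B"
    then obtain c X where c: "hcurve c X" "c 0 = glog ex p" "c 1 = glog ex q" "L = arclen X 1"
      by (auto simp: reach_def)
    have "glog ex \<circ> (ex \<circ> c) = c" by (simp add: fun_eq_iff)
    then have "horizontal_curve G ex V (ex \<circ> c) X" using c(1) by (simp add: horizontal_curve_iff)
    then show "L \<in> ?A" using c assms
      by (intro CollectI exI[of _ X] exI[of _ "ex \<circ> c"]) (auto simp: arclen_def)
  qed
  then show ?thesis by (simp add: carnot_dist_def cdist_def)
qed

lemma tuple_eq_prodl: "tuple G m (\<lambda>j. ex (u j)) = ex (prodl (map u [1..<Suc m]))"
proof -
  \<comment> \<open>\<open>ex 0\<close> is idempotent, hence neutral.\<close>
  have "ex 0 = \<one>\<^bsub>G\<^esub>"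
    using ex_gmul[of 0 0] G.l_cancel_one'[of "ex 0" "ex 0"] by simp
  then have "foldr (\<lambda>j q. ex (u j) \<otimes>\<^bsub>G\<^esub> q) js \<one>\<^bsub>G\<^esub> = ex (prodl (map u js))" for js
    by (induction js) (simp_all add: ex_gmul)
  then show ?thesis by (simp add: tuple_def)
qed

end

section \<open>From the distortion quotient to inequalities between distances\<close>

text \<open>For infinite \<open>b\<close> the right-hand side is infinite, since
  \<open>a / b < c\<close> excludes \<open>c = 0\<close>.\<close>

lemma ennreal_le_mult_if_divide_less:
  fixes a b c :: ennreal
  assumes "b \<noteq> 0" "a / b < c" shows "a \<le> c * b"
proof (cases "b = \<infinity>")
  case True
  have "c \<noteq> 0" using assms(2) by auto
  then show ?thesis using True by (simp add: ennreal_mult_top infinity_ennreal_def)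
next
  case False
  have "a = a / b * b"
    using mult_divide_eq_ennreal[OF assms(1) False[unfolded infinity_ennreal_def], of a] by (simp add: divide_ennreal_def mult_ac)
  also have "\<dots> \<le> c * b" using assms(2) by (intro mult_right_mono) auto
  finally show ?thesis .
qed

text \<open>The quotient condition at small scales is turned into inequalities between distances;
  the constant grows by \<open>1\<close> to absorb the upper limit.\<close>

lemma quasiconformal_withD:
  assumes "quasiconformal_with G ex V K \<Omega> f" "p \<in> \<Omega>" "K \<ge> 1"
    and nn: "\<And>x y. x \<in> \<Omega> \<Longrightarrow> y \<in> \<Omega> \<Longrightarrow> 0 \<le> carnot_dist G ex V (f x) (f y)"
  obtains s0 where "s0 > 0"
    and "\<And>s x y. 0 < s \<Longrightarrow> s < s0 \<Longrightarrow> x \<in> \<Omega> \<Longrightarrow> y \<in> \<Omega> \<Longrightarrow> carnot_dist G ex V x p \<le> s \<Longrightarrow> s \<le> carnot_dist G ex V y p \<Longrightarrow>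
      carnot_dist G ex V (f x) (f p) \<le> (K + 1) * carnot_dist G ex V (f y) (f p)"
    and "\<And>s y. 0 < s \<Longrightarrow> s < s0 \<Longrightarrow> y \<in> \<Omega> \<Longrightarrow> s \<le> carnot_dist G ex V y p \<Longrightarrow> carnot_dist G ex V (f y) (f p) \<noteq> 0"
proof -
  let ?d = "carnot_dist G ex V"
  have "Limsup (at_right 0) (distortion G ex V \<Omega> f p) \<le> ennreal K"
    using assms(1,2) by (simp add: quasiconformal_with_def)
  also have "\<dots> < ennreal (K + 1)" using assms(3) by (simp add: ennreal_less_iff)
  finally have "\<forall>\<^sub>F s in at_right 0. distortion G ex V \<Omega> f p s < ennreal (K + 1)" by (rule Limsup_lessD)
  then obtain s0 where s0: "s0 > 0" "\<And>s. 0 < s \<Longrightarrow> s < s0 \<Longrightarrow> distortion G ex V \<Omega> f p s < ennreal (K + 1)"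
    unfolding eventually_at_right_field by auto
  define a where "a s = (SUP x\<in>{x \<in> \<Omega>. ?d x p \<le> s}. ennreal (?d (f x) (f p)))" for s
  define b where "b s = (INF x\<in>{x \<in> \<Omega>. ?d x p \<ge> s}. ennreal (?d (f x) (f p)))" for s
  have D: "distortion G ex V \<Omega> f p s = (if b s = 0 then \<infinity> else a s / b s)" for s
    by (simp add: distortion_def a_def b_def Let_def)
  \<comment> \<open>Finite distortion excludes the branch with value infinity, so the infimum is not
    zero.\<close>
  have b0: "b s \<noteq> 0" and ab: "a s \<le> ennreal (K + 1) * b s" if "0 < s" "s < s0" for s
  proof -
    show "b s \<noteq> 0" using s0(2)[OF that] by (auto simp: D)
    then show "a s \<le> ennreal (K + 1) * b s"
      using s0(2)[OF that] by (intro ennreal_le_mult_if_divide_less) (auto simp: D)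
  qed
  have b_le: "b s \<le> ennreal (?d (f y) (f p))" if "y \<in> \<Omega>" "s \<le> ?d y p" for s y
    unfolding b_def using that by (intro INF_lower) auto
  show thesis
  proof
    show "s0 > 0" by (rule s0(1))
    fix s y assume s: "0 < s" "s < s0" and y: "y \<in> \<Omega>" "s \<le> ?d y p"
    show "?d (f y) (f p) \<noteq> 0" using b_le[OF y] b0[OF s] by auto
    fix x assume x: "x \<in> \<Omega>" "?d x p \<le> s"
    have "ennreal (?d (f x) (f p)) \<le> a s" unfolding a_def using x by (intro SUP_upper) auto
    also have "\<dots> \<le> ennreal (K + 1) * b s" by (rule ab[OF s])
    also have "\<dots> \<le> ennreal (K + 1) * ennreal (?d (f y) (f p))" by (intro mult_left_mono b_le[OF y]) simp
    also have "\<dots> = ennreal ((K + 1) * ?d (f y) (f p))"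
      using assms(3) nn[OF y(1) assms(2)] by (simp add: ennreal_mult)
    finally show "?d (f x) (f p) \<le> (K + 1) * ?d (f y) (f p)"
      using assms(3) nn[OF y(1) assms(2)] by (simp add: ennreal_le_iff)
  qed
qed

theorem theorem5p1:
  fixes G :: "'g monoid"
    and ex :: "'a::euclidean_space \<Rightarrow> 'g"
    and br :: "'a \<Rightarrow> 'a \<Rightarrow> 'a"
    and V :: "nat \<Rightarrow> 'a set"
    and l m :: nat
    and g :: "nat \<Rightarrow> 'a set"
    and f :: "'g \<Rightarrow> 'g"
  assumes "carnot_group G ex br V l"
    and "totally_nonabelian br UNIV V"
    and "finest_decomposition br V l m g"
    and "m > 1"
    and "f \<in> carrier G \<rightarrow> carrier G"
    and "C1_map ex f"
    and "quasiconformal G ex V (carrier G) f"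
  shows "\<exists>T \<sigma> F fs.
           T \<in> aut_dilation G ex V l \<and>
           \<sigma> permutes {1..m} \<and>
           (\<forall>j\<in>{1..m}. T ` (ex ` g j) = ex ` g (\<sigma> j)) \<and>
           (\<forall>j\<in>{1..m}. fs j \<in> ex ` g j \<rightarrow> ex ` g j) \<and>
           (\<forall>p. (\<forall>j\<in>{1..m}. p j \<in> ex ` g j) \<longrightarrow>
                F (tuple G m p) = tuple G m (\<lambda>j. fs j (p j))) \<and>
           bi_lipschitz G ex V F \<and>
           (\<forall>p\<in>carrier G. f p = T (F p))"
proof -
  interpret carnot_exp G ex br V l
    using assms(1) by unfold_locales (auto simp: carnot_group_def)
  define f' where "f' = glog ex \<circ> f \<circ> ex"
  have fc: "f p \<in> carrier G" if "p \<in> carrier G" for p using assms(5) that by auto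
  have ff': "ex (f' x) = f (ex x)" for x by (simp add: f'_def fc)
  have dist_ex: "carnot_dist G ex V (ex x) (ex y) = cdist x y" for x y
    by (simp add: carnot_dist_eq)
  have dist_f: "carnot_dist G ex V (f (ex x)) (f (ex y)) = cdist (f' x) (f' y)" for x y
    unfolding ff'[symmetric] by (rule dist_ex)
  obtain K where K: "K \<ge> 1" "quasiconformal_with G ex V K (carrier G) f"
    using assms(7) by (auto simp: quasiconformal_def)
  have nn: "0 \<le> carnot_dist G ex V (f x) (f y)" if "x \<in> carrier G" "y \<in> carrier G" for x y
    using fc[OF that(1)] fc[OF that(2)] by (simp add: carnot_dist_eq cdist_nonneg)
  \<comment> \<open>The second part records that the denominator does not vanish; it yields the
    injectivity of \<open>f'\<close>.\<close>
  have qc: "\<exists>s0>0. (\<forall>s x y. 0 < s \<longrightarrow> s < s0 \<longrightarrow> cdist x p \<le> s \<longrightarrow> s \<le> cdist y p \<longrightarrow>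
      cdist (f' x) (f' p) \<le> (K + 1) * cdist (f' y) (f' p)) \<and>
      (\<forall>s y. 0 < s \<longrightarrow> s < s0 \<longrightarrow> s \<le> cdist y p \<longrightarrow> cdist (f' y) (f' p) \<noteq> 0)" for p
  proof -
    obtain s0 where s0: "s0 > 0"
      "\<And>s x y. 0 < s \<Longrightarrow> s < s0 \<Longrightarrow> x \<in> carrier G \<Longrightarrow> y \<in> carrier G \<Longrightarrow>
        carnot_dist G ex V x (ex p) \<le> s \<Longrightarrow> s \<le> carnot_dist G ex V y (ex p) \<Longrightarrow>
        carnot_dist G ex V (f x) (f (ex p)) \<le> (K + 1) * carnot_dist G ex V (f y) (f (ex p))"
      "\<And>s y. 0 < s \<Longrightarrow> s < s0 \<Longrightarrow> y \<in> carrier G \<Longrightarrow> s \<le> carnot_dist G ex V y (ex p) \<Longrightarrow>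
        carnot_dist G ex V (f y) (f (ex p)) \<noteq> 0"
      by (rule quasiconformal_withD[OF K(2) ex_in[of p] K(1) nn], assumption, assumption, rule that)
    show ?thesis
    proof (intro exI[of _ s0] conjI allI impI)
      fix s x y assume "0 < s" "s < s0" "cdist x p \<le> s" "s \<le> cdist y p"
      then show "cdist (f' x) (f' p) \<le> (K + 1) * cdist (f' y) (f' p)"
        using s0(2)[of s "ex x" "ex y"] by (simp add: dist_ex dist_f)
    next
      fix s y assume "0 < s" "s < s0" "s \<le> cdist y p"
      then show "cdist (f' y) (f' p) \<noteq> 0"
        using s0(3)[of s "ex y"] by (simp add: dist_ex dist_f)
    qed (rule s0(1))
  qed
  have "inj f'"
  proof (rule injI, rule ccontr)
    fix x y assume eq: "f' x = f' y" and "x \<noteq> y"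
    then have "cdist y x > 0" using cdist_eq_0_iff[of y x] cdist_nonneg[of y x] by auto
    obtain s0 where s0: "s0 > 0" "\<And>s z. 0 < s \<Longrightarrow> s < s0 \<Longrightarrow> s \<le> cdist z x \<Longrightarrow> cdist (f' z) (f' x) \<noteq> 0"
      using qc[of x] by blast
    \<comment> \<open>Any small scale up to the distance of the two points will do: \<open>y\<close>
      then takes part in the infimum, which is positive.\<close>
    define s where "s = min (s0 / 2) (cdist y x)"
    have "0 < s" "s < s0" "s \<le> cdist y x" using s0(1) \<open>cdist y x > 0\<close> by (auto simp: s_def)
    from s0(2)[OF this] show False using eq by simp
  qed
  interpret S: qc_split gmul V l f' "K + 1" m g
  proof unfold_locales
    show "Ck 1 f'" using assms(6) by (simp add: C1_map_def f'_def)
    show "1 \<le> K + 1" using K(1) by simp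
    show "\<exists>s0>0. \<forall>s x y. 0 < s \<longrightarrow> s < s0 \<longrightarrow> cdist x p \<le> s \<longrightarrow> s \<le> cdist y p \<longrightarrow>
      cdist (f' x) (f' p) \<le> (K + 1) * cdist (f' y) (f' p)" for p
      using qc[of p] by blast
    show "inj f'" by fact
    show "finest_decomposition lbr V l m g" using assms(3) by (simp add: lbr_eq)
    show "m > 1" by fact
  qed
  \<comment> \<open>\<open>T\<close> is the Pansu differential at \<open>0\<close> transported to
    the group, \<open>F\<close> is \<open>f\<close> followed by the inverse of \<open>T\<close>, and
    \<open>fs j\<close> is the component of \<open>F\<close> in the factor \<open>j\<close>.\<close>
  define T where "T p = ex (S.\<phi> (glog ex p))" for p
  define F where "F p = ex (S.\<psi> (f' (glog ex p)))" for p
  define fs where "fs j p = ex (S.\<pi> j (S.\<psi> (f' (glog ex p))))" for j p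
  have bij: "bij_betw T (carrier G) (carrier G)"
    by (rule bij_betw_byWitness[where f' = "\<lambda>p. ex (S.\<psi> (glog ex p))"]) (auto simp: T_def)
  have Tinv: "inv_into (carrier G) T (ex x) = ex (S.\<psi> x)" for x
    using bij by (intro inv_into_f_eq) (auto simp: T_def bij_betw_def)
  have T: "T \<in> aut_dilation G ex V l"
    unfolding aut_dilation_def
  proof (intro CollectI conjI allI ballI impI)
    have "T \<in> hom G G"
    proof (rule homI)
      show "T p \<in> carrier G" for p by (simp add: T_def)
      fix p q assume pq: "p \<in> carrier G" "q \<in> carrier G"
      have "glog ex (p \<otimes>\<^bsub>G\<^esub> q) = gmul (glog ex p) (glog ex q)" using pq by (simp add: gmul_def)
      then show "T (p \<otimes>\<^bsub>G\<^esub> q) = T p \<otimes>\<^bsub>G\<^esub> T q" by (simp add: T_def S.\<phi>_mul ex_gmul)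
    qed
    then show "T \<in> iso G G" using bij by (simp add: iso_def)
    have \<phi>: "glog ex \<circ> T \<circ> ex = S.\<phi>" by (rule ext) (simp add: T_def)
    show "smooth (glog ex \<circ> T \<circ> ex)"
      unfolding \<phi> using S.linear_\<phi> linear_conv_bounded_linear by (intro smooth_linear) blast
    have \<psi>: "glog ex \<circ> inv_into (carrier G) T \<circ> ex = S.\<psi>" by (rule ext) (simp add: Tinv)
    show "smooth (glog ex \<circ> inv_into (carrier G) T \<circ> ex)"
      unfolding \<psi> using S.linear_\<psi> linear_conv_bounded_linear by (intro smooth_linear) blast
    show "T (group_dilation ex V l s p) = group_dilation ex V l s (T p)" for s p
      by (simp add: group_dilation_def dilation_eq_dil T_def S.\<phi>_dil)
  qed
  have TF: "f p = T (F p)" if "p \<in> carrier G" for p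
    using that by (simp add: T_def F_def ff')
  have Tg: "T ` (ex ` g j) = ex ` g (S.\<sigma> 0 j)" if "j \<in> {1..m}" for j
  proof -
    have "T ` (ex ` g j) = ex ` (S.\<phi> ` g j)" by (simp only: image_image T_def glog_ex)
    also have "S.\<phi> ` g j = g (S.\<sigma> 0 j)" unfolding S.\<phi>_def by (rule S.\<sigma>(2)[OF S.regular that])
    finally show ?thesis .
  qed
  have fs: "fs j \<in> ex ` g j \<rightarrow> ex ` g j" if "j \<in> {1..m}" for j
    using S.\<pi>_in[OF that] by (auto simp: fs_def)
  have Ft: "F (tuple G m p) = tuple G m (\<lambda>j. fs j (p j))" if p: "\<forall>j\<in>{1..m}. p j \<in> ex ` g j" for p
  proof -
    define u where "u j = glog ex (p j)" for j
    have u: "u j \<in> g j" "p j = ex (u j)" if j: "j \<in> {1..m}" for j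
    proof -
      obtain v where "v \<in> g j" "p j = ex v" using p j by blast
      then show "u j \<in> g j" "p j = ex (u j)" by (simp_all add: u_def)
    qed
    have cong: "tuple G m p = tuple G m q" if "\<And>j. j \<in> {1..m} \<Longrightarrow> p j = q j" for p q :: "nat \<Rightarrow> 'g"
      unfolding tuple_def using that by (intro foldr_cong) auto
    have tup: "tuple G m (\<lambda>j. ex (v j)) = ex (\<Sum>j\<in>{1..m}. v j)" if "\<And>j. j \<in> {1..m} \<Longrightarrow> v j \<in> g j" for v
    proof -
      have "set [1..<Suc m] = {1..m}" by auto
      then show ?thesis
        using S.prodl_commuting[of "[1..<Suc m]" v] that by (simp only: tuple_eq_prodl) (simp add: atLeastLessThanSuc_atLeastAtMost)
    qed
    let ?s = "\<Sum>j\<in>{1..m}. u j"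
    have "tuple G m p = tuple G m (\<lambda>j. ex (u j))" by (rule cong) (rule u(2))
    also have "\<dots> = ex ?s" by (rule tup) (rule u(1))
    finally have "F (tuple G m p) = ex (S.\<psi> (f' ?s))" by (simp add: F_def)
    also have "S.\<psi> (f' ?s) = (\<Sum>j\<in>{1..m}. S.\<pi> j (S.\<psi> (f' ?s)))" by (rule S.sum_\<pi>[symmetric])
    \<comment> \<open>By \<open>S.\<pi>_\<psi>_f\<close> each component depends on the coordinate in
      its own factor alone.\<close>
    also have "\<dots> = (\<Sum>j\<in>{1..m}. S.\<pi> j (S.\<psi> (f' (u j))))"
    proof (rule sum.cong[OF refl])
      fix j assume j: "j \<in> {1..m}"
      have "S.\<pi> j ?s = u j" by (rule S.\<pi>_eqI[OF u(1) refl j])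
      then show "S.\<pi> j (S.\<psi> (f' ?s)) = S.\<pi> j (S.\<psi> (f' (u j)))" using S.\<pi>_\<psi>_f[OF j, of ?s] by simp
    qed
    also have "ex \<dots> = tuple G m (\<lambda>j. ex (S.\<pi> j (S.\<psi> (f' (u j)))))"
      by (rule tup[symmetric]) (rule S.\<pi>_in)
    also have "\<dots> = tuple G m (\<lambda>j. fs j (p j))"
      by (rule cong) (simp add: fs_def u_def)
    finally show ?thesis .
  qed
  have lip: "bi_lipschitz G ex V F"
  proof -
    obtain M where M: "M > 0" "\<And>p q. cdist (f' p) (f' q) \<le> M * cdist p q" "\<And>p q. cdist p q \<le> M * cdist (f' p) (f' q)"
      using S.f_bilipschitz by blast
    obtain M1 where M1: "M1 > 0" "\<And>p q. cdist (S.\<phi> p) (S.\<phi> q) \<le> M1 * cdist p q"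
      using S.hom_lipschitz[OF S.linear_\<phi> S.\<phi>_mul S.\<phi>_dil] by blast
    obtain M2 where M2: "M2 > 0" "\<And>p q. cdist (S.\<psi> p) (S.\<psi> q) \<le> M2 * cdist p q"
      using S.hom_lipschitz[OF S.linear_\<psi> S.\<psi>_mul S.\<psi>_dil] by blast
    \<comment> \<open>The upper bound for \<open>F\<close> involves the Lipschitz constant
      \<open>M2\<close> of the inverse of \<open>T\<close>; the lower one writes \<open>f\<close> as
      \<open>T\<close> after \<open>F\<close> and so involves the constant \<open>M1\<close> of
      \<open>T\<close>.\<close>
    define N where "N = max 1 (max (M2 * M) (M1 * M))"
    have N: "N \<ge> 1" "M2 * M \<le> N" "M1 * M \<le> N" by (auto simp: N_def)
    show ?thesis
      unfolding bi_lipschitz_def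
    proof (intro exI[of _ N] conjI ballI)
      show "1 \<le> N" by (rule N(1))
      fix p q assume pq: "p \<in> carrier G" "q \<in> carrier G"
      define x y where "x = glog ex p" and "y = glog ex q"
      have d: "carnot_dist G ex V p q = cdist x y" using pq by (simp add: carnot_dist_eq x_def y_def)
      have dF: "carnot_dist G ex V (F p) (F q) = cdist (S.\<psi> (f' x)) (S.\<psi> (f' y))"
        by (simp add: F_def dist_ex x_def y_def)
      have "cdist (S.\<psi> (f' x)) (S.\<psi> (f' y)) \<le> M2 * (M * cdist x y)"
        using M2 M(2)[of x y] by (meson mult_left_mono order_trans less_imp_le)
      also have "\<dots> \<le> N * cdist x y" using mult_right_mono[OF N(2) cdist_nonneg[of x y]] by (simp add: mult_ac)
      finally show "carnot_dist G ex V (F p) (F q) \<le> N * carnot_dist G ex V p q" by (simp add: d dF)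
      have "cdist (f' x) (f' y) \<le> M1 * cdist (S.\<psi> (f' x)) (S.\<psi> (f' y))"
        using M1(2)[of "S.\<psi> (f' x)" "S.\<psi> (f' y)"] by simp
      then have "cdist x y \<le> M * (M1 * cdist (S.\<psi> (f' x)) (S.\<psi> (f' y)))"
        using M(1) M(3)[of x y] by (meson mult_left_mono order_trans less_imp_le)
      also have "\<dots> \<le> N * cdist (S.\<psi> (f' x)) (S.\<psi> (f' y))"
        using mult_right_mono[OF N(3) cdist_nonneg[of "S.\<psi> (f' x)" "S.\<psi> (f' y)"]] by (simp add: mult_ac)
      finally show "carnot_dist G ex V p q / N \<le> carnot_dist G ex V (F p) (F q)"
        using N(1) by (simp add: d dF pos_divide_le_eq mult.commute)
    qed
  qed
  show ?thesis
  proof (rule exI[of _ T], rule exI[of _ "S.\<sigma> 0"], rule exI[of _ F], rule exI[of _ fs], intro conjI)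
    show "T \<in> aut_dilation G ex V l" by (rule T)
    show "S.\<sigma> 0 permutes {1..m}" by (rule S.\<sigma>(1)[OF S.regular])
    show "\<forall>j\<in>{1..m}. T ` (ex ` g j) = ex ` g (S.\<sigma> 0 j)" by (intro ballI Tg)
    show "\<forall>j\<in>{1..m}. fs j \<in> ex ` g j \<rightarrow> ex ` g j" by (intro ballI fs)
    show "\<forall>p. (\<forall>j\<in>{1..m}. p j \<in> ex ` g j) \<longrightarrow> F (tuple G m p) = tuple G m (\<lambda>j. fs j (p j))"
      by (intro allI impI Ft)
    show "bi_lipschitz G ex V F" by (rule lip)
    show "\<forall>p\<in>carrier G. f p = T (F p)" by (intro ballI TF)
  qed
qed

end
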